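(* Let $\alpha_{\mathbf P}\ge\alpha$ and let $\boldsymbol m_h^n\in\boldsymbol{\mathcal M}_h$ be given. Consider the preconditioned GMRES algorithm with the stationary preconditioner $\mathbf P^{\rm 2D}$ for the solution of $\mathbf P^{\rm 2D}\mathbf A_{\mathbf Q}[\boldsymbol m_h^n]\mathbf x=\mathbf P^{\rm 2D}\mathbf b_{\mathbf Q}[\boldsymbol m_h^n]$ with initial guess $\mathbf x^{(0)}\in\mathbb R^{2N}$. For $\ell\in\mathbb N_0$, let $\mathbf x^{(\ell)}\in\mathbb R^{2N}$ denote the GMRES iterates with residuals $\mathbf r^{(\ell)}:=\mathbf P^{\rm 2D}\mathbf b_{\mathbf Q}[\boldsymbol m_h^n]-\mathbf P^{\rm 2D}\mathbf A_{\mathbf Q}[\boldsymbol m_h^n]\mathbf x^{(\ell)}$. Let $1+(\mathbf T_n\boldsymbol m_h^n(z))_3\ge\gamma>0$ for all nodes $z\in\mathcal N_h$. Then there exists a constant $C>1$, which depends only on $C_{\rm mesh}$, such that for all $\ell\in\mathbb N_0$ $$|||\mathbf r^{(\ell)}|||\le\bigg[1-C^{-1}\Big(\frac{\alpha}{\alpha_{\mathbf P}}\Big)^2\bigg(1+\frac1{\alpha_{\mathbf P}}+\frac{\|W_k(\lambda_h^n)-\alpha_{\mathbf P}\|_{L^\infty(\Omega)}}{\alpha_{\mathbf P}}\bigg)^{-2}\mathbb F^{-4}\bigg]^{\ell/2}|||\mathbf r^{(0)}|||,$$ where $$\mathbb F:=1+\gamma^{-2}+\frac{\beta(k)k}{\alpha_{\mathbf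 P}\gamma^6}\|\nabla\boldsymbol m_h^n\|_{L^\infty(\Omega)}^2\ge1.$$
   Context: Mesh and spaces: $\Omega\subset\mathbb R^3$ is a bounded Lipschitz domain, $\mathcal T_h$ a triangulation of $\Omega$ into tetrahedra which is $C_{\rm mesh}$-quasi-uniform with mesh-size $h>0$, i.e. $h\le|K|^{1/3}\le\operatorname{diam}(K)\le C_{\rm mesh}h$ for all $K\in\mathcal T_h$. $\mathcal S_h$ is the space of continuous functions on $\Omega$ that are affine on each element, $\mathcal N_h=\{z_1,\dots,z_N\}$ the set of nodes, $\varphi_j\in\mathcal S_h$ the hat functions, $\boldsymbol{\mathcal S}_h=(\mathcal S_h)^3$ with basis $\boldsymbol\phi_{3(j-1)+\ell}:=\varphi_j\mathbf e_\ell$ ($\ell=1,2,3$), and $(\mathcal S_h)^2$ has the basis $\boldsymbol\psi_{2(j-1)+\ell}:=\varphi_j\mathbf e_\ell$ ($\ell=1,2$), $j=1,\dots,N$. $\boldsymbol{\mathcal M}_h:=\{\boldsymbol\varphi_h\in\boldsymbol{\mathcal S}_h:|\boldsymbol\varphi_h(z)|=1\ \forall z\in\mathcal N_h\}$. $\langle\cdot,\cdot\rangle_\Omega$ is the $L^2(\Omega)$-scalar product (also for vector- and matrix-valued functions); $L^\infty$-norms of vector/matrix-valued functions are taken with the pointwise Euclidean (Frobenius) norm. Data: $\alpha\in(0,1]$, $\ell_{\rm ex}>0$, $T>0$, time-step size $k=T/M$ with $M\in\mathbb N$, $t_n=kn$, $0\le n<M$; $\boldsymbol m_h^{n-1}\in\boldsymbol{\mathcal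 M}_h$. $\boldsymbol\pi:H^1(\Omega)^3\to L^2(\Omega)^3$ is a bounded operator, $\boldsymbol f\in C^1([0,T],L^2(\Omega)^3)$. $\beta:\mathbb R_{>0}\to\mathbb R_{>0}$ and the (bounded, measurable) functions $W_k:\mathbb R\to\mathbb R_{>0}$ satisfy $\lim_{k\to0}\|W_k-\alpha\|_{L^\infty(\mathbb R)}=0$, $\inf_{k>0}\inf_{s\in\mathbb R}W_k(s)\ge\alpha/2>0$, $\lim_{k\to0}\beta(k)k=0$. $\lambda_h^n:=-\ell_{\rm ex}^2|\nabla\boldsymbol m_h^n|^2+(\boldsymbol f(t_n)+\boldsymbol\pi(\boldsymbol m_h^n))\cdot\boldsymbol m_h^n$. $\boldsymbol L_h(\boldsymbol m_h^n,\boldsymbol m_h^{n-1})\in L^2(\Omega)^3$ is a given function. Matrices: $\mathbf M_k[\boldsymbol m_h^n]_{ij}:=\langle(W_k(\lambda_h^n)/\alpha)\boldsymbol\phi_i,\boldsymbol\phi_j\rangle_\Omega$, $\mathbf L_{ij}:=\langle\nabla\boldsymbol\phi_i,\nabla\boldsymbol\phi_j\rangle_\Omega$, $\mathbf S[\boldsymbol m_h^n]_{ij}:=\langle\boldsymbol m_h^n\times\boldsymbol\phi_i,\boldsymbol\phi_j\rangle_\Omega$ (all in $\mathbb R^{3N\times3N}$), $\mathbf A_k[\boldsymbol m_h^n]:=\alpha\mathbf M_k[\boldsymbol m_h^n]+\beta(k)k\,\mathbf L-\mathbf S[\boldsymbol m_h^n]$; $\mathbf b[\boldsymbol m_h^n]_j:=-\ell_{\rm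 ex}^2\langle\nabla\boldsymbol m_h^n,\nabla\boldsymbol\phi_j\rangle_\Omega+\langle\boldsymbol L_h(\boldsymbol m_h^n,\boldsymbol m_h^{n-1}),\boldsymbol\phi_j\rangle_\Omega$; $\mathbf M^{\rm 2D}_{ij}:=\langle\boldsymbol\psi_i,\boldsymbol\psi_j\rangle_\Omega$, $\mathbf L^{\rm 2D}_{ij}:=\langle\nabla\boldsymbol\psi_i,\nabla\boldsymbol\psi_j\rangle_\Omega$ (in $\mathbb R^{2N\times2N}$). Householder matrices: for $\mathbf m\in\mathbb R^3$ with $|\mathbf m|=1$, $\widetilde{\mathbf H}[\mathbf m]:=\mathbf I-2\mathbf w\mathbf w^T$ with $\mathbf w:=(\mathbf m+\mathbf e_3)/|\mathbf m+\mathbf e_3|$ if $\mathbf m\ne-\mathbf e_3$, and $\widetilde{\mathbf H}[-\mathbf e_3]:=[\mathbf e_1,\mathbf e_2,-\mathbf e_3]$; $\mathbf H[\mathbf m]:=[\widetilde{\mathbf H}[\mathbf m]\mathbf e_1,\widetilde{\mathbf H}[\mathbf m]\mathbf e_2]\in\mathbb R^{3\times2}$. $\mathbf T_n\in\mathbb R^{3\times3}$ is a fixed matrix with $\mathbf T_n=\mathbf T_n^{-1}=\mathbf T_n^T$. $\mathbf Q[\boldsymbol m_h^n]\in\mathbb R^{3N\times2N}$ is block-diagonal with $i$-th diagonal block $\mathbf T_n\mathbf H[\mathbf T_n\boldsymbol m_h^n(z_i)]$. System and preconditioner: $\mathbf A_{\mathbf Q}[\boldsymbol m_h^n]:=\mathbf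 Q[\boldsymbol m_h^n]^T\mathbf A_k[\boldsymbol m_h^n]\mathbf Q[\boldsymbol m_h^n]$, $\mathbf b_{\mathbf Q}[\boldsymbol m_h^n]:=\mathbf Q[\boldsymbol m_h^n]^T\mathbf b[\boldsymbol m_h^n]$. With a parameter $\alpha_{\mathbf P}>0$, $\mathbf P^{\rm 2D}:=(\alpha_{\mathbf P}\mathbf M^{\rm 2D}+\beta(k)k\,\mathbf L^{\rm 2D})^{-1}$ and $|||\mathbf x|||^2:=\mathbf x\cdot(\alpha_{\mathbf P}\mathbf M^{\rm 2D}+\beta(k)k\,\mathbf L^{\rm 2D})\mathbf x$ for $\mathbf x\in\mathbb R^{2N}$. GMRES with symmetric positive definite preconditioner $\mathbf P$ for $\mathbf P\mathbf A\mathbf x=\mathbf P\mathbf b$ is understood with respect to the scalar product $\mathbf x\cdot\mathbf P^{-1}\mathbf y$: the iterate $\mathbf x^{(\ell)}$ minimizes $\mathbf x\mapsto|||\mathbf P\mathbf b-\mathbf P\mathbf A\mathbf x|||$, $|||\mathbf y|||^2=\mathbf y\cdot\mathbf P^{-1}\mathbf y$, over $\mathbf x^{(0)}+\operatorname{span}\{(\mathbf P\mathbf A)^j\mathbf r^{(0)}:0\le j\le\ell-1\}$, where $\mathbf r^{(0)}=\mathbf P\mathbf b-\mathbf P\mathbf A\mathbf x^{(0)}$. *)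

theory Defs
  imports
    "Jordan_Normal_Form.VS_Connect"
    "Jordan_Normal_Form.Gauss_Jordan_Elimination"
    "HOL-Analysis.Analysis"
    "HOL-Probability.Essential_Supremum"
begin

text \<open>From here on, \<open>$\<close> is only component selection in \<open>real^n\<close>.\<close>

no_notation vec_index (infixl \<open>$\<close> 100)

section \<open>Function spaces on a domain\<close>

definition lipschitz_domain :: "(real^3) set \<Rightarrow> bool" where
  "lipschitz_domain \<Omega> \<longleftrightarrow>
     open \<Omega> \<and> connected \<Omega> \<and> \<Omega> \<noteq> {} \<and>
     (\<forall>p\<in>frontier \<Omega>. \<exists>U (R :: real^3 \<Rightarrow> real^3) (g :: real \<times> real \<Rightarrow> real) L.
        open U \<and> p \<in> U \<and> orthogonal_transformation R \<and> L-lipschitz_on UNIV g \<and>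
        \<Omega> \<inter> U = {y\<in>U. g (R y $ 1, R y $ 2) < R y $ 3})"

text \<open>Functions on \<open>\<Omega>\<close> are total functions on \<open>real^3\<close> whose values outside the closure of
  \<open>\<Omega>\<close> are irrelevant; elements of \<open>L\<^sup>2\<close> are represented by functions, not by classes.\<close>

definition L2_space :: "(real^3) set \<Rightarrow> (real^3 \<Rightarrow> 'b::euclidean_space) set" where
  "L2_space \<Omega> = {v \<in> borel_measurable (lebesgue_on \<Omega>).
     integrable (lebesgue_on \<Omega>) (\<lambda>x. (norm (v x))\<^sup>2)}"

definition L2_inner ::
    "(real^3) set \<Rightarrow> (real^3 \<Rightarrow> 'b::euclidean_space) \<Rightarrow> (real^3 \<Rightarrow> 'b) \<Rightarrow> real" where
  "L2_inner \<Omega> u v = (LINT x|lebesgue_on \<Omega>. inner (u x) (v x))"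

definition L2_norm :: "(real^3) set \<Rightarrow> (real^3 \<Rightarrow> 'b::euclidean_space) \<Rightarrow> real" where
  "L2_norm \<Omega> v = sqrt (L2_inner \<Omega> v v)"

text \<open>On \<open>real^m^n\<close> the library norm (inner product) is the Frobenius norm (inner product).\<close>

definition Linf_norm :: "'a measure \<Rightarrow> ('a \<Rightarrow> 'b::euclidean_space) \<Rightarrow> real" where
  "Linf_norm \<mu> v = real_of_ereal (esssup \<mu> (\<lambda>x. ereal (norm (v x))))"

primrec C_k :: "nat \<Rightarrow> (real^3 \<Rightarrow> real) \<Rightarrow> bool" where
  "C_k 0 \<eta> = continuous_on UNIV \<eta>"
| "C_k (Suc m) \<eta> = ((\<forall>x. \<eta> differentiable at x) \<and>
     (\<forall>j. C_k m (\<lambda>x. frechet_derivative \<eta> (at x) (axis j 1))))"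

definition test_function :: "(real^3) set \<Rightarrow> (real^3 \<Rightarrow> real) \<Rightarrow> bool" where
  "test_function \<Omega> \<eta> \<longleftrightarrow>
     (\<forall>m. C_k m \<eta>) \<and> compact (closure {x. \<eta> x \<noteq> 0}) \<and> closure {x. \<eta> x \<noteq> 0} \<subseteq> \<Omega>"

definition weak_gradient ::
    "(real^3) set \<Rightarrow> (real^3 \<Rightarrow> real^3) \<Rightarrow> (real^3 \<Rightarrow> real^3^3) \<Rightarrow> bool" where
  "weak_gradient \<Omega> v G \<longleftrightarrow>
     (\<forall>\<eta> i j. test_function \<Omega> \<eta> \<longrightarrow>
        (LINT x|lebesgue_on \<Omega>. v x $ i * frechet_derivative \<eta> (at x) (axis j 1)) =
        - (LINT x|lebesgue_on \<Omega>. G x $ i $ j * \<eta> x))"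

definition H1_space :: "(real^3) set \<Rightarrow> (real^3 \<Rightarrow> real^3) set" where
  "H1_space \<Omega> = {v \<in> L2_space \<Omega>. \<exists>G\<in>L2_space \<Omega>. weak_gradient \<Omega> v G}"

text \<open>The weak gradient is unique almost everywhere, so the bound below is by the
  \<open>H\<^sup>1\<close>-norm. The second conjunct says that the operator is well defined on classes. Linearity
  is not part of the definition.\<close>

definition bounded_operator_H1_L2 ::
    "(real^3) set \<Rightarrow> ((real^3 \<Rightarrow> real^3) \<Rightarrow> real^3 \<Rightarrow> real^3) \<Rightarrow> bool" where
  "bounded_operator_H1_L2 \<Omega> \<pi> \<longleftrightarrow>
     (\<forall>v\<in>H1_space \<Omega>. \<pi> v \<in> L2_space \<Omega>) \<and>
     (\<forall>v\<in>H1_space \<Omega>. \<forall>w\<in>H1_space \<Omega>. (AE x in lebesgue_on \<Omega>. v x = w x) \<longrightarrow>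
        (AE x in lebesgue_on \<Omega>. \<pi> v x = \<pi> w x)) \<and>
     (\<exists>c. \<forall>v\<in>L2_space \<Omega>. \<forall>G\<in>L2_space \<Omega>. weak_gradient \<Omega> v G \<longrightarrow>
        L2_norm \<Omega> (\<pi> v) \<le> c * sqrt ((L2_norm \<Omega> v)\<^sup>2 + (L2_norm \<Omega> G)\<^sup>2))"

definition C1_into_L2 :: "(real^3) set \<Rightarrow> real \<Rightarrow> (real \<Rightarrow> real^3 \<Rightarrow> real^3) \<Rightarrow> bool" where
  "C1_into_L2 \<Omega> T f \<longleftrightarrow> (\<exists>f'. \<forall>t\<in>{0..T}.
     f t \<in> L2_space \<Omega> \<and> f' t \<in> L2_space \<Omega> \<and>
     ((\<lambda>s. L2_norm \<Omega> (\<lambda>x. (f s x - f t x) /\<^sub>R (s - t) - f' t x)) \<longlongrightarrow> 0) (at t within {0..T}) \<and>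
     ((\<lambda>s. L2_norm \<Omega> (\<lambda>x. f' s x - f' t x)) \<longlongrightarrow> 0) (at t within {0..T}))"

section \<open>Mesh and finite element spaces\<close>

definition quasi_uniform_mesh ::
    "real \<Rightarrow> real \<Rightarrow> (real^3) set \<Rightarrow> (real^3) set set \<Rightarrow> bool" where
  "quasi_uniform_mesh Cmesh h \<Omega> \<T> \<longleftrightarrow>
     triangulation \<T> \<and> (\<forall>K\<in>\<T>. 3 simplex K) \<and> \<Union>\<T> = closure \<Omega> \<and>
     (\<forall>K\<in>\<T>. h \<le> root 3 (measure lebesgue K) \<and> root 3 (measure lebesgue K) \<le> diameter K \<and>
        diameter K \<le> Cmesh * h)"

definition nodes :: "(real^3) set set \<Rightarrow> (real^3) set" where
  "nodes \<T> = (\<Union>K\<in>\<T>. {p. p extreme_point_of K})"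

definition P1_space :: "(real^3) set \<Rightarrow> (real^3) set set \<Rightarrow> (real^3 \<Rightarrow> real) set" where
  "P1_space \<Omega> \<T> = {v. continuous_on (closure \<Omega>) v \<and>
     (\<forall>K\<in>\<T>. \<exists>a b. \<forall>x\<in>K. v x = inner a x + b)}"

definition unit_P1_space :: "(real^3) set \<Rightarrow> (real^3) set set \<Rightarrow> (real^3 \<Rightarrow> real^3) set" where
  "unit_P1_space \<Omega> \<T> = {v. (\<forall>i. (\<lambda>x. v x $ i) \<in> P1_space \<Omega> \<T>) \<and> (\<forall>p\<in>nodes \<T>. norm (v p) = 1)}"

definition hat_functions ::
    "(real^3) set \<Rightarrow> (real^3) set set \<Rightarrow> nat \<Rightarrow> (nat \<Rightarrow> real^3) \<Rightarrow> (nat \<Rightarrow> real^3 \<Rightarrow> real) \<Rightarrow> bool" where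
  "hat_functions \<Omega> \<T> N z \<phi> \<longleftrightarrow>
     (\<forall>j<N. \<phi> j \<in> P1_space \<Omega> \<T> \<and> (\<forall>i<N. \<phi> j (z i) = (if i = j then 1 else 0)))"

text \<open>All indices of nodes, vectors and matrices start at 0, so \<open>d * j + l\<close> with \<open>l < d\<close> stands for
  node \<open>j\<close> and Cartesian direction \<open>l + 1\<close>; in the finite index types \<open>2\<close> and \<open>3\<close> the numerals
  are read modulo the cardinality, which makes \<open>of_nat (l + 1)\<close> the intended index.\<close>

definition phi :: "(nat \<Rightarrow> real^3 \<Rightarrow> real) \<Rightarrow> nat \<Rightarrow> real^3 \<Rightarrow> real^3" where
  "phi \<phi> i x = \<phi> (i div 3) x *\<^sub>R axis (of_nat (i mod 3 + 1)) 1"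

definition psi :: "(nat \<Rightarrow> real^3 \<Rightarrow> real) \<Rightarrow> nat \<Rightarrow> real^3 \<Rightarrow> real^2" where
  "psi \<phi> i x = \<phi> (i div 2) x *\<^sub>R axis (of_nat (i mod 2 + 1)) 1"

text \<open>For piecewise affine functions the classical Jacobian exists off the element boundaries,
  i.e. almost everywhere; its value elsewhere is arbitrary and does not matter.\<close>

definition grad :: "(real^3 \<Rightarrow> real^'d) \<Rightarrow> real^3 \<Rightarrow> real^3^'d" where
  "grad v x = jacobian v (at x)"

section \<open>Linear systems\<close>

definition mass3 ::
    "(real^3) set \<Rightarrow> nat \<Rightarrow> (nat \<Rightarrow> real^3 \<Rightarrow> real) \<Rightarrow> (real^3 \<Rightarrow> real) \<Rightarrow> real Matrix.mat" where
  "mass3 \<Omega> N \<phi> \<omega> = Matrix.mat (3 * N) (3 * N)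
     (\<lambda>(i, j). L2_inner \<Omega> (\<lambda>x. \<omega> x *\<^sub>R phi \<phi> i x) (phi \<phi> j))"

definition stiff3 :: "(real^3) set \<Rightarrow> nat \<Rightarrow> (nat \<Rightarrow> real^3 \<Rightarrow> real) \<Rightarrow> real Matrix.mat" where
  "stiff3 \<Omega> N \<phi> = Matrix.mat (3 * N) (3 * N)
     (\<lambda>(i, j). L2_inner \<Omega> (grad (phi \<phi> i)) (grad (phi \<phi> j)))"

definition skew3 ::
    "(real^3) set \<Rightarrow> nat \<Rightarrow> (nat \<Rightarrow> real^3 \<Rightarrow> real) \<Rightarrow> (real^3 \<Rightarrow> real^3) \<Rightarrow> real Matrix.mat" where
  "skew3 \<Omega> N \<phi> m = Matrix.mat (3 * N) (3 * N)
     (\<lambda>(i, j). L2_inner \<Omega> (\<lambda>x. cross3 (m x) (phi \<phi> i x)) (phi \<phi> j))"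

definition mass2 :: "(real^3) set \<Rightarrow> nat \<Rightarrow> (nat \<Rightarrow> real^3 \<Rightarrow> real) \<Rightarrow> real Matrix.mat" where
  "mass2 \<Omega> N \<phi> = Matrix.mat (2 * N) (2 * N) (\<lambda>(i, j). L2_inner \<Omega> (psi \<phi> i) (psi \<phi> j))"

definition stiff2 :: "(real^3) set \<Rightarrow> nat \<Rightarrow> (nat \<Rightarrow> real^3 \<Rightarrow> real) \<Rightarrow> real Matrix.mat" where
  "stiff2 \<Omega> N \<phi> = Matrix.mat (2 * N) (2 * N)
     (\<lambda>(i, j). L2_inner \<Omega> (grad (psi \<phi> i)) (grad (psi \<phi> j)))"

definition lambda_fun ::
    "real \<Rightarrow> (real^3 \<Rightarrow> real^3) \<Rightarrow> ((real^3 \<Rightarrow> real^3) \<Rightarrow> real^3 \<Rightarrow> real^3) \<Rightarrow> (real^3 \<Rightarrow> real^3) \<Rightarrow>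
     real^3 \<Rightarrow> real" where
  "lambda_fun l_ex ft \<pi> m x = - l_ex\<^sup>2 * (norm (grad m x))\<^sup>2 + inner (ft x + \<pi> m x) (m x)"

text \<open>In \<open>system_matrix\<close> and \<open>system_rhs\<close>, \<open>\<omega>\<close> is \<open>W\<^sub>k(\<lambda>)\<close>, \<open>\<kappa>\<close> is \<open>\<beta>(k) k\<close> and \<open>\<Lambda>\<close> is the
  \<open>L\<^sup>2\<close>-function on the right-hand side.\<close>

definition system_matrix ::
    "(real^3) set \<Rightarrow> nat \<Rightarrow> (nat \<Rightarrow> real^3 \<Rightarrow> real) \<Rightarrow> real \<Rightarrow> real \<Rightarrow> (real^3 \<Rightarrow> real) \<Rightarrow>
     (real^3 \<Rightarrow> real^3) \<Rightarrow> real Matrix.mat" where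
  "system_matrix \<Omega> N \<phi> \<alpha> \<kappa> \<omega> m =
     \<alpha> \<cdot>\<^sub>m mass3 \<Omega> N \<phi> (\<lambda>x. \<omega> x / \<alpha>) + \<kappa> \<cdot>\<^sub>m stiff3 \<Omega> N \<phi> - skew3 \<Omega> N \<phi> m"

definition system_rhs ::
    "(real^3) set \<Rightarrow> nat \<Rightarrow> (nat \<Rightarrow> real^3 \<Rightarrow> real) \<Rightarrow> real \<Rightarrow> (real^3 \<Rightarrow> real^3) \<Rightarrow>
     (real^3 \<Rightarrow> real^3) \<Rightarrow> real Matrix.vec" where
  "system_rhs \<Omega> N \<phi> l_ex \<Lambda> m = Matrix.vec (3 * N)
     (\<lambda>j. - l_ex\<^sup>2 * L2_inner \<Omega> (grad m) (grad (phi \<phi> j)) + L2_inner \<Omega> \<Lambda> (phi \<phi> j))"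

definition householder_tilde :: "real^3 \<Rightarrow> real^3^3" where
  "householder_tilde m =
     (if m \<noteq> - axis 3 1
      then let w = (m + axis 3 1) /\<^sub>R norm (m + axis 3 1)
           in Finite_Cartesian_Product.mat 1 - 2 *\<^sub>R (\<chi> i j. w $ i * w $ j)
      else (\<chi> i j. (if j = 1 then axis 1 1 else if j = 2 then axis 2 1 else - axis 3 1) $ i))"

definition householder :: "real^3 \<Rightarrow> real^2^3" where
  "householder m = (\<chi> i j. (householder_tilde m *v (if j = 1 then axis 1 1 else axis 2 1)) $ i)"

definition Q_matrix ::
    "nat \<Rightarrow> (nat \<Rightarrow> real^3) \<Rightarrow> real^3^3 \<Rightarrow> (real^3 \<Rightarrow> real^3) \<Rightarrow> real Matrix.mat" where
  "Q_matrix N z Tn m = Matrix.mat (3 * N) (2 * N)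
     (\<lambda>(i, j). if i div 3 = j div 2
        then (Tn ** householder (Tn *v m (z (i div 3)))) $ of_nat (i mod 3 + 1) $ of_nat (j mod 2 + 1)
        else 0)"

section \<open>Preconditioned GMRES\<close>

definition mat_inv :: "real Matrix.mat \<Rightarrow> real Matrix.mat" where
  "mat_inv A = the (mat_inverse A)"

definition energy_norm :: "real Matrix.mat \<Rightarrow> real Matrix.vec \<Rightarrow> real" where
  "energy_norm B x = sqrt (scalar_prod x (B *\<^sub>v x))"

definition pgmres_residual ::
    "real Matrix.mat \<Rightarrow> real Matrix.mat \<Rightarrow> real Matrix.vec \<Rightarrow> real Matrix.vec \<Rightarrow> real Matrix.vec" where
  "pgmres_residual P A b x = P *\<^sub>v b - (P * A) *\<^sub>v x"

definition pgmres_search_space ::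
    "real Matrix.mat \<Rightarrow> real Matrix.mat \<Rightarrow> real Matrix.vec \<Rightarrow> real Matrix.vec \<Rightarrow> nat \<Rightarrow>
     real Matrix.vec set" where
  "pgmres_search_space P A b x0 l =
     {x0 + v | v. v \<in> LinearCombinations.module.span class_ring (module_vec TYPE(real) (dim_vec x0))
        {((P * A) ^\<^sub>m j) *\<^sub>v pgmres_residual P A b x0 | j. j < l}}"

definition pgmres_iterates ::
    "real Matrix.mat \<Rightarrow> real Matrix.mat \<Rightarrow> real Matrix.vec \<Rightarrow> real Matrix.vec \<Rightarrow>
     (nat \<Rightarrow> real Matrix.vec) \<Rightarrow> bool" where
  "pgmres_iterates P A b x0 x \<longleftrightarrow>
     (\<forall>l. x l \<in> pgmres_search_space P A b x0 l \<and>
       (\<forall>y\<in>pgmres_search_space P A b x0 l.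
          energy_norm (mat_inv P) (pgmres_residual P A b (x l))
          \<le> energy_norm (mat_inv P) (pgmres_residual P A b y)))"

end

theory Submission
  imports Defs
begin

text \<open>GMRES reduces the energy norm of the residual at least as fast as the minimal residual
  iteration, whose rate is \<open>1 - (c\<^sub>1 / c\<^sub>2)\<^sup>2\<close> for a system matrix with coercivity constant \<open>c\<^sub>1\<close>
  and bound \<open>c\<^sub>2\<close> in the energy norm of the preconditioner. Both constants come from comparing
  the energies of the finite element functions \<open>v\<close> with coefficients \<open>x\<close> and \<open>u\<close> with coefficients
  \<open>Q x\<close>. At a node \<open>p\<close> we have \<open>u(p) = G(p) v(p)\<close> with an isometry \<open>G(p)\<close> that is Lipschitz in
  \<open>m(p)\<close>, with constant of order \<open>\<gamma> powr (- 1 / 2)\<close>. On an element, \<open>L\<^sup>2\<close>-norms are equivalent to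
  the maximum over the vertices and gradients are equivalent to differences of nodal values
  divided by \<open>h\<close>. Hence the \<open>L\<^sup>2\<close>-norms of \<open>u\<close> and \<open>v\<close> are equivalent, and the gradients are
  comparable up to the term in which \<open>G\<close> is differenced, which costs
  \<open>\<parallel>\<nabla>m\<parallel>\<^sup>2 / \<gamma>\<close> times the \<open>L\<^sup>2\<close>-norm: this is the factor \<open>F\<close>, once in \<open>c\<^sub>1\<close> and once in \<open>c\<^sub>2\<close>.
  Measurability of the coefficient \<open>W\<^sub>k(\<lambda>)\<close> requires \<open>\<pi>(m)\<close> to be an \<open>L\<^sup>2\<close>-function, hence \<open>m\<close> to have
  a weak gradient.\<close>

section \<open>Convergence of preconditioned GMRES\<close>

text \<open>\<open>C\<close> is fixed before the domain and the mesh, so no constant may come from a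
  compactness argument over element shapes. Every element estimate is proved directly from volume at
  least \<open>h ^ 3\<close> and diameter at most \<open>Cm * h\<close>: gradients are bounded by
  enclosing the element in a thin box, L2-norms are bounded below on a shrunken copy. The powers of
  \<open>h\<close> cancel in each comparison, which leaves a polynomial in \<open>Cm\<close>. The
  energies have to be compared in both directions: coercivity is available for \<open>u\<close> and
  must be carried back to \<open>v\<close>, boundedness needs the converse. Each direction costs
  \<open>c3 * F\<close> with \<open>c3\<close> depending on \<open>Cm\<close> only, so
  \<open>c1 / c2\<close> carries the inverse square of it and the rate the inverse fourth power.
  Together with the lower bound \<open>\<alpha> / 2\<close> of the coefficient this yields
  \<open>C = 4 * c3 ^ 4\<close>. The skew term vanishes in the quadratic form and costs only the
  summand \<open>1 / \<alpha>P\<close> in the upper bound. What threatens the gradient comparison is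
  the pole \<open>- axis 3 1\<close>, where the Householder normal is singular;
  \<open>\<gamma>\<close> keeps the nodal values away from it.\<close>

text \<open>Positive definiteness excludes a nonzero kernel vector, so the determinant is nonzero
  and \<open>mat_inverse\<close> succeeds. The last claim is what makes GMRES with
  \<open>P = mat_inv B\<close> minimise in the energy norm of \<open>B\<close>, since
  \<open>pgmres_iterates\<close> speaks of \<open>mat_inv P\<close>.\<close>

lemma mat_inv_pos_def:
  assumes B: "B \<in> carrier_mat n n"
    and pos: "\<And>x. x \<in> carrier_vec n \<Longrightarrow> x \<noteq> 0\<^sub>v n \<Longrightarrow> 0 < scalar_prod x (B *\<^sub>v x)"
  shows "mat_inv B \<in> carrier_mat n n" and "mat_inv B * B = 1\<^sub>m n" and "B * mat_inv B = 1\<^sub>m n"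
    and "mat_inv (mat_inv B) = B"
proof -
  have nonsing: "Determinant.det B \<noteq> 0"
    using det_0_iff_vec_prod_zero_field[OF B] pos by fastforce
  then have "mat_inverse B \<noteq> None"
    using mat_inverse(1)[OF B, of "()"] det_non_zero_imp_unit[OF B, of "()"] by blast
  then obtain P where "mat_inverse B = Some P"
    by auto
  then have P: "mat_inv B = P" "B * P = 1\<^sub>m n" "P * B = 1\<^sub>m n" "P \<in> carrier_mat n n"
    using mat_inverse(2)[OF B] by (auto simp: mat_inv_def)
  then show "mat_inv B \<in> carrier_mat n n" "mat_inv B * B = 1\<^sub>m n" "B * mat_inv B = 1\<^sub>m n"
    by auto
  have "Determinant.det P \<noteq> 0"
    using P(2) det_mult[OF B P(4)] by auto
  then have "mat_inverse P \<noteq> None"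
    using mat_inverse(1)[OF P(4), of "()"] det_non_zero_imp_unit[OF P(4), of "()"] by blast
  then obtain B' where "mat_inverse P = Some B'"
    by auto
  then have B': "mat_inv P = B'" "P * B' = 1\<^sub>m n" "B' \<in> carrier_mat n n"
    using mat_inverse(2)[OF P(4)] by (auto simp: mat_inv_def)
  have "B' = (B * P) * B'"
    using B' P by simp
  also have "\<dots> = B * (P * B')"
    by (rule assoc_mult_mat[OF B P(4) B'(3)])
  also have "\<dots> = B"
    using B' B by simp
  finally show "mat_inv (mat_inv B) = B"
    using P B' by simp
qed

text \<open>The preimage of \<open>span S'\<close> under \<open>G\<close> is a submodule, so it
  contains \<open>span S\<close> as soon as it contains \<open>S\<close>.\<close>

lemma (in vec_space) mult_mat_vec_span:
  assumes G: "G \<in> carrier_mat n n" and S: "S \<subseteq> carrier_vec n" and S': "S' \<subseteq> carrier_vec n"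
    and GS: "\<And>v. v \<in> S \<Longrightarrow> G *\<^sub>v v \<in> span S'" and v: "v \<in> span S"
  shows "G *\<^sub>v v \<in> span S'"
proof -
  interpret S': LinearCombinations.submodule class_ring "span S'" V
    using span_is_submodule[OF S'] .
  have "LinearCombinations.submodule class_ring {v \<in> carrier_vec n. G *\<^sub>v v \<in> span S'} V"
  proof (unfold_locales, goal_cases)
    case (2 v w)
    then show ?case
      using mult_add_distrib_mat_vec[OF G, of v w] S'.m_closed by auto
  next
    case 3
    have "G *\<^sub>v 0\<^sub>v n = 0\<^sub>v n"
      using G by auto
    then show ?case
      using S'.zero_closed by auto
  next
    case (4 c v)
    then show ?case
      using mult_mat_vec[OF G, of v c] S'.smult_closed by auto
  qed auto
  from span_is_subset[OF _ this] GS S v show ?thesis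
    by blast
qed

text \<open>The Krylov space of order \<open>l + 1\<close> contains the residual of every element of the search
  space of order \<open>l\<close>, so the step of the minimal residual iteration is admissible for GMRES.\<close>

lemma pgmres_search_space_step:
  assumes G: "P * A \<in> carrier_mat n n" and P: "P \<in> carrier_mat n n" and b: "b \<in> carrier_vec n"
    and x0: "x0 \<in> carrier_vec n" and y: "y \<in> pgmres_search_space P A b x0 l"
  shows "y \<in> carrier_vec n"
    and "y + t \<cdot>\<^sub>v pgmres_residual P A b y \<in> pgmres_search_space P A b x0 (Suc l)"
proof -
  interpret V: vec_space "TYPE(real)" n .
  define r where "r = pgmres_residual P A b x0"
  define K where "K j = {((P * A) ^\<^sub>m i) *\<^sub>v r | i. i < j}" for j
  have r: "r \<in> carrier_vec n"
    using G P b x0 by (auto simp: r_def pgmres_residual_def)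
  have K: "K j \<subseteq> carrier_vec n" for j
    using mult_mat_vec_carrier[OF pow_carrier_mat[OF G] r] by (auto simp: K_def)
  have dim: "dim_vec x0 = n"
    using x0 by auto
  obtain v where v: "v \<in> V.span (K l)" "y = x0 + v"
    using y unfolding pgmres_search_space_def K_def r_def dim by auto
  have vc: "v \<in> carrier_vec n"
    using v(1) V.span_is_subset2[OF K] by auto
  show y': "y \<in> carrier_vec n"
    using v vc x0 by auto
  have "(P * A) *\<^sub>v w \<in> V.span (K (Suc l))" if w: "w \<in> K l" for w
  proof -
    obtain i where i: "i < l" "w = ((P * A) ^\<^sub>m i) *\<^sub>v r"
      using w unfolding K_def by blast
    have "(P * A) *\<^sub>v w = ((P * A) * (P * A) ^\<^sub>m i) *\<^sub>v r"
      using i assoc_mult_mat_vec[OF G pow_carrier_mat[OF G] r] by simp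
    \<comment> \<open>Matrix powers append the new factor on the right, so a factor on the left has
      to be moved through by induction.\<close>
    also have "(P * A) * (P * A) ^\<^sub>m i = (P * A) ^\<^sub>m (Suc i)"
      using G P right_mult_one_mat[OF G]
      by (induction i) (simp_all flip: assoc_mult_mat[OF G pow_carrier_mat[OF G] G])
    finally have "(P * A) *\<^sub>v w \<in> K (Suc l)"
      unfolding K_def using i by blast
    then show ?thesis
      using V.in_own_span[OF K] by blast
  qed
  from V.mult_mat_vec_span[OF G K K this v(1)] have Gv: "(P * A) *\<^sub>v v \<in> V.span (K (Suc l))" .
  have "r \<in> K (Suc l)"
    using r G by (auto simp: K_def intro!: exI[of _ 0])
  then have rK: "r \<in> V.span (K (Suc l))"
    using V.in_own_span[OF K] by blast
  have vK: "v \<in> V.span (K (Suc l))"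
    using v(1) V.span_is_monotone[of "K l" "K (Suc l)"] by (force simp: K_def)
  have res: "pgmres_residual P A b y = r + (-1) \<cdot>\<^sub>v ((P * A) *\<^sub>v v)"
    unfolding pgmres_residual_def r_def v(2) mult_add_distrib_mat_vec[OF G x0 vc]
    using G P b x0 vc by (intro eq_vecI) (auto simp: algebra_simps)
  have rc: "pgmres_residual P A b y \<in> carrier_vec n"
    unfolding res using r vc G by auto
  interpret S: LinearCombinations.submodule class_ring "V.span (K (Suc l))" "module_vec TYPE(real) n"
    using V.span_is_submodule[OF K] .
  have "v + t \<cdot>\<^sub>v pgmres_residual P A b y \<in> V.span (K (Suc l))"
    unfolding res using S.m_closed S.smult_closed rK Gv vK by (auto simp: class_ring_simps module_vec_simps)
  moreover have "y + t \<cdot>\<^sub>v pgmres_residual P A b y = x0 + (v + t \<cdot>\<^sub>v pgmres_residual P A b y)"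
    using assoc_add_vec[OF x0 vc, of "t \<cdot>\<^sub>v pgmres_residual P A b y"] rc v(2) by simp
  ultimately show "y + t \<cdot>\<^sub>v pgmres_residual P A b y \<in> pgmres_search_space P A b x0 (Suc l)"
    unfolding pgmres_search_space_def K_def r_def dim by blast
qed

text \<open>The upper bound on \<open>A\<close> is stated in the form that Young's inequality delivers for forms
  defined by integrals; it gives \<open>|P A x| \<le> c\<^sub>2 |x|\<close> in the energy norm, with \<open>y = P A x\<close>.\<close>

proposition pgmres_residual_step:
  assumes A: "A \<in> carrier_mat n n" and B: "B \<in> carrier_mat n n"
    and b: "b \<in> carrier_vec n" and x0: "x0 \<in> carrier_vec n"
    and sym: "\<And>x y. x \<in> carrier_vec n \<Longrightarrow> y \<in> carrier_vec n \<Longrightarrow>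
      scalar_prod x (B *\<^sub>v y) = scalar_prod y (B *\<^sub>v x)"
    and pos: "\<And>x. x \<in> carrier_vec n \<Longrightarrow> x \<noteq> 0\<^sub>v n \<Longrightarrow> 0 < scalar_prod x (B *\<^sub>v x)"
    and c1: "0 < c1" and c2: "0 < c2"
    and lower: "\<And>x. x \<in> carrier_vec n \<Longrightarrow> c1 * scalar_prod x (B *\<^sub>v x) \<le> scalar_prod x (A *\<^sub>v x)"
    and upper: "\<And>x y. x \<in> carrier_vec n \<Longrightarrow> y \<in> carrier_vec n \<Longrightarrow>
      2 * scalar_prod y (A *\<^sub>v x) \<le> c2\<^sup>2 * scalar_prod x (B *\<^sub>v x) + scalar_prod y (B *\<^sub>v y)"
    and it: "pgmres_iterates (mat_inv B) A b x0 x"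
  defines "r \<equiv> \<lambda>l. pgmres_residual (mat_inv B) A b (x l)"
  shows "(energy_norm B (r (Suc l)))\<^sup>2 \<le> (1 - (c1 / c2)\<^sup>2) * (energy_norm B (r l))\<^sup>2"
    and "0 \<le> energy_norm B (r l)"
proof -
  define P where "P = mat_inv B"
  define E where "E y = scalar_prod y (B *\<^sub>v y)" for y
  have P: "P \<in> carrier_mat n n" "P * B = 1\<^sub>m n" "B * P = 1\<^sub>m n" "mat_inv P = B"
    using mat_inv_pos_def[OF B pos] by (auto simp: P_def)
  have G: "P * A \<in> carrier_mat n n"
    using P A by auto
  have E_nonneg: "0 \<le> E y" if "y \<in> carrier_vec n" for y
    using pos[OF that] B by (cases "y = 0\<^sub>v n") (auto simp: E_def less_imp_le)
  have energy: "(energy_norm B y)\<^sup>2 = E y" if "y \<in> carrier_vec n" for y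
    using E_nonneg[OF that] by (simp add: energy_norm_def E_def)
  have BG: "B *\<^sub>v ((P * A) *\<^sub>v y) = A *\<^sub>v y" if "y \<in> carrier_vec n" for y
  proof -
    have "B *\<^sub>v ((P * A) *\<^sub>v y) = B *\<^sub>v (P *\<^sub>v (A *\<^sub>v y))"
      using assoc_mult_mat_vec[OF P(1) A that] by simp
    also have "\<dots> = (B * P) *\<^sub>v (A *\<^sub>v y)"
      using assoc_mult_mat_vec[OF B P(1), of "A *\<^sub>v y"] A that by simp
    finally show ?thesis
      using P A that by simp
  qed
  have xl: "x l \<in> pgmres_search_space P A b x0 l"
    using it by (auto simp: pgmres_iterates_def P_def)
  have x: "x j \<in> carrier_vec n" for j
    using it pgmres_search_space_step(1)[OF G P(1) b x0] by (auto simp: pgmres_iterates_def P_def)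
  have r: "r j \<in> carrier_vec n" for j
    using x[of j] G P b by (auto simp: r_def pgmres_residual_def P_def)
  \<comment> \<open>The minimiser of 1 - 2 t c1 + t^2 c2^2, the factor that the estimates below
    produce.\<close>
  define t where "t = c1 / c2\<^sup>2"
  define g where "g = (P * A) *\<^sub>v r l"
  have g: "g \<in> carrier_vec n"
    using G r by (auto simp: g_def)
  let ?y = "x l + t \<cdot>\<^sub>v r l"
  have "?y \<in> pgmres_search_space P A b x0 (Suc l)"
    using pgmres_search_space_step(2)[OF G P(1) b x0 xl] by (simp add: r_def P_def)
  then have "energy_norm B (r (Suc l)) \<le> energy_norm B (pgmres_residual P A b ?y)"
    using it P(4) by (auto simp: pgmres_iterates_def P_def r_def)
  also have "pgmres_residual P A b ?y = r l - t \<cdot>\<^sub>v g"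
  proof -
    have "(P * A) *\<^sub>v ?y = (P * A) *\<^sub>v x l + t \<cdot>\<^sub>v g"
      using mult_add_distrib_mat_vec[OF G x[of l], of "t \<cdot>\<^sub>v r l"] r mult_mat_vec[OF G r]
      by (simp add: g_def)
    then show ?thesis
      using x[of l] r[of l] g G P b unfolding r_def pgmres_residual_def P_def[symmetric]
      by (intro eq_vecI) (auto simp: pgmres_residual_def)
  qed
  finally have "(energy_norm B (r (Suc l)))\<^sup>2 \<le> (energy_norm B (r l - t \<cdot>\<^sub>v g))\<^sup>2"
    using energy[OF r] E_nonneg[OF r] by (intro power_mono) (auto simp: energy_norm_def E_def)
  also have "\<dots> = E (r l - t \<cdot>\<^sub>v g)"
    using r g by (intro energy) auto
  also have "\<dots> = E (r l) - 2 * t * scalar_prod (r l) (A *\<^sub>v r l) + t\<^sup>2 * E g"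
  proof -
    have Br: "B *\<^sub>v r l \<in> carrier_vec n" and Bg: "B *\<^sub>v g \<in> carrier_vec n"
      using B r g by auto
    have "E (r l - t \<cdot>\<^sub>v g)
        = scalar_prod (r l - t \<cdot>\<^sub>v g) (B *\<^sub>v r l - t \<cdot>\<^sub>v (B *\<^sub>v g))"
      using mult_minus_distrib_mat_vec[OF B r, of "t \<cdot>\<^sub>v g"] mult_mat_vec[OF B g] g
      by (simp add: E_def)
    also have "\<dots> = scalar_prod (r l) (B *\<^sub>v r l) - t * scalar_prod (r l) (B *\<^sub>v g)
        - t * scalar_prod g (B *\<^sub>v r l) + t\<^sup>2 * scalar_prod g (B *\<^sub>v g)"
      using r[of l] g Br Bg
      by (simp add: scalar_prod_minus_distrib[of _ n] minus_scalar_prod_distrib[of _ n]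
          algebra_simps power2_eq_square)
    also have "scalar_prod g (B *\<^sub>v r l) = scalar_prod (r l) (B *\<^sub>v g)"
      using sym[OF g r] .
    finally show ?thesis
      using BG[OF r, of l] by (simp add: E_def g_def algebra_simps)
  qed
  also have "\<dots> \<le> E (r l) - 2 * t * (c1 * E (r l)) + t\<^sup>2 * (c2\<^sup>2 * E (r l))"
  proof -
    \<comment> \<open>For \<open>y = g\<close> the left side of \<open>upper\<close> is
      \<open>2 * E g\<close>, because \<open>B\<close> undoes the preconditioner; one
      \<open>E g\<close> is then absorbed from the right side.\<close>
    have "scalar_prod g (A *\<^sub>v r l) = E g"
      using BG[OF r, of l] by (simp add: E_def g_def)
    then have "E g \<le> c2\<^sup>2 * E (r l)"
      using upper[OF r[of l] g] by (simp add: E_def)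
    moreover have "0 \<le> t"
      using c1 by (simp add: t_def)
    ultimately show ?thesis
      using lower[OF r[of l]] by (intro add_mono diff_mono mult_left_mono) (auto simp: E_def)
  qed
  also have "\<dots> = (1 - (c1 / c2)\<^sup>2) * E (r l)"
    using c2 by (simp add: t_def field_simps power2_eq_square)
  finally show "(energy_norm B (r (Suc l)))\<^sup>2 \<le> (1 - (c1 / c2)\<^sup>2) * (energy_norm B (r l))\<^sup>2"
    using energy[OF r] by simp
  show "0 \<le> energy_norm B (r l)"
    using E_nonneg[OF r] by (simp add: energy_norm_def E_def)
qed

text \<open>The recursion is iterated for squares and the root is taken at the end. Strict
  positivity of \<open>q\<close> matters already for \<open>l = 0\<close>: \<open>0 powr 0\<close>
  is \<open>0\<close>, so \<open>q = 0\<close> would make the right side vanish.\<close>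

lemma powr_half_bound_of_square_recursion:
  fixes E :: "nat \<Rightarrow> real"
  assumes step: "\<And>l. (E (Suc l))\<^sup>2 \<le> \<rho> * (E l)\<^sup>2" and nonneg: "\<And>l. 0 \<le> E l" and q: "\<rho> \<le> q" "0 < q"
  shows "E l \<le> q powr (real l / 2) * E 0"
proof -
  have "(E l)\<^sup>2 \<le> q ^ l * (E 0)\<^sup>2"
  proof (induction l)
    case (Suc l)
    have "(E (Suc l))\<^sup>2 \<le> \<rho> * (E l)\<^sup>2"
      by (rule step)
    also have "\<dots> \<le> q * (E l)\<^sup>2"
      using q by (intro mult_right_mono) auto
    also have "\<dots> \<le> q * (q ^ l * (E 0)\<^sup>2)"
      using q Suc.IH by (intro mult_left_mono) auto
    finally show ?case
      by (simp add: mult.assoc)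
  qed simp
  also have "q ^ l = (q powr (real l / 2))\<^sup>2"
  proof -
    have "(q powr (real l / 2))\<^sup>2 = q powr (real l / 2 + real l / 2)"
      by (simp only: power2_eq_square powr_add)
    also have "\<dots> = q ^ l"
      using q by (simp only: field_sum_of_halves powr_realpow)
    finally show ?thesis ..
  qed
  finally have "(E l)\<^sup>2 \<le> (q powr (real l / 2) * E 0)\<^sup>2"
    by (simp only: power_mult_distrib)
  then show ?thesis
    by (rule power2_le_imp_le) (rule mult_nonneg_nonneg[OF powr_ge_zero nonneg])
qed

section \<open>Measure-theoretic preliminaries\<close>

lemma norm_le_l1_3:
  fixes x y :: "real^3"
  shows "norm x \<le> \<bar>x $ 1\<bar> + \<bar>x $ 2\<bar> + \<bar>x $ 3\<bar>"
  using norm_le_l1_cart[of x] by (simp add: sum_3)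

text \<open>Locally the frontier lies on the rotated graph of a Lipschitz function, which is the
  Lipschitz image of a plane and hence a null set.\<close>

lemma negligible_frontier_lipschitz_domain:
  assumes "lipschitz_domain \<Omega>"
  shows "negligible (frontier \<Omega>)"
proof (subst locally_negligible_alt, intro ballI)
  fix p assume p: "p \<in> frontier \<Omega>"
  have opn: "open \<Omega>"
    using assms by (simp add: lipschitz_domain_def)
  obtain U g L and R :: "real^3 \<Rightarrow> real^3" where U: "open U" "p \<in> U" and R: "orthogonal_transformation R"
    and g: "L-lipschitz_on UNIV g" and eq: "\<Omega> \<inter> U = {y\<in>U. g (R y $ 1, R y $ 2) < R y $ 3}"
    using bspec[OF conjunct2[OF conjunct2[OF conjunct2[OF assms[unfolded lipschitz_domain_def]]]] p]
    by blast
  define S where "S = inv_into UNIV R"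
  have S: "orthogonal_transformation S"
    using R orthogonal_transformation_inv by (auto simp: S_def)
  have SR: "S (R y) = y" for y
    using orthogonal_transformation_inj[OF R] by (simp add: S_def)
  \<comment> \<open>\<open>H\<close> ignores the third coordinate: it is a Lipschitz self-map of the
    whole space that sends the plane \<open>x $ 3 = 0\<close> onto the rotated graph of
    \<open>g\<close>.\<close>
  define H where "H x = S (vector [x $ 1, x $ 2, g (x $ 1, x $ 2)])" for x :: "real^3"
  have L: "0 \<le> L"
    using g lipschitz_on_nonneg by blast
  have Hlip: "norm (H y - H x) \<le> (2 + 2 * L) * norm (y - x)" for x y
  proof -
    have c: "\<bar>y $ i - x $ i\<bar> \<le> norm (y - x)" for i
      using component_le_norm_cart[of "y - x" i] by simp
    have "H y - H x = S (vector [y $ 1, y $ 2, g (y $ 1, y $ 2)] - vector [x $ 1, x $ 2, g (x $ 1, x $ 2)])"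
      using orthogonal_transformation_linear[OF S] by (simp add: H_def linear_diff)
    then have "norm (H y - H x)
        = norm (vector [y $ 1, y $ 2, g (y $ 1, y $ 2)] - vector [x $ 1, x $ 2, g (x $ 1, x $ 2)] :: real^3)"
      using orthogonal_transformation_norm[OF S] by simp
    also have "\<dots> \<le> \<bar>y $ 1 - x $ 1\<bar> + \<bar>y $ 2 - x $ 2\<bar> + \<bar>g (y $ 1, y $ 2) - g (x $ 1, x $ 2)\<bar>"
      by (rule order.trans[OF norm_le_l1_3]) (simp add: vector_3)
    finally have *: "norm (H y - H x)
        \<le> \<bar>y $ 1 - x $ 1\<bar> + \<bar>y $ 2 - x $ 2\<bar> + \<bar>g (y $ 1, y $ 2) - g (x $ 1, x $ 2)\<bar>" .
    have "\<bar>g (y $ 1, y $ 2) - g (x $ 1, x $ 2)\<bar> \<le> L * dist (y $ 1, y $ 2) (x $ 1, x $ 2)"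
      using lipschitz_onD[OF g, of "(y $ 1, y $ 2)" "(x $ 1, x $ 2)"] by (simp add: dist_real_def)
    also have "\<dots> \<le> L * (2 * norm (y - x))"
    proof (rule mult_left_mono[OF _ L])
      show "dist (y $ 1, y $ 2) (x $ 1, x $ 2) \<le> 2 * norm (y - x)"
        using sqrt_sum_squares_le_sum_abs[of "y $ 1 - x $ 1" "y $ 2 - x $ 2"] c[of 1] c[of 2]
        by (simp add: dist_Pair_Pair dist_real_def)
    qed
    finally show ?thesis
      using * c[of 1] c[of 2] by (simp add: algebra_simps)
  qed
  have "negligible (H ` {x. x $ 3 = 0})"
    by (rule negligible_locally_Lipschitz_image)
      (use Hlip in \<open>auto intro!: negligible_standard_hyperplane_cart exI[of _ UNIV]\<close>)
  moreover have "frontier \<Omega> \<inter> U \<subseteq> H ` {x. x $ 3 = 0}"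
  proof
    fix y assume y: "y \<in> frontier \<Omega> \<inter> U"
    have contR: "continuous_on A (\<lambda>y. R y $ i)" for A i
      by (intro continuous_intros linear_continuous_on linear_linear[THEN iffD2]
          orthogonal_transformation_linear[OF R])
    have contg: "continuous_on A (\<lambda>y. g (R y $ 1, R y $ 2))" for A
      by (rule continuous_on_compose2[of UNIV g])
        (auto intro!: continuous_intros contR lipschitz_on_continuous_on[OF g])
    have "\<not> g (R y $ 1, R y $ 2) < R y $ 3"
      using y eq opn by (auto simp: frontier_def interior_open)
    \<comment> \<open>The part of \<open>U\<close> above which the graph lies is open and misses
      \<open>\<Omega>\<close>, hence also its closure.\<close>
    moreover have "\<not> g (R y $ 1, R y $ 2) > R y $ 3"
    proof
      assume gt: "g (R y $ 1, R y $ 2) > R y $ 3"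
      let ?V = "U \<inter> {y. R y $ 3 < g (R y $ 1, R y $ 2)}"
      have "open ?V"
        using U(1) by (intro open_Int open_Collect_less contR contg)
      moreover have "?V \<inter> \<Omega> = {}"
        using eq by force
      ultimately have "?V \<inter> closure \<Omega> = {}"
        by (simp add: open_Int_closure_eq_empty)
      then show False
        using y gt by (auto simp: frontier_def)
    qed
    ultimately have "R y $ 3 = g (R y $ 1, R y $ 2)"
      by simp
    then have "R y = vector [R y $ 1, R y $ 2, g (R y $ 1, R y $ 2)]"
      by (simp add: vec_eq_iff forall_3 vector_3)
    then have "y = H (vector [R y $ 1, R y $ 2, 0])"
      using SR[of y] by (simp add: H_def vector_3)
    then show "y \<in> H ` {x. x $ 3 = 0}"
      by (auto simp: vector_3)
  qed
  ultimately show "\<exists>V. openin (top_of_set (frontier \<Omega>)) V \<and> p \<in> V \<and> negligible V"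
    using U p negligible_subset by (intro exI[of _ "frontier \<Omega> \<inter> U"]) auto
qed

text \<open>Rotating \<open>a\<close> to the first axis puts \<open>K\<close> into a box with sides
  \<open>D / norm a\<close>, \<open>2 * d\<close> and \<open>2 * d\<close>. The lemma turns a lower
  bound on the volume and a small oscillation of a linear functional into a bound on its
  gradient.\<close>

lemma measure_mult_norm_le_width:
  fixes a :: "real^3"
  assumes K: "compact K" "K \<noteq> {}" and a: "a \<noteq> 0"
    and width: "\<And>x y. x \<in> K \<Longrightarrow> y \<in> K \<Longrightarrow> inner a x - inner a y \<le> D"
    and diam: "\<And>x y. x \<in> K \<Longrightarrow> y \<in> K \<Longrightarrow> dist x y \<le> d"
  shows "measure lebesgue K * norm a \<le> D * (2 * d)\<^sup>2"
proof -
  obtain q where q: "q \<in> K" "\<And>x. x \<in> K \<Longrightarrow> inner a q \<le> inner a x"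
    using continuous_attains_inf[OF K continuous_on_inner[OF continuous_on_const continuous_on_id]] by blast
  have "norm (a /\<^sub>R norm a) = 1"
    using a by simp
  then obtain R :: "real^3 \<Rightarrow> real^3" where R: "orthogonal_transformation R" "R (a /\<^sub>R norm a) = axis 1 1"
    using orthogonal_transformation_exists_1[OF _ norm_axis_1[of 1]] by blast
  have linR: "R (x - y) = R x - R y" for x y
    using orthogonal_transformation_linear[OF R(1)] by (simp add: linear_diff)
  have R1: "R x $ 1 - R q $ 1 = inner a (x - q) / norm a" for x
  proof -
    have "R (x - q) $ 1 = inner (R (x - q)) (R (a /\<^sub>R norm a))"
      by (simp add: R(2) inner_axis)
    also have "\<dots> = inner (x - q) (a /\<^sub>R norm a)"
      using R(1) by (simp add: orthogonal_transformation_def)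
    finally show ?thesis
      by (simp add: linR inner_commute divide_inverse_commute)
  qed
  have d: "0 \<le> d" "0 \<le> D"
    using diam[OF q(1) q(1)] width[OF q(1) q(1)] by auto
  let ?l = "R q - vector [0, d, d]" and ?u = "R q + vector [D / norm a, d, d]"
  have "R ` K \<subseteq> cbox ?l ?u"
  proof (rule image_subsetI)
    fix x assume x: "x \<in> K"
    have "\<bar>R x $ i - R q $ i\<bar> \<le> d" for i
      using component_le_norm_cart[of "R (x - q)" i] orthogonal_transformation_norm[OF R(1), of "x - q"]
        diam[OF x q(1)] by (simp add: linR dist_norm)
    from this[of 2] this[of 3] have *: "R q $ 2 \<le> R x $ 2 + d \<and> R x $ 2 \<le> R q $ 2 + d \<and>
        R q $ 3 \<le> R x $ 3 + d \<and> R x $ 3 \<le> R q $ 3 + d"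
      by auto
    have "0 \<le> inner a (x - q)" "inner a (x - q) \<le> D"
      using q(2)[OF x] width[OF x q(1)] by (auto simp: inner_diff_right)
    then have "0 \<le> inner a (x - q) / norm a" "inner a (x - q) / norm a \<le> D / norm a"
      using a by (auto simp: divide_right_mono)
    with * show "R x \<in> cbox ?l ?u"
      using R1[of x] by (simp add: mem_box_cart forall_3 vector_3)
  qed
  then have "measure lebesgue (R ` K) \<le> measure lebesgue (cbox ?l ?u)"
    using measurable_orthogonal_image[OF R(1) lmeasurable_compact[OF K(1)]]
    by (intro measure_mono_fmeasurable) (auto simp: fmeasurableD)
  also have "\<dots> \<le> D / norm a * (2 * d)\<^sup>2"
  proof -
    have prod3: "(\<Prod>i\<in>UNIV. f i) = f 1 * f 2 * f 3" for f :: "3 \<Rightarrow> real"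
      unfolding UNIV_3 by (simp add: mult.assoc)
    have "?u $ 1 - ?l $ 1 = D / norm a" "?u $ 2 - ?l $ 2 = 2 * d" "?u $ 3 - ?l $ 3 = 2 * d"
      by (simp_all add: vector_3)
    then have "(\<Prod>i\<in>UNIV. ?u $ i - ?l $ i) = D / norm a * (2 * d)\<^sup>2"
      unfolding prod3 by (simp only: power2_eq_square mult.assoc)
    then show ?thesis
      using d content_cbox_if_cart[of ?l ?u] by (cases "cbox ?l ?u = {}") simp_all
  qed
  finally have "measure lebesgue K \<le> D / norm a * (2 * d)\<^sup>2"
    using measure_orthogonal_image[OF R(1) lmeasurable_compact[OF K(1)]] by simp
  then show ?thesis
    using a by (simp add: field_simps)
qed

text \<open>A class that is closed under sums and bilinear products and consists of integrable
  functions on a space of finite measure; integrability by itself does not pass to products. All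
  integrands below are handled through it.\<close>

definition ess_bounded :: "'a measure \<Rightarrow> ('a \<Rightarrow> 'b::euclidean_space) \<Rightarrow> bool" where
  "ess_bounded M f \<longleftrightarrow> f \<in> borel_measurable M \<and> (\<exists>c. AE x in M. norm (f x) \<le> c)"

lemma ess_boundedI:
  "f \<in> borel_measurable M \<Longrightarrow> AE x in M. norm (f x) \<le> c \<Longrightarrow> ess_bounded M f"
  by (auto simp: ess_bounded_def)

lemma ess_bounded_measurable: "ess_bounded M f \<Longrightarrow> f \<in> borel_measurable M"
  by (simp add: ess_bounded_def)

lemma ess_bounded_integrable:
  fixes f :: "'a \<Rightarrow> 'b::euclidean_space"
  assumes "finite_measure M" "ess_bounded M f"
  shows "integrable M f"
  using assms finite_measure.integrable_const_bound[of M f] by (auto simp: ess_bounded_def)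

lemma ess_bounded_const [intro]: "ess_bounded M (\<lambda>_. c)"
  by (auto simp: ess_bounded_def)

lemma ess_bounded_bilinear:
  fixes f :: "'a \<Rightarrow> 'b::euclidean_space" and g :: "'a \<Rightarrow> 'c::euclidean_space"
    and prod :: "'b \<Rightarrow> 'c \<Rightarrow> 'd::euclidean_space"
  assumes bil: "bounded_bilinear prod" and f: "ess_bounded M f" and g: "ess_bounded M g"
  shows "ess_bounded M (\<lambda>x. prod (f x) (g x))"
proof -
  have fm [measurable]: "f \<in> borel_measurable M" and gm [measurable]: "g \<in> borel_measurable M"
    using f g by (auto simp: ess_bounded_def)
  obtain cf cg where c: "AE x in M. norm (f x) \<le> cf" "AE x in M. norm (g x) \<le> cg"
    using f g by (auto simp: ess_bounded_def)
  obtain k where k: "\<And>a b. norm (prod a b) \<le> norm a * norm b * k" "0 \<le> k"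
    using bounded_bilinear.nonneg_bounded[OF bil] by blast
  have "(\<lambda>x. prod (f x) (g x)) \<in> borel_measurable M"
    by (rule borel_measurable_continuous_Pair[OF fm gm])
      (intro bounded_bilinear.continuous_on[OF bil] continuous_intros)
  moreover have "AE x in M. norm (prod (f x) (g x)) \<le> \<bar>cf\<bar> * \<bar>cg\<bar> * k"
    using c
  proof eventually_elim
    case (elim x)
    have "norm (prod (f x) (g x)) \<le> norm (f x) * norm (g x) * k"
      by (rule k)
    also have "\<dots> \<le> \<bar>cf\<bar> * \<bar>cg\<bar> * k"
      using elim k(2) by (intro mult_mono) auto
    finally show ?case .
  qed
  ultimately show ?thesis
    by (rule ess_boundedI)
qed

lemmas ess_bounded_inner = ess_bounded_bilinear[OF bounded_bilinear_inner]
lemmas ess_bounded_scaleR = ess_bounded_bilinear[OF bounded_bilinear_scaleR]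

lemma ess_bounded_mult:
  "ess_bounded M f \<Longrightarrow> ess_bounded M g \<Longrightarrow> ess_bounded M (\<lambda>x. f x * g x :: real)"
  by (rule ess_bounded_bilinear[OF bounded_bilinear_mult])

lemma ess_bounded_add:
  assumes "ess_bounded M f" "ess_bounded M g"
  shows "ess_bounded M (\<lambda>x. f x + g x)"
proof -
  obtain cf cg where "AE x in M. norm (f x) \<le> cf" "AE x in M. norm (g x) \<le> cg"
    using assms by (auto simp: ess_bounded_def)
  then have "AE x in M. norm (f x + g x) \<le> cf + cg"
    by eventually_elim (meson add_mono norm_triangle_ineq order.trans)
  then show ?thesis
    using assms by (intro ess_boundedI) (auto simp: ess_bounded_def)
qed

lemma ess_bounded_sum:
  "(\<And>i. i \<in> I \<Longrightarrow> ess_bounded M (f i)) \<Longrightarrow> ess_bounded M (\<lambda>x. \<Sum>i\<in>I. f i x)"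
  by (induction I rule: infinite_finite_induct) (auto intro: ess_bounded_add)

lemma ess_bounded_cmult: "ess_bounded M f \<Longrightarrow> ess_bounded M (\<lambda>x. c *\<^sub>R f x)"
  by (rule ess_bounded_scaleR) auto

lemma ess_bounded_norm_sq: "ess_bounded M f \<Longrightarrow> ess_bounded M (\<lambda>x. (norm (f x))\<^sup>2)"
  using ess_bounded_inner[of M f f] by (simp add: power2_norm_eq_inner)

text \<open>Completeness of Lebesgue measure. It serves for \<open>grad v\<close>, whose values on
  the element boundaries are arbitrary.\<close>

lemma borel_measurable_lebesgue_on_AE:
  fixes f g :: "'a::euclidean_space \<Rightarrow> 'b::euclidean_space"
  assumes S: "S \<in> sets lebesgue" and f: "f \<in> borel_measurable (lebesgue_on S)"
    and ae: "AE x in lebesgue_on S. f x = g x"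
  shows "g \<in> borel_measurable (lebesgue_on S)"
  unfolding borel_measurable_lebesgue_on_preimage_borel[OF S]
proof (intro allI impI)
  fix T :: "'b set" assume T: "T \<in> sets borel"
  have *: "{x \<in> S. f x \<in> T} \<in> sets lebesgue"
    using f T unfolding borel_measurable_lebesgue_on_preimage_borel[OF S] by blast
  have "AE x in lebesgue. x \<in> S \<longrightarrow> f x = g x"
    using ae S by (simp add: AE_restrict_space_iff)
  then have "negligible {x. \<not> (x \<in> S \<longrightarrow> f x = g x)}"
    by (simp add: completion.AE_iff_null_sets negligible_iff_null_sets)
  then have "negligible (({x \<in> S. f x \<in> T} - {x \<in> S. g x \<in> T}) \<union> ({x \<in> S. g x \<in> T} - {x \<in> S. f x \<in> T}))"
    by (rule negligible_subset) auto
  from sets_negligible_symdiff[OF * this] show "{x \<in> S. g x \<in> T} \<in> sets lebesgue" .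
qed

section \<open>Piecewise affine functions on a quasi-uniform mesh\<close>

definition P1_vector_space :: "(real^3) set \<Rightarrow> (real^3) set set \<Rightarrow> (real^3 \<Rightarrow> real^'d) set" where
  "P1_vector_space \<Omega> \<T> = {v. \<forall>i. (\<lambda>x. v x $ i) \<in> P1_space \<Omega> \<T>}"

text \<open>One matrix is chosen per element, so that all pairs of points of \<open>K\<close>,
  boundary points included, share it; at interior points it is the derivative.\<close>

definition elem_grad :: "(real^3 \<Rightarrow> real^'d) \<Rightarrow> (real^3) set \<Rightarrow> real^3^'d" where
  "elem_grad v K = (SOME A. \<exists>b. \<forall>x\<in>K. v x = A *v x + b)"

text \<open>Cauchy-Schwarz row by row: the Frobenius norm dominates the operator norm.\<close>

lemma matrix_mult_norm_le: "norm (A *v x) \<le> norm A * norm (x :: real^'n)" for A :: "real^'n^'m"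
proof -
  have "norm (A *v x) = L2_set (\<lambda>i. norm (inner (A $ i) x)) UNIV"
    by (simp add: norm_vec_def matrix_vector_mult_def inner_vec_def)
  also have "\<dots> \<le> L2_set (\<lambda>i. norm (A $ i) * norm x) UNIV"
    by (intro L2_set_mono) (auto simp: Cauchy_Schwarz_ineq2)
  also have "\<dots> = norm A * norm x"
    by (simp add: norm_vec_def L2_set_left_distrib)
  finally show ?thesis .
qed

locale fe_mesh =
  fixes Cm h :: real and \<Omega> :: "(real^3) set" and \<T> :: "(real^3) set set"
  assumes lip: "lipschitz_domain \<Omega>" and bounded: "bounded \<Omega>" and h_pos: "0 < h"
    and mesh: "quasi_uniform_mesh Cm h \<Omega> \<T>"
begin

abbreviation verts :: "(real^3) set \<Rightarrow> (real^3) set" where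
  "verts K \<equiv> {p. p extreme_point_of K}"

lemma
  shows finite_mesh: "finite \<T>" and Union_mesh: "\<Union>\<T> = closure \<Omega>"
    and face: "K \<in> \<T> \<Longrightarrow> K' \<in> \<T> \<Longrightarrow> (K \<inter> K') face_of K"
    and open_domain: "open \<Omega>" and domain_nonempty: "\<Omega> \<noteq> {}"
  using mesh lip by (auto simp: quasi_uniform_mesh_def triangulation_def lipschitz_domain_def)

lemma domain_lmeasurable: "\<Omega> \<in> lmeasurable"
  using open_domain bounded by (simp add: lmeasurable_open)

lemma domain_sets [simp]: "\<Omega> \<in> sets lebesgue"
  using domain_lmeasurable by (simp add: fmeasurableD)

lemma finite_measure_domain: "finite_measure (lebesgue_on \<Omega>)"
  using domain_lmeasurable finite_measure_lebesgue_on by blast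

text \<open>The extreme points of the hull of an affinely independent set are the points of this
  set. This links \<open>nodes\<close>, which is defined by extreme points, to the corners of the
  simplices.\<close>

lemma
  assumes K: "K \<in> \<T>"
  shows elem_compact: "compact K" and elem_convex: "convex K" and elem_hull: "K = convex hull (verts K)"
    and finite_verts: "finite (verts K)" and verts_nonempty: "verts K \<noteq> {}"
    and verts_subset: "verts K \<subseteq> nodes \<T>" and verts_elem: "verts K \<subseteq> K"
proof -
  have "3 simplex K"
    using mesh K by (simp add: quasi_uniform_mesh_def)
  then obtain C where C: "finite C" "\<not> affine_dependent C" "int (card C) = 3 + 1" "K = convex hull C"
    unfolding simplex by blast
  have vC: "verts K = C"
    using C extreme_point_of_convex_hull_affine_independent by auto
  show "compact K" "convex K" "K = convex hull (verts K)" "finite (verts K)" "verts K \<noteq> {}" "verts K \<subseteq> K"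
    unfolding vC using C by (auto simp: finite_imp_compact_convex_hull hull_inc)
  show "verts K \<subseteq> nodes \<T>"
    using K by (auto simp: nodes_def)
qed

lemma elem_measure: "K \<in> \<T> \<Longrightarrow> h ^ 3 \<le> measure lebesgue K"
proof -
  assume "K \<in> \<T>"
  then have "h \<le> root 3 (measure lebesgue K)"
    using mesh by (simp add: quasi_uniform_mesh_def)
  then have "h ^ 3 \<le> root 3 (measure lebesgue K) ^ 3"
    using h_pos by (intro power_mono) auto
  then show ?thesis
    by (simp add: odd_real_root_pow)
qed

lemma elem_dist: "K \<in> \<T> \<Longrightarrow> x \<in> K \<Longrightarrow> y \<in> K \<Longrightarrow> dist x y \<le> Cm * h"
proof -
  assume K: "K \<in> \<T>" and xy: "x \<in> K" "y \<in> K"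
  have "dist x y \<le> diameter K"
    using elem_compact[OF K] xy by (intro diameter_bounded_bound compact_imp_bounded)
  then show ?thesis
    using mesh K by (force simp: quasi_uniform_mesh_def)
qed

lemma mesh_nonempty: "\<T> \<noteq> {}"
  using Union_mesh domain_nonempty closure_subset by fastforce

lemma Cm_ge_1: "1 \<le> Cm"
proof -
  obtain K where "K \<in> \<T>"
    using mesh_nonempty by blast
  then have "h \<le> Cm * h"
    using mesh unfolding quasi_uniform_mesh_def by (meson order.trans)
  then show ?thesis
    using h_pos by simp
qed

lemma elem_closure: "K \<in> \<T> \<Longrightarrow> K \<subseteq> closure \<Omega>"
  using Union_mesh by blast

lemma elem_lmeasurable: "K \<in> \<T> \<Longrightarrow> K \<in> lmeasurable"
  using elem_compact lmeasurable_compact by blast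

lemma negligible_skeleton: "negligible (frontier \<Omega> \<union> (\<Union>K\<in>\<T>. frontier K))"
  using finite_mesh negligible_frontier_lipschitz_domain[OF lip] elem_convex negligible_convex_frontier
  by (intro negligible_Un negligible_Union) auto

lemma AE_not_skeleton: "AE x in lebesgue_on \<Omega>. x \<notin> frontier \<Omega> \<union> (\<Union>K\<in>\<T>. frontier K)"
proof -
  have "AE x in lebesgue. x \<notin> frontier \<Omega> \<union> (\<Union>K\<in>\<T>. frontier K)"
    using negligible_skeleton by (intro AE_not_in) (simp add: negligible_iff_null_sets)
  then have "AE x in lebesgue. x \<in> \<Omega> \<longrightarrow> x \<notin> frontier \<Omega> \<union> (\<Union>K\<in>\<T>. frontier K)"
    by eventually_elim simp
  then show ?thesis
    by (subst AE_restrict_space_iff) simp_all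
qed

text \<open>A face of \<open>K\<close> that meets \<open>interior K\<close> is all of
  \<open>K\<close>. This applies to the common face \<open>K \<inter> K'\<close>, and once
  \<open>K\<close> lies in \<open>K'\<close> it applies with the roles exchanged.\<close>

lemma disjoint_interior:
  assumes "K \<in> \<T>" "K' \<in> \<T>" "x \<in> interior K" "x \<in> K'"
  shows "K = K'"
proof -
  have "K \<inter> K' = K"
    using face_of_disjoint_interior[OF face[OF assms(1,2)]] assms(3,4) interior_subset by blast
  then have sub: "K \<subseteq> K'"
    by blast
  then have "x \<in> interior K'"
    using assms(3) interior_mono by blast
  then have "K' \<inter> K = K'"
    using face_of_disjoint_interior[OF face[OF assms(2,1)]] assms(3) interior_subset by blast
  with sub show ?thesis
    by blast
qed

lemma AE_unique_elem:
  "AE x in lebesgue_on \<Omega>. \<exists>K\<in>\<T>. x \<in> interior K \<and> (\<forall>K'\<in>\<T>. x \<in> K' \<longleftrightarrow> K' = K)"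
proof -
  have "AE x in lebesgue_on \<Omega>. x \<in> \<Omega>"
    using AE_space[of "lebesgue_on \<Omega>"] by simp
  with AE_not_skeleton show ?thesis
  proof eventually_elim
    case (elim x)
    then obtain K where K: "K \<in> \<T>" "x \<in> K"
      using Union_mesh closure_subset by blast
    then have "x \<in> interior K"
      using elim elem_compact[OF K(1)] by (auto simp: frontier_def compact_imp_closed)
    then show ?case
      using K disjoint_interior by metis
  qed
qed

text \<open>The closed elements overlap, but almost every point lies in exactly one of them, so
  their indicators sum to one almost everywhere.\<close>

lemma integral_eq_sum_elems:
  fixes g :: "real^3 \<Rightarrow> real"
  assumes g: "integrable (lebesgue_on \<Omega>) g"
  shows "(LINT x|lebesgue_on \<Omega>. g x) = (\<Sum>K\<in>\<T>. LINT x|lebesgue_on \<Omega>. indicator K x * g x)"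
proof -
  have meas: "K \<in> \<T> \<Longrightarrow> K \<inter> \<Omega> \<in> sets (lebesgue_on \<Omega>)" for K
    using elem_lmeasurable by (auto simp: sets_restrict_space fmeasurableD)
  have int: "K \<in> \<T> \<Longrightarrow> integrable (lebesgue_on \<Omega>) (\<lambda>x. indicator K x * g x)" for K
  proof -
    assume K: "K \<in> \<T>"
    have "integrable (lebesgue_on \<Omega>) (\<lambda>x. indicator (K \<inter> \<Omega>) x * g x)"
      using integrable_mult_indicator[OF meas[OF K] g] by simp
    then show ?thesis
      by (rule Bochner_Integration.integrable_cong[THEN iffD1, rotated 2]) (auto simp: indicator_def)
  qed
  have "(LINT x|lebesgue_on \<Omega>. g x) = (LINT x|lebesgue_on \<Omega>. (\<Sum>K\<in>\<T>. indicator K x * g x))"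
  proof (rule integral_cong_AE)
    show "g \<in> borel_measurable (lebesgue_on \<Omega>)"
      using g by simp
    show "(\<lambda>x. \<Sum>K\<in>\<T>. indicator K x * g x) \<in> borel_measurable (lebesgue_on \<Omega>)"
      using int by (intro borel_measurable_sum) auto
    show "AE x in lebesgue_on \<Omega>. g x = (\<Sum>K\<in>\<T>. indicator K x * g x)"
      using AE_unique_elem
    proof eventually_elim
      case (elim x)
      then obtain K where K: "K \<in> \<T>" "x \<in> interior K" "\<And>K'. K' \<in> \<T> \<Longrightarrow> x \<in> K' \<longleftrightarrow> K' = K"
        by blast
      have "(\<Sum>K\<in>\<T>. indicator K x * g x) = (\<Sum>K'\<in>\<T>. if K' = K then g x else 0)"
        using K(3) by (intro sum.cong) (simp_all add: indicator_def)
      then show ?case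
        using K finite_mesh by simp
    qed
  qed
  also have "\<dots> = (\<Sum>K\<in>\<T>. LINT x|lebesgue_on \<Omega>. indicator K x * g x)"
    using int by (rule Bochner_Integration.integral_sum)
  finally show ?thesis .
qed

text \<open>Elements are subsets of the closure while integrals run over \<open>\<Omega>\<close>;
  the difference lies in the frontier, which is a null set.\<close>

lemma integral_indicator_domain:
  assumes S: "S \<in> lmeasurable" and sub: "S \<subseteq> closure \<Omega>"
  shows "(LINT x|lebesgue_on \<Omega>. indicator S x) = measure lebesgue S"
    and "integrable (lebesgue_on \<Omega>) (indicator S :: _ \<Rightarrow> real)"
proof -
  have sets: "S \<inter> \<Omega> \<in> lmeasurable"
    using S domain_lmeasurable by (simp add: fmeasurable.Int)
  have eq: "(\<lambda>x. indicator \<Omega> x * indicator S x) = (indicator (S \<inter> \<Omega>) :: _ \<Rightarrow> real)"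
    by (auto simp: indicator_def)
  have "measure lebesgue (S \<inter> \<Omega>) = measure lebesgue S"
  proof (rule measure_negligible_symdiff[OF S])
    have "(S - S \<inter> \<Omega>) \<union> (S \<inter> \<Omega> - S) \<subseteq> frontier \<Omega>"
      using sub open_domain by (auto simp: frontier_def interior_open)
    then show "negligible ((S - S \<inter> \<Omega>) \<union> (S \<inter> \<Omega> - S))"
      using negligible_frontier_lipschitz_domain[OF lip] negligible_subset by blast
  qed
  then show "(LINT x|lebesgue_on \<Omega>. indicator S x) = measure lebesgue S"
    using sets by (subst integral_restrict_space) (simp_all add: eq fmeasurableD)
  show "integrable (lebesgue_on \<Omega>) (indicator S :: _ \<Rightarrow> real)"
  proof (subst integrable_restrict_space)
    show "integrable lebesgue (\<lambda>x. indicator \<Omega> x *\<^sub>R (indicator S x :: real))"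
      unfolding real_scaleR_def eq using sets
      by (intro integrable_real_indicator) (auto simp: fmeasurable_def infinity_ennreal_def)
  qed simp
qed

lemma P1_elem:
  assumes v: "v \<in> P1_vector_space \<Omega> \<T>" and K: "K \<in> \<T>"
  obtains b where "\<And>x. x \<in> K \<Longrightarrow> v x = elem_grad v K *v x + b"
proof -
  have "\<exists>a b. \<forall>x\<in>K. v x $ i = inner a x + b" for i
    using v K by (auto simp: P1_vector_space_def P1_space_def)
  then obtain a b where ab: "\<And>i x. x \<in> K \<Longrightarrow> v x $ i = inner (a i) x + b i"
    by metis
  have "\<exists>A b. \<forall>x\<in>K. v x = A *v x + b"
    using ab by (intro exI[of _ "\<chi> i. a i"] exI[of _ "\<chi> i. b i"])
      (auto simp: vec_eq_iff matrix_vector_mult_def inner_vec_def)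
  then have "\<exists>b. \<forall>x\<in>K. v x = elem_grad v K *v x + b"
    unfolding elem_grad_def by (rule someI_ex)
  then show ?thesis
    using that by blast
qed

lemma P1_diff:
  assumes "v \<in> P1_vector_space \<Omega> \<T>" "K \<in> \<T>" "x \<in> K" "y \<in> K"
  shows "v x - v y = elem_grad v K *v (x - y)"
  using P1_elem[OF assms(1,2)] assms(3,4) by (metis add_diff_cancel_right matrix_vector_mult_diff_distrib)

lemma P1_has_derivative:
  assumes v: "v \<in> P1_vector_space \<Omega> \<T>" and K: "K \<in> \<T>" and x: "x \<in> interior K"
  shows "(v has_derivative (*v) (elem_grad v K)) (at x)" and "grad v x = elem_grad v K"
proof -
  obtain b where b: "\<And>x. x \<in> K \<Longrightarrow> v x = elem_grad v K *v x + b"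
    using P1_elem[OF v K] by blast
  have "((\<lambda>x. elem_grad v K *v x + b) has_derivative (*v) (elem_grad v K)) (at x)"
    by (auto intro!: derivative_eq_intros bounded_linear.has_derivative[OF matrix_vector_mul_bounded_linear])
  then show d: "(v has_derivative (*v) (elem_grad v K)) (at x)"
    by (rule has_derivative_transform_within_open[OF _ open_interior x])
      (metis b interior_subset subsetD)
  then have "frechet_derivative v (at x) = (*v) (elem_grad v K)"
    using frechet_derivative_at by metis
  then show "grad v x = elem_grad v K"
    by (simp add: grad_def jacobian_def matrix_of_matrix_vector_mul)
qed

text \<open>The norm of an affine map is convex, so bounds at the vertices extend to their
  hull.\<close>

lemma P1_convex_bound:
  assumes v: "v \<in> P1_vector_space \<Omega> \<T>" and K: "K \<in> \<T>"
    and bd: "\<And>p. p \<in> verts K \<Longrightarrow> norm (v p) \<le> M" and x: "x \<in> K"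
  shows "norm (v x) \<le> M"
proof -
  obtain b where b: "\<And>x. x \<in> K \<Longrightarrow> v x = elem_grad v K *v x + b"
    using P1_elem[OF v K] by blast
  let ?f = "\<lambda>x. norm (elem_grad v K *v x + b)"
  have "convex_on UNIV ?f"
    unfolding convex_on_def
  proof (intro conjI convex_UNIV allI ballI impI)
    fix x y :: "real^3" and s t :: real assume st: "0 \<le> s" "0 \<le> t" "s + t = 1"
    have "elem_grad v K *v (s *\<^sub>R x + t *\<^sub>R y) + b
        = s *\<^sub>R (elem_grad v K *v x + b) + t *\<^sub>R (elem_grad v K *v y + b)"
      using st scaleR_add_left[of s t b]
      by (simp add: matrix_vector_right_distrib matrix_vector_mult_scaleR algebra_simps)
    then show "?f (s *\<^sub>R x + t *\<^sub>R y) \<le> s * ?f x + t * ?f y"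
      using st norm_triangle_ineq[of "s *\<^sub>R (elem_grad v K *v x + b)" "t *\<^sub>R (elem_grad v K *v y + b)"]
      by simp
  qed
  then have "convex_on (convex hull (verts K)) ?f"
    by (rule convex_on_subset) auto
  moreover have "\<forall>p\<in>verts K. ?f p \<le> M"
    using bd b verts_elem[OF K] by (metis subsetD)
  ultimately have "\<forall>x\<in>convex hull (verts K). ?f x \<le> M"
    by (rule convex_on_convex_hull_bound)
  then show ?thesis
    using x b elem_hull[OF K] by auto
qed

lemma P1_continuous:
  assumes "v \<in> P1_vector_space \<Omega> \<T>"
  shows "continuous_on (closure \<Omega>) v"
proof -
  have "continuous_on (closure \<Omega>) (\<lambda>x. \<chi> i. v x $ i)"
    using assms by (intro continuous_on_vec_lambda) (auto simp: P1_vector_space_def P1_space_def)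
  then show ?thesis
    by simp
qed

lemma P1_ess_bounded:
  assumes v: "v \<in> P1_vector_space \<Omega> \<T>"
  shows "ess_bounded (lebesgue_on \<Omega>) v"
proof -
  have "compact (v ` closure \<Omega>)"
    using P1_continuous[OF v] bounded by (intro compact_continuous_image) (auto simp: compact_closure)
  then obtain c where "\<forall>y\<in>v ` closure \<Omega>. norm y \<le> c"
    using compact_imp_bounded bounded_iff by blast
  then have "AE x in lebesgue_on \<Omega>. norm (v x) \<le> c"
    using closure_subset by (intro AE_I2) auto
  moreover have "v \<in> borel_measurable (lebesgue_on \<Omega>)"
    by (rule continuous_imp_measurable_on_sets_lebesgue[OF continuous_on_subset[OF P1_continuous[OF v] closure_subset]])
      simp
  ultimately show ?thesis
    by (rule ess_boundedI[rotated])
qed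

lemma AE_grad:
  fixes v :: "real^3 \<Rightarrow> real^'d"
  assumes v: "v \<in> P1_vector_space \<Omega> \<T>"
  shows "AE x in lebesgue_on \<Omega>. grad v x = (\<Sum>K\<in>\<T>. indicator K x *\<^sub>R elem_grad v K)"
  using AE_unique_elem
proof eventually_elim
  case (elim x)
  then obtain K where K: "K \<in> \<T>" "x \<in> interior K" "\<And>K'. K' \<in> \<T> \<Longrightarrow> x \<in> K' \<longleftrightarrow> K' = K"
    by blast
  have "(\<Sum>K\<in>\<T>. indicator K x *\<^sub>R elem_grad v K) = (\<Sum>K'\<in>\<T>. if K' = K then elem_grad v K else 0)"
    using K(3) by (intro sum.cong) (simp_all add: indicator_def)
  then show ?case
    using K finite_mesh P1_has_derivative(2)[OF v K(1,2)] by simp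
qed

lemma grad_ess_bounded:
  fixes v :: "real^3 \<Rightarrow> real^'d"
  assumes v: "v \<in> P1_vector_space \<Omega> \<T>"
  shows "ess_bounded (lebesgue_on \<Omega>) (grad v)"
proof (rule ess_boundedI)
  have "(\<lambda>x. \<Sum>K\<in>\<T>. indicator K x *\<^sub>R elem_grad v K) \<in> borel_measurable (lebesgue_on \<Omega>)"
    by (intro borel_measurable_sum borel_measurable_scaleR borel_measurable_const
        borel_measurable_integrable[OF integral_indicator_domain(2)[OF elem_lmeasurable elem_closure]])
  moreover have "AE x in lebesgue_on \<Omega>. (\<Sum>K\<in>\<T>. indicator K x *\<^sub>R elem_grad v K) = grad v x"
    using AE_grad[OF v] by eventually_elim (rule sym)
  ultimately show "grad v \<in> borel_measurable (lebesgue_on \<Omega>)"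
    by (rule borel_measurable_lebesgue_on_AE[OF domain_sets])
  show "AE x in lebesgue_on \<Omega>. norm (grad v x) \<le> (\<Sum>K\<in>\<T>. norm (elem_grad v K))"
    using AE_grad[OF v]
    by eventually_elim (auto intro!: order.trans[OF norm_sum] sum_mono simp: indicator_def)
qed

end

section \<open>Element estimates\<close>

context fe_mesh
begin

lemma integrable_elem_mult:
  fixes g :: "real^3 \<Rightarrow> real"
  assumes "K \<in> \<T>" "ess_bounded (lebesgue_on \<Omega>) g"
  shows "integrable (lebesgue_on \<Omega>) (\<lambda>x. indicator K x * g x)"
proof -
  have "ess_bounded (lebesgue_on \<Omega>) (indicator K :: _ \<Rightarrow> real)"
    using integral_indicator_domain(2)[OF elem_lmeasurable elem_closure] assms(1)
    by (intro ess_boundedI[of _ _ 1]) auto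
  then show ?thesis
    using ess_bounded_integrable[OF finite_measure_domain ess_bounded_mult] assms(2) by blast
qed

lemma max_vertex:
  fixes f :: "real^3 \<Rightarrow> real"
  assumes K: "K \<in> \<T>"
  obtains q where "q \<in> verts K" "\<And>p. p \<in> verts K \<Longrightarrow> f p \<le> f q"
proof -
  have fin: "finite (f ` verts K)" "f ` verts K \<noteq> {}"
    using finite_verts[OF K] verts_nonempty[OF K] by auto
  obtain q where "q \<in> verts K" "Max (f ` verts K) = f q"
    using Max_in[OF fin] by blast
  then show ?thesis
    using that Max_ge[OF fin(1)] by (metis imageI)
qed

lemma P1_elem_upper:
  assumes v: "v \<in> P1_vector_space \<Omega> \<T>" and K: "K \<in> \<T>"
    and M: "\<And>p. p \<in> verts K \<Longrightarrow> norm (v p) \<le> M"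
  shows "(LINT x|lebesgue_on \<Omega>. indicator K x * (norm (v x))\<^sup>2) \<le> M\<^sup>2 * measure lebesgue K"
proof -
  have "(LINT x|lebesgue_on \<Omega>. indicator K x * (norm (v x))\<^sup>2)
      \<le> (LINT x|lebesgue_on \<Omega>. M\<^sup>2 * indicator K x)"
  proof (rule integral_mono)
    show "integrable (lebesgue_on \<Omega>) (\<lambda>x. indicator K x * (norm (v x))\<^sup>2)"
      by (intro integrable_elem_mult K ess_bounded_norm_sq P1_ess_bounded v)
    show "integrable (lebesgue_on \<Omega>) (\<lambda>x. M\<^sup>2 * indicator K x)"
      using integral_indicator_domain(2)[OF elem_lmeasurable[OF K] elem_closure[OF K]] by simp
    show "indicator K x * (norm (v x))\<^sup>2 \<le> M\<^sup>2 * indicator K x" for x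
      using P1_convex_bound[OF v K M, of x] by (auto simp: indicator_def intro!: power_mono)
  qed
  then show ?thesis
    using integral_indicator_domain(1)[OF elem_lmeasurable[OF K] elem_closure[OF K]] by simp
qed

text \<open>Near a vertex where \<open>|v|\<close> is maximal, namely on the copy of \<open>K\<close> shrunk towards that vertex
  by the factor \<open>1/8\<close>, \<open>|v|\<close> is at least \<open>3/4\<close> of its maximum.\<close>

lemma P1_elem_lower:
  assumes v: "v \<in> P1_vector_space \<Omega> \<T>" and K: "K \<in> \<T>" and q: "q \<in> verts K"
  shows "(norm (v q))\<^sup>2 * measure lebesgue K
    \<le> 1024 * (LINT x|lebesgue_on \<Omega>. indicator K x * (norm (v x))\<^sup>2)"
proof -
  obtain p where p: "p \<in> verts K" and pmax: "\<And>y. y \<in> verts K \<Longrightarrow> norm (v y) \<le> norm (v p)"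
    using max_vertex[OF K, of "\<lambda>y. norm (v y)"] by blast
  define S where "S = (\<lambda>x. (1/8) *\<^sub>R x + (7/8) *\<^sub>R p) ` K"
  have pK: "p \<in> K"
    using p verts_elem[OF K] by blast
  have SK: "S \<subseteq> K"
  proof
    fix y assume "y \<in> S"
    then obtain x where "x \<in> K" "y = (1/8) *\<^sub>R x + (7/8) *\<^sub>R p"
      by (auto simp: S_def)
    then show "y \<in> K"
      using convexD[OF elem_convex[OF K] _ pK, of x "1/8" "7/8"] by simp
  qed
  have "compact S"
    unfolding S_def using elem_compact[OF K] by (intro compact_continuous_image continuous_intros)
  then have Sm: "S \<in> lmeasurable"
    by (rule lmeasurable_compact)
  have Smeas: "measure lebesgue S = measure lebesgue K / 512"
    unfolding S_def using measure_lebesgue_affine[of "1/8" "(7/8) *\<^sub>R p" K]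
    by (simp add: power3_eq_cube)
  have Scl: "S \<subseteq> closure \<Omega>"
    using SK elem_closure[OF K] by blast
  have low: "(9/16) * (norm (v p))\<^sup>2 \<le> (norm (v y))\<^sup>2" if y: "y \<in> S" for y
  proof -
    obtain x where x: "x \<in> K" "y = (1/8) *\<^sub>R x + (7/8) *\<^sub>R p"
      using y by (auto simp: S_def)
    have "v y - v p = elem_grad v K *v ((1/8) *\<^sub>R (x - p))"
    proof -
      have "y - p = (1/8) *\<^sub>R (x - p)"
        unfolding x(2) by (simp add: vec_eq_iff field_simps)
      then show ?thesis
        using P1_diff[OF v K _ pK, of y] SK y by auto
    qed
    also have "\<dots> = (1/8) *\<^sub>R (v x - v p)"
      using P1_diff[OF v K x(1) pK] by (simp add: matrix_vector_mult_scaleR)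
    finally have eq: "v y = (7/8) *\<^sub>R v p + (1/8) *\<^sub>R v x"
      by (simp add: vec_eq_iff field_simps)
    have "norm ((7/8) *\<^sub>R v p) \<le> norm (v y) + norm ((1/8) *\<^sub>R v x)"
      using norm_triangle_ineq4[of "v y" "(1/8) *\<^sub>R v x"] by (simp add: eq)
    moreover have "norm (v x) \<le> norm (v p)"
      using P1_convex_bound[OF v K pmax x(1)] .
    ultimately have "(3/4) * norm (v p) \<le> norm (v y)"
      by simp
    then have "((3/4) * norm (v p))\<^sup>2 \<le> (norm (v y))\<^sup>2"
      by (intro power_mono) auto
    then show ?thesis
      by (simp add: power2_eq_square)
  qed
  have "(9/16) * (norm (v p))\<^sup>2 * measure lebesgue S
      = (LINT x|lebesgue_on \<Omega>. (9/16) * (norm (v p))\<^sup>2 * indicator S x)"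
    using integral_indicator_domain(1)[OF Sm Scl] by simp
  also have "\<dots> \<le> (LINT x|lebesgue_on \<Omega>. indicator K x * (norm (v x))\<^sup>2)"
  proof (rule integral_mono)
    show "integrable (lebesgue_on \<Omega>) (\<lambda>x. indicator K x * (norm (v x))\<^sup>2)"
      by (intro integrable_elem_mult K ess_bounded_norm_sq P1_ess_bounded v)
    show "integrable (lebesgue_on \<Omega>) (\<lambda>x. (9/16) * (norm (v p))\<^sup>2 * indicator S x)"
      using integral_indicator_domain(2)[OF Sm Scl] by simp
    show "(9/16) * (norm (v p))\<^sup>2 * indicator S x \<le> indicator K x * (norm (v x))\<^sup>2" for x
      using low[of x] SK by (auto simp: indicator_def)
  qed
  finally have "9 * ((norm (v p))\<^sup>2 * measure lebesgue K)
      \<le> 8192 * (LINT x|lebesgue_on \<Omega>. indicator K x * (norm (v x))\<^sup>2)"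
    using Smeas by simp
  \<comment> \<open>The squared bound \<open>9/16\<close> and the volume factor \<open>1/512\<close>
    give \<open>8192 / 9\<close>, which is rounded up to \<open>1024\<close>.\<close>
  then have "(norm (v p))\<^sup>2 * measure lebesgue K
      \<le> 1024 * (LINT x|lebesgue_on \<Omega>. indicator K x * (norm (v x))\<^sup>2)"
    using mult_nonneg_nonneg[OF zero_le_power2[of "norm (v p)"] measure_nonneg[of lebesgue K]]
    by linarith
  moreover have "(norm (v q))\<^sup>2 * measure lebesgue K \<le> (norm (v p))\<^sup>2 * measure lebesgue K"
    using pmax[OF q] by (intro mult_right_mono power_mono) auto
  ultimately show ?thesis
    by linarith
qed

text \<open>The rows are treated one by one: a component that varies by at most \<open>D\<close>
  between vertices varies by at most \<open>D\<close> on \<open>K\<close>, and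
  \<open>measure_mult_norm_le_width\<close> with diameter bound \<open>Cm * h\<close> and volume at
  least \<open>h ^ 3\<close> bounds the row by 4 Cm^2 D / h. The factor \<open>CARD('d)\<close> is
  the number of rows.\<close>

lemma elem_grad_upper:
  fixes v :: "real^3 \<Rightarrow> real^'d"
  assumes v: "v \<in> P1_vector_space \<Omega> \<T>" and K: "K \<in> \<T>"
    and D: "\<And>p q. p \<in> verts K \<Longrightarrow> q \<in> verts K \<Longrightarrow> norm (v p - v q) \<le> D"
  shows "norm (elem_grad v K) \<le> real CARD('d) * (4 * Cm\<^sup>2) * D / h"
proof -
  let ?A = "elem_grad v K"
  have row: "norm (?A $ i) \<le> 4 * Cm\<^sup>2 * D / h" for i
  proof (cases "?A $ i = 0")
    case True
    obtain q where "q \<in> verts K"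
      using verts_nonempty[OF K] by blast
    then have "0 \<le> D"
      using D[of q q] by simp
    then show ?thesis
      using True h_pos by simp
  next
    case False
    have ne: "K \<noteq> {}"
      using verts_nonempty[OF K] verts_elem[OF K] by blast
    have comp: "(v x - v y) $ i = inner (?A $ i) x - inner (?A $ i) y" if "x \<in> K" "y \<in> K" for x y
    proof -
      have "(v x - v y) $ i = (?A *v (x - y)) $ i"
        by (simp only: P1_diff[OF v K that])
      then show ?thesis
        by (simp add: matrix_vector_mult_def inner_vec_def right_diff_distrib sum_subtractf)
    qed
    have "inner (?A $ i) x - inner (?A $ i) y \<le> D" if xy: "x \<in> K" "y \<in> K" for x y
    proof -
      have cv: "convex_on (convex hull (verts K)) (\<lambda>x. inner a x)" for a :: "real^3"
        by (simp add: convex_on_def inner_add_right)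
      \<comment> \<open>The oscillation is bounded in one argument at a time: here \<open>x\<close>
        is free and \<open>q\<close> a vertex, afterwards the second argument becomes free through
        the negated functional.\<close>
      have 1: "\<forall>x\<in>convex hull (verts K). inner (?A $ i) x \<le> D + inner (?A $ i) q" if q: "q \<in> verts K" for q
      proof (rule convex_on_convex_hull_bound[OF cv], intro ballI)
        fix p assume p: "p \<in> verts K"
        have "inner (?A $ i) p - inner (?A $ i) q = (v p - v q) $ i"
          using comp[OF subsetD[OF verts_elem[OF K] p] subsetD[OF verts_elem[OF K] q]] by (rule sym)
        also have "\<dots> \<le> D"
          using component_le_norm_cart[of "v p - v q" i] D[OF p q] by linarith
        finally show "inner (?A $ i) p \<le> D + inner (?A $ i) q"
          by simp
      qed
      have "\<forall>q\<in>convex hull (verts K). inner (- ?A $ i) q \<le> D - inner (?A $ i) x"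
      proof (rule convex_on_convex_hull_bound[OF cv], intro ballI)
        fix q assume "q \<in> verts K"
        then show "inner (- ?A $ i) q \<le> D - inner (?A $ i) x"
          using 1 xy(1) elem_hull[OF K] by force
      qed
      then show ?thesis
        using xy(2) elem_hull[OF K] by force
    qed
    from measure_mult_norm_le_width[OF elem_compact[OF K] ne False this elem_dist[OF K]]
    have "measure lebesgue K * norm (?A $ i) \<le> D * (2 * (Cm * h))\<^sup>2" .
    moreover have "h ^ 3 * norm (?A $ i) \<le> measure lebesgue K * norm (?A $ i)"
      using elem_measure[OF K] by (intro mult_right_mono) auto
    ultimately have "h\<^sup>2 * (h * norm (?A $ i)) \<le> h\<^sup>2 * (4 * Cm\<^sup>2 * D)"
      by (simp add: power2_eq_square power3_eq_cube algebra_simps)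
    then show ?thesis
      using h_pos by (simp add: field_simps)
  qed
  have "norm ?A \<le> (\<Sum>i\<in>UNIV. norm (?A $ i))"
    by (simp add: norm_vec_def L2_set_le_sum)
  also have "\<dots> \<le> (\<Sum>i\<in>(UNIV::'d set). 4 * Cm\<^sup>2 * D / h)"
    by (intro sum_mono row)
  finally show ?thesis
    by simp
qed

lemma elem_grad_lower:
  assumes v: "v \<in> P1_vector_space \<Omega> \<T>" and K: "K \<in> \<T>" and pq: "p \<in> verts K" "q \<in> verts K"
  shows "norm (v p - v q) \<le> norm (elem_grad v K) * (Cm * h)"
proof -
  have pqK: "p \<in> K" "q \<in> K"
    using pq verts_elem[OF K] by auto
  have "norm (v p - v q) \<le> norm (elem_grad v K) * norm (p - q)"
    unfolding P1_diff[OF v K pqK] by (rule matrix_mult_norm_le)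
  also have "\<dots> \<le> norm (elem_grad v K) * (Cm * h)"
    using elem_dist[OF K pqK] by (intro mult_left_mono) (auto simp: dist_norm)
  finally show ?thesis .
qed

lemma AE_grad_elem:
  fixes v :: "real^3 \<Rightarrow> real^'d"
  assumes v: "v \<in> P1_vector_space \<Omega> \<T>" and K: "K \<in> \<T>"
  shows "AE x in lebesgue_on \<Omega>. x \<in> K \<longrightarrow> grad v x = elem_grad v K"
  using AE_not_skeleton
proof eventually_elim
  case (elim x)
  have "x \<in> interior K" if "x \<in> K"
    using that elim K closure_subset[of K] by (auto simp: frontier_def)
  then show ?case
    using P1_has_derivative(2)[OF v K] by blast
qed

lemma integral_elem_grad:
  fixes v :: "real^3 \<Rightarrow> real^'d"
  assumes v: "v \<in> P1_vector_space \<Omega> \<T>" and K: "K \<in> \<T>"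
  shows "(LINT x|lebesgue_on \<Omega>. indicator K x * (norm (grad v x))\<^sup>2)
    = (norm (elem_grad v K))\<^sup>2 * measure lebesgue K"
proof -
  have "(LINT x|lebesgue_on \<Omega>. indicator K x * (norm (grad v x))\<^sup>2)
      = (LINT x|lebesgue_on \<Omega>. (norm (elem_grad v K))\<^sup>2 * indicator K x)"
  proof (rule integral_cong_AE)
    show "(\<lambda>x. indicator K x * (norm (grad v x))\<^sup>2) \<in> borel_measurable (lebesgue_on \<Omega>)"
      by (intro borel_measurable_integrable integrable_elem_mult K ess_bounded_norm_sq grad_ess_bounded v)
    show "(\<lambda>x. (norm (elem_grad v K))\<^sup>2 * indicator K x) \<in> borel_measurable (lebesgue_on \<Omega>)"
      using integral_indicator_domain(2)[OF elem_lmeasurable[OF K] elem_closure[OF K]] by simp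
    show "AE x in lebesgue_on \<Omega>. indicator K x * (norm (grad v x))\<^sup>2 = (norm (elem_grad v K))\<^sup>2 * indicator K x"
      using AE_grad_elem[OF v K] by eventually_elim (simp add: indicator_def)
  qed
  then show ?thesis
    using integral_indicator_domain(1)[OF elem_lmeasurable[OF K] elem_closure[OF K]] by simp
qed

text \<open>\<open>Linf_norm\<close> applies \<open>real_of_ereal\<close>, which sends infinite
  values to \<open>0\<close>. Essential boundedness excludes the value infinity, and the positive
  measure of the nonempty open set \<open>\<Omega>\<close> excludes minus infinity.\<close>

lemma Linf_norm_bound:
  fixes f :: "real^3 \<Rightarrow> 'b::euclidean_space"
  assumes f: "ess_bounded (lebesgue_on \<Omega>) f"
  shows "AE x in lebesgue_on \<Omega>. norm (f x) \<le> Linf_norm (lebesgue_on \<Omega>) f"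
    and "0 \<le> Linf_norm (lebesgue_on \<Omega>) f"
proof -
  let ?M = "lebesgue_on \<Omega>" and ?s = "esssup (lebesgue_on \<Omega>) (\<lambda>x. ereal (norm (f x)))"
  obtain c where c: "AE x in ?M. norm (f x) \<le> c"
    using f by (auto simp: ess_bounded_def)
  have meas: "(\<lambda>x. ereal (norm (f x))) \<in> borel_measurable ?M"
    using ess_bounded_measurable[OF f] by simp
  have ub: "?s \<le> ereal c"
    using c by (intro esssup_I meas) auto
  have "emeasure ?M (space ?M) \<noteq> 0"
  proof
    assume "emeasure ?M (space ?M) = 0"
    then have "negligible \<Omega>"
      by (simp add: emeasure_restrict_space negligible_iff_null_sets null_sets_def)
    then show False
      using open_domain domain_nonempty open_not_negligible by blast
  qed
  then have "(0::ereal) = esssup ?M (\<lambda>x. 0)"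
    by (simp add: esssup_const)
  also have "\<dots> \<le> ?s"
    by (intro esssup_mono) auto
  finally have lb: "0 \<le> ?s" .
  have fin: "ereal (real_of_ereal ?s) = ?s"
    using ub lb by (intro ereal_real') auto
  show "0 \<le> Linf_norm ?M f"
    using lb by (simp add: Linf_norm_def real_of_ereal_pos)
  have "AE x in ?M. ereal (norm (f x)) \<le> ?s"
    by (rule esssup_AE)
  then show "AE x in ?M. norm (f x) \<le> Linf_norm ?M f"
  proof eventually_elim
    case (elim x)
    then have "ereal (norm (f x)) \<le> ereal (real_of_ereal ?s)"
      by (simp only: fin)
    then show ?case
      by (simp add: Linf_norm_def)
  qed
qed

text \<open>The gradient is constant on \<open>K\<close> up to a null set; if it exceeded the
  essential bound, \<open>K\<close> would be null, contrary to its positive volume.\<close>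

lemma elem_grad_le_Linf:
  assumes v: "v \<in> P1_vector_space \<Omega> \<T>" and K: "K \<in> \<T>"
  shows "norm (elem_grad v K) \<le> Linf_norm (lebesgue_on \<Omega>) (grad v)"
proof (rule ccontr)
  assume neg: "\<not> ?thesis"
  have "AE x in lebesgue_on \<Omega>. x \<notin> K"
    using Linf_norm_bound(1)[OF grad_ess_bounded[OF v]] AE_grad_elem[OF v K]
  proof eventually_elim
    case (elim x)
    then show ?case
      using neg by metis
  qed
  then have "AE x in lebesgue_on \<Omega>. indicator K x = (0::real)"
    by eventually_elim simp
  then have "(LINT x|lebesgue_on \<Omega>. indicator K x) = (0::real)"
    using integral_eq_zero_AE by blast
  then have "measure lebesgue K = 0"
    using integral_indicator_domain(1)[OF elem_lmeasurable[OF K] elem_closure[OF K]] by simp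
  then show False
    using elem_measure[OF K] h_pos by simp
qed

end

section \<open>Piecewise affine functions are weakly differentiable\<close>

context fe_mesh
begin

text \<open>The preimages of the elements cover the parameter interval by finitely many closed sets,
  and Lipschitz bounds on these glue along an interval. The sum of the element gradients is a common
  Lipschitz factor for all of them.\<close>

lemma P1_lipschitz_on_segment:
  assumes v: "v \<in> P1_vector_space \<Omega> \<T>" and seg: "closed_segment x y \<subseteq> closure \<Omega>"
  shows "norm (v y - v x) \<le> (\<Sum>K\<in>\<T>. norm (elem_grad v K)) * norm (y - x)"
proof -
  define B where "B = (\<Sum>K\<in>\<T>. norm (elem_grad v K))"
  define l where "l t = x + t *\<^sub>R (y - x)" for t
  define U where "U K = l -` K" for K
  have "(B * norm (y - x))-lipschitz_on {0..1} (v \<circ> l)"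
  proof (rule lipschitz_on_closed_Union[where I = \<T> and U = U])
    fix K assume K: "K \<in> \<T>"
    show "closed (U K)"
      unfolding U_def l_def using elem_compact[OF K]
      by (intro closed_vimage compact_imp_closed continuous_intros)
    show "(B * norm (y - x))-lipschitz_on (U K) (v \<circ> l)"
    proof (rule lipschitz_onI)
      fix s t assume st: "s \<in> U K" "t \<in> U K"
      then have "v (l s) - v (l t) = elem_grad v K *v (l s - l t)"
        by (intro P1_diff[OF v K]) (auto simp: U_def)
      also have "l s - l t = (s - t) *\<^sub>R (y - x)"
        by (simp add: l_def scaleR_diff_left)
      finally have "dist (v (l s)) (v (l t)) \<le> norm (elem_grad v K) * norm ((s - t) *\<^sub>R (y - x))"
        using matrix_mult_norm_le by (metis dist_norm)
      also have "\<dots> \<le> B * norm ((s - t) *\<^sub>R (y - x))"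
        unfolding B_def using K finite_mesh by (intro mult_right_mono member_le_sum) auto
      finally show "dist ((v \<circ> l) s) ((v \<circ> l) t) \<le> B * norm (y - x) * dist s t"
        by (simp add: dist_real_def mult_ac)
    next
      show "0 \<le> B * norm (y - x)"
        by (simp add: B_def sum_nonneg)
    qed
  next
    show "0 \<le> B * norm (y - x)"
      by (simp add: B_def sum_nonneg)
    have "l t \<in> closed_segment x y" if "t \<in> {0..1}" for t
      using that by (auto simp: l_def in_segment algebra_simps intro!: exI[of _ t])
    then show "{0..1} \<subseteq> (\<Union>K\<in>\<T>. U K)"
      using seg Union_mesh by (fastforce simp: U_def)
  qed (rule finite_mesh)
  from lipschitz_onD[OF this, of 1 0] show ?thesis
    by (simp add: l_def B_def dist_norm)
qed

lemma ess_bounded_L2: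
  assumes "ess_bounded (lebesgue_on \<Omega>) f"
  shows "f \<in> L2_space \<Omega>"
  using ess_bounded_measurable[OF assms]
    ess_bounded_integrable[OF finite_measure_domain ess_bounded_norm_sq[OF assms]]
  by (simp add: L2_space_def)

end

section \<open>Integrals of directional derivatives over the whole space\<close>

lemma lebesgue_integral_translate_diff:
  fixes g :: "'a::euclidean_space \<Rightarrow> real"
  assumes cont: "continuous_on UNIV g" and int: "integrable lebesgue g"
  shows "(LINT x|lebesgue. (g (x + a) - g x) / t) = 0"
proof -
  have [measurable]: "g \<in> borel_measurable borel"
    using cont by (rule borel_measurable_continuous_onI)
  have plus: "distr lborel borel (\<lambda>x. a + x) = lborel"
    using lborel_affine[of 1 a] by (simp add: density_1)
  have int_g: "integrable lborel g"
    using int by (simp add: integrable_completion)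
  then have "integrable (distr lborel borel (\<lambda>x. a + x)) g"
    by (simp add: plus)
  then have int_a: "integrable lborel (\<lambda>x. g (a + x))"
    by (subst (asm) integrable_distr_eq) auto
  have "(LINT x|lborel. g (a + x)) = (LINT x|distr lborel borel (\<lambda>x. a + x). g x)"
    by (subst integral_distr) auto
  then have eq: "(LINT x|lborel. g (a + x)) = (LINT x|lborel. g x)"
    by (simp add: plus)
  have "(LINT x|lebesgue. (g (x + a) - g x) / t) = (LINT x|lborel. (g (a + x) - g x) / t)"
    by (subst integral_completion) (auto simp: add.commute)
  also have "\<dots> = 0"
    using int_g int_a eq by simp
  finally show ?thesis .
qed

text \<open>Difference quotients of a compactly supported function integrate to zero, and pass to the
  limit by dominated convergence.\<close>

lemma lebesgue_integral_derivative_zero: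
  fixes g D :: "'a::euclidean_space \<Rightarrow> real"
  assumes cont: "continuous_on UNIV g" and supp: "\<And>x. norm x > r \<Longrightarrow> g x = 0"
    and \<delta>: "0 < \<delta>" and e: "norm e = 1"
    and lips: "\<And>x t. 0 < t \<Longrightarrow> t < \<delta> \<Longrightarrow> \<bar>g (x + t *\<^sub>R e) - g x\<bar> \<le> c * t"
    and deriv: "AE x in lebesgue. ((\<lambda>t. g (x + t *\<^sub>R e)) has_real_derivative D x) (at 0)"
    and D: "D \<in> borel_measurable lebesgue"
  shows "(LINT x|lebesgue. D x) = 0"
proof -
  \<comment> \<open>A null sequence of positive steps; the shift by \<open>2\<close> keeps every
    step strictly below \<open>\<delta>\<close>, where \<open>lips\<close> applies.\<close>
  define t where "t n = \<delta> / real (n + 2)" for n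
  have t: "0 < t n" "t n < \<delta>" "t n \<le> \<delta>" for n
    using \<delta> by (auto simp: t_def field_simps add_pos_nonneg)
  have "t \<longlonglongrightarrow> 0"
    unfolding t_def by (rule LIMSEQ_ignore_initial_segment[OF lim_const_over_n])
  then have t_at: "filterlim t (at 0) sequentially"
    using t(1) by (auto simp: filterlim_at intro!: always_eventually) (metis less_irrefl)
  define q where "q n x = (g (x + t n *\<^sub>R e) - g x) / t n" for n x
  have gm [measurable]: "g \<in> borel_measurable borel"
    using cont by (rule borel_measurable_continuous_onI)
  have qm: "q n \<in> borel_measurable lebesgue" for n
    unfolding q_def by (intro measurable_completion) measurable
  have c: "0 \<le> c"
  proof -
    have "0 \<le> c * t 0"
      using lips[OF t(1,2), of 0 0] by linarith
    then show ?thesis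
      using t(1)[of 0] by (simp add: zero_le_mult_iff)
  qed
  have "compact (g ` cball 0 r)"
    using cont by (intro compact_continuous_image) (auto intro: continuous_on_subset)
  then obtain b where b: "\<And>x. x \<in> cball 0 r \<Longrightarrow> \<bar>g x\<bar> \<le> b"
    using compact_imp_bounded bounded_iff by (metis imageI real_norm_def)
  have cball: "integrable lebesgue (indicator (cball 0 \<rho>) :: 'a \<Rightarrow> real)" for \<rho> :: real
    using lmeasurable_cball[of "0::'a" \<rho>]
    by (intro integrable_real_indicator) (auto simp: fmeasurable_def infinity_ennreal_def)
  have int_g: "integrable lebesgue g"
  proof (rule Bochner_Integration.integrable_bound[of _ "\<lambda>x. b * indicator (cball 0 r) x"])
    show "AE x in lebesgue. norm (g x) \<le> norm (b * indicator (cball 0 r) x)"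
      using b supp by (intro AE_I2) (force simp: indicator_def not_le)
  qed (use cball in \<open>auto intro: measurable_completion\<close>)
  have "(\<lambda>n. LINT x|lebesgue. q n x) \<longlonglongrightarrow> (LINT x|lebesgue. D x)"
  proof (rule integral_dominated_convergence[OF D qm])
    \<comment> \<open>The ball is enlarged by \<open>\<delta>\<close> because the translates reach
      the support from that distance.\<close>
    show "integrable lebesgue (\<lambda>x::'a. c * indicator (cball 0 (\<bar>r\<bar> + \<delta>)) x)"
      using cball by simp
    show "AE x in lebesgue. (\<lambda>n. q n x) \<longlonglongrightarrow> D x"
      using deriv
    proof eventually_elim
      case (elim x)
      then have "((\<lambda>h. (g (x + h *\<^sub>R e) - g x) / h) \<longlongrightarrow> D x) (at 0)"
        by (simp add: DERIV_def)
      from filterlim_compose[OF this t_at] show ?case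
        by (simp add: q_def)
    qed
    show "AE x in lebesgue. norm (q n x) \<le> c * indicator (cball 0 (\<bar>r\<bar> + \<delta>)) x" for n
    proof (rule AE_I2)
      fix x
      show "norm (q n x) \<le> c * indicator (cball 0 (\<bar>r\<bar> + \<delta>)) x"
      proof (cases "norm x \<le> \<bar>r\<bar> + \<delta>")
        case True
        then show ?thesis
          using lips[OF t(1,2), of x n] t(1)[of n] by (simp add: q_def divide_le_eq)
      next
        case False
        have "norm x \<le> norm (x + t n *\<^sub>R e) + norm (t n *\<^sub>R e)"
          using norm_triangle_ineq4[of "x + t n *\<^sub>R e" "t n *\<^sub>R e"] by simp
        then have "norm (x + t n *\<^sub>R e) > r" "norm x > r"
          using False e t[of n] \<delta> by auto
        then show ?thesis
          using supp c by (simp add: q_def)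
      qed
    qed
  qed
  moreover have "(LINT x|lebesgue. q n x) = 0" for n
    unfolding q_def by (rule lebesgue_integral_translate_diff[OF cont int_g])
  ultimately have "(\<lambda>_::nat. 0) \<longlonglongrightarrow> (LINT x|lebesgue. D x)"
    by simp
  then show ?thesis
    by (simp add: LIMSEQ_const_iff)
qed

lemma test_function_properties:
  assumes "test_function \<Omega> \<eta>"
  shows "\<eta> differentiable at x" and "continuous_on UNIV (\<lambda>x. frechet_derivative \<eta> (at x) (axis j 1))"
    and "continuous_on UNIV \<eta>"
    and "compact (closure {x. \<eta> x \<noteq> 0})" and "closure {x. \<eta> x \<noteq> 0} \<subseteq> \<Omega>"
proof -
  have "C_k (Suc 0) \<eta>" "C_k 0 \<eta>"
    using assms unfolding test_function_def by blast+
  then show "\<eta> differentiable at x" "continuous_on UNIV (\<lambda>x. frechet_derivative \<eta> (at x) (axis j 1))"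
    "continuous_on UNIV \<eta>"
    by simp_all
  show "compact (closure {x. \<eta> x \<noteq> 0})" "closure {x. \<eta> x \<noteq> 0} \<subseteq> \<Omega>"
    using assms by (auto simp: test_function_def)
qed

lemma has_real_derivative_along_line:
  fixes f :: "'a::real_normed_vector \<Rightarrow> real"
  assumes "(f has_derivative F) (at (x + s *\<^sub>R e))"
  shows "((\<lambda>t. f (x + t *\<^sub>R e)) has_real_derivative F e) (at s)"
proof -
  have "((\<lambda>t. x + t *\<^sub>R e) has_derivative (\<lambda>h. h *\<^sub>R e)) (at s)"
    by (auto intro!: derivative_eq_intros)
  from has_derivative_compose[OF this assms]
  have "((\<lambda>t. f (x + t *\<^sub>R e)) has_derivative (\<lambda>h. F (h *\<^sub>R e))) (at s)" .
  moreover have "F (h *\<^sub>R e) = F e * h" for h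
    using linear_scale[OF has_derivative_linear[OF assms]] by simp
  ultimately show ?thesis
    by (simp add: has_field_derivative_def)
qed

lemma ess_bounded_component:
  fixes f :: "'a \<Rightarrow> ('b::euclidean_space)^'n"
  assumes "ess_bounded M f"
  shows "ess_bounded M (\<lambda>x. f x $ i)"
proof -
  have "(\<lambda>x. f x $ i) \<in> borel_measurable M"
    using ess_bounded_measurable[OF assms]
    by (rule borel_measurable_continuous_on[rotated]) (intro continuous_intros)
  moreover obtain c where "AE x in M. norm (f x) \<le> c"
    using assms by (auto simp: ess_bounded_def)
  then have "AE x in M. norm (f x $ i) \<le> c"
    by eventually_elim (rule order.trans[OF Finite_Cartesian_Product.norm_nth_le])
  ultimately show ?thesis
    by (rule ess_boundedI)
qed

text \<open>Integration by parts without face terms: a component of \<open>v\<close> times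
  \<open>\<eta>\<close> is Lipschitz for short steps along an axis and differentiable off the
  skeleton, so the integral of its derivative vanishes. The continuity of \<open>v\<close> across
  faces enters through the Lipschitz bound.\<close>

lemma (in fe_mesh) P1_weak_gradient:
  assumes v: "v \<in> P1_vector_space \<Omega> \<T>"
  shows "weak_gradient \<Omega> v (grad v)"
  unfolding weak_gradient_def
proof (intro allI impI)
  fix \<eta> and i j :: 3
  assume tf: "test_function \<Omega> \<eta>"
  let ?e = "axis j (1::real)"
  define d\<eta> where "d\<eta> x = frechet_derivative \<eta> (at x) ?e" for x
  define S where "S = closure {x. \<eta> x \<noteq> 0}"
  note tfp = test_function_properties[OF tf, folded S_def]
  have S: "compact S" "S \<subseteq> \<Omega>"
    by (fact tfp(4,5))+
  have \<eta>0: "\<eta> x = 0" if "x \<notin> S" for x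
    using that closure_subset[of "{x. \<eta> x \<noteq> 0}"] by (auto simp: S_def)
  have open_S: "open (- S)"
    using S(1) by (simp add: compact_imp_closed open_Compl)
  have \<eta>': "(\<eta> has_derivative frechet_derivative \<eta> (at x)) (at x)" for x
    using tfp(1) frechet_derivative_works by blast
  have d\<eta>0: "d\<eta> x = 0" if x: "x \<notin> S" for x
  proof -
    have "(\<eta> has_derivative (\<lambda>_. 0)) (at x)"
      by (rule has_derivative_transform_within_open[OF has_derivative_const[of 0] open_S])
        (use x \<eta>0 in auto)
    then show ?thesis
      using frechet_derivative_at by (metis d\<eta>_def)
  qed
  have cont_d\<eta>: "continuous_on A d\<eta>" and cont_\<eta>: "continuous_on A \<eta>" for A
    using tfp(2)[of j] tfp(3) continuous_on_subset[OF _ subset_UNIV] by (auto simp: d\<eta>_def[abs_def])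
  have bound: "\<exists>b\<ge>0. \<forall>x\<in>A. \<bar>f x\<bar> \<le> b" if A: "compact A" and f: "continuous_on A f"
    for f :: "real^3 \<Rightarrow> real" and A
  proof -
    obtain b where "\<forall>y\<in>f ` A. norm y \<le> b"
      using compact_imp_bounded[OF compact_continuous_image[OF f A]] bounded_iff by blast
    then show ?thesis
      by (intro exI[of _ "\<bar>b\<bar>"]) force
  qed
  obtain bd where bd: "0 \<le> bd" "\<And>x. \<bar>d\<eta> x\<bar> \<le> bd"
    using bound[OF S(1) cont_d\<eta>] d\<eta>0 by (metis abs_zero)
  obtain b\<eta> where b\<eta>: "0 \<le> b\<eta>" "\<And>x. \<bar>\<eta> x\<bar> \<le> b\<eta>"
    using bound[OF S(1) cont_\<eta>] \<eta>0 by (metis abs_zero)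
  have cont_v: "continuous_on (closure \<Omega>) (\<lambda>x. v x $ i)"
    using v by (simp add: P1_vector_space_def P1_space_def)
  obtain bv where bv: "0 \<le> bv" "\<And>x. x \<in> \<Omega> \<Longrightarrow> \<bar>v x $ i\<bar> \<le> bv"
    using bound[OF _ cont_v] bounded closure_subset by (metis compact_closure subsetD)
  define L where "L = (\<Sum>K\<in>\<T>. norm (elem_grad v K))"
  have L: "0 \<le> L"
    by (simp add: L_def sum_nonneg)
  \<comment> \<open>Off \<open>S\<close> the factor \<open>\<eta>\<close> is zero, so the arbitrary
    values of \<open>v\<close> outside the closure of the domain do not reach
    \<open>g\<close>.\<close>
  define g where "g x = v x $ i * \<eta> x" for x
  define f where "f x = v x $ i * d\<eta> x + grad v x $ i $ j * \<eta> x" for x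
  have d\<eta>_b: "ess_bounded (lebesgue_on \<Omega>) d\<eta>"
    by (rule ess_boundedI[of _ _ bd])
      (use continuous_imp_measurable_on_sets_lebesgue[OF cont_d\<eta> domain_sets] bd in auto)
  have \<eta>_b: "ess_bounded (lebesgue_on \<Omega>) \<eta>"
    by (rule ess_boundedI[of _ _ b\<eta>])
      (use continuous_imp_measurable_on_sets_lebesgue[OF cont_\<eta> domain_sets] b\<eta> in auto)
  have prod1: "ess_bounded (lebesgue_on \<Omega>) (\<lambda>x. v x $ i * d\<eta> x)"
    by (rule ess_bounded_mult[OF ess_bounded_component[OF P1_ess_bounded[OF v]] d\<eta>_b])
  have prod2: "ess_bounded (lebesgue_on \<Omega>) (\<lambda>x. grad v x $ i $ j * \<eta> x)"
    by (rule ess_bounded_mult[OF ess_bounded_component[OF ess_bounded_component[OF grad_ess_bounded[OF v]]] \<eta>_b])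
  obtain r where r: "\<And>x. x \<in> S \<Longrightarrow> norm x \<le> r"
    using compact_imp_bounded[OF S(1)] bounded_iff by blast
  obtain \<delta> where \<delta>: "0 < \<delta>" "(\<Union>x\<in>S. ball x \<delta>) \<subseteq> \<Omega>"
    using compact_subset_open_imp_ball_epsilon_subset[OF S(1) open_domain S(2)] by blast
  have "(LINT x|lebesgue. indicator \<Omega> x * f x) = 0"
  proof (rule lebesgue_integral_derivative_zero[of g r \<delta> ?e "bv * bd + b\<eta> * L"])
    \<comment> \<open>Two open sets cover the space: on \<open>\<Omega>\<close> both factors are
      continuous, on the complement of \<open>S\<close> the product is zero.\<close>
    have "continuous_on (\<Omega> \<union> - S) g"
    proof (rule continuous_on_open_Un[OF open_domain open_S])
      show "continuous_on \<Omega> g"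
        unfolding g_def by (intro continuous_intros cont_\<eta> continuous_on_subset[OF cont_v] closure_subset)
      show "continuous_on (- S) g"
        by (rule continuous_on_eq[OF continuous_on_const[of _ 0]]) (simp add: g_def \<eta>0)
    qed
    moreover have "\<Omega> \<union> - S = UNIV"
      using S(2) by blast
    ultimately show "continuous_on UNIV g"
      by simp
    show "g x = 0" if "norm x > r" for x
      using that r[of x] \<eta>0[of x] by (force simp: g_def)
    show "0 < \<delta>" "norm ?e = 1"
      using \<delta> by (auto simp: norm_axis_1)
    show "\<bar>g (x + t *\<^sub>R ?e) - g x\<bar> \<le> (bv * bd + b\<eta> * L) * t" if t: "0 < t" "t < \<delta>" for x t
    proof (cases "x \<in> S \<or> x + t *\<^sub>R ?e \<in> S")
      case False
      then show ?thesis
        using bv bd b\<eta> L t by (simp add: g_def \<eta>0)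
    next
      case True
      let ?y = "x + t *\<^sub>R ?e"
      \<comment> \<open>Both end points lie in one \<open>\<delta>\<close>-ball around a point of
        the support. This ball is convex and contained in \<open>\<Omega>\<close>, as the segment
        estimate for \<open>v\<close> requires.\<close>
      obtain s where s: "s \<in> S" "x \<in> ball s \<delta>" "?y \<in> ball s \<delta>"
        using True t \<delta>(1) by (force simp: dist_norm norm_axis_1)
      have seg: "closed_segment x ?y \<subseteq> \<Omega>"
        using closed_segment_subset[OF s(2,3) convex_ball] \<delta>(2) s(1) by blast
      then have \<Omega>: "?y \<in> \<Omega>"
        by auto
      have "\<bar>v ?y $ i - v x $ i\<bar> \<le> norm (v ?y - v x)"
        using component_le_norm_cart[of "v ?y - v x" i] by simp
      also have "\<dots> \<le> L * norm (?y - x)"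
        unfolding L_def using seg closure_subset by (intro P1_lipschitz_on_segment[OF v]) blast
      finally have v_lip: "\<bar>v ?y $ i - v x $ i\<bar> \<le> L * t"
        using t by (simp add: norm_axis_1)
      have "norm (\<eta> (x + t *\<^sub>R ?e) - \<eta> (x + 0 *\<^sub>R ?e)) \<le> bd * norm (t - 0)"
      proof (rule field_differentiable_bound[OF convex_UNIV])
        show "((\<lambda>t. \<eta> (x + t *\<^sub>R ?e)) has_real_derivative d\<eta> (x + s *\<^sub>R ?e)) (at s within UNIV)" for s
          using has_real_derivative_along_line[OF \<eta>'] by (simp add: d\<eta>_def)
      qed (use bd in auto)
      then have \<eta>_lip: "\<bar>\<eta> ?y - \<eta> x\<bar> \<le> bd * t"
        using t by simp
      have "g ?y - g x = v ?y $ i * (\<eta> ?y - \<eta> x) + \<eta> x * (v ?y $ i - v x $ i)"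
        by (simp add: g_def algebra_simps)
      then have "\<bar>g ?y - g x\<bar> \<le> \<bar>v ?y $ i\<bar> * \<bar>\<eta> ?y - \<eta> x\<bar> + \<bar>\<eta> x\<bar> * \<bar>v ?y $ i - v x $ i\<bar>"
        using abs_triangle_ineq by (simp add: abs_mult[symmetric])
      also have "\<dots> \<le> bv * (bd * t) + b\<eta> * (L * t)"
        using bv b\<eta> \<Omega> v_lip \<eta>_lip by (intro add_mono mult_mono) auto
      finally show ?thesis
        by (simp add: algebra_simps)
    qed
    have "AE x in lebesgue. x \<notin> frontier \<Omega> \<union> (\<Union>K\<in>\<T>. frontier K)"
      using negligible_skeleton by (intro AE_not_in) (simp add: negligible_iff_null_sets)
    then show "AE x in lebesgue. ((\<lambda>t. g (x + t *\<^sub>R ?e)) has_real_derivative indicator \<Omega> x * f x) (at 0)"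
    proof eventually_elim
      case (elim x)
      show ?case
      proof (cases "x \<in> S")
        case False
        have "(g has_derivative (\<lambda>_. 0)) (at (x + 0 *\<^sub>R ?e))"
          by (rule has_derivative_transform_within_open[OF has_derivative_const[of 0] open_S])
            (use False \<eta>0 in \<open>auto simp: g_def\<close>)
        from has_real_derivative_along_line[OF this] show ?thesis
          using \<eta>0[OF False] d\<eta>0[OF False] by (simp add: f_def)
      next
        case True
        then have x: "x \<in> \<Omega>" "x \<in> closure \<Omega>"
          using S(2) closure_subset by blast+
        then obtain K where K: "K \<in> \<T>" "x \<in> K"
          using Union_mesh by blast
        then have "x \<in> interior K"
          using elim closure_subset[of K] by (auto simp: frontier_def)
        note v' = P1_has_derivative[OF v K(1) this]
        have "((\<lambda>x. v x $ i) has_derivative (\<lambda>h. (elem_grad v K *v h) $ i)) (at x)"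
          using bounded_linear.has_derivative[OF bounded_linear_vec_nth v'(1)] .
        from has_derivative_mult[OF this \<eta>'[of x]]
        have "(g has_derivative (\<lambda>h. v x $ i * frechet_derivative \<eta> (at x) h
            + (elem_grad v K *v h) $ i * \<eta> x)) (at (x + 0 *\<^sub>R ?e))"
          by (simp add: g_def[abs_def])
        from has_real_derivative_along_line[OF this] show ?thesis
          using x(1) by (simp add: f_def d\<eta>_def v'(2) matrix_vector_mult_basis column_def)
      qed
    qed
    have "f \<in> borel_measurable (lebesgue_on \<Omega>)"
      unfolding f_def using ess_bounded_measurable[OF ess_bounded_add[OF prod1 prod2]] .
    then show "(\<lambda>x. indicator \<Omega> x * f x) \<in> borel_measurable lebesgue"
      by (subst (asm) borel_measurable_restrict_space_iff) auto
  qed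
  then have "(LINT x|lebesgue_on \<Omega>. f x) = 0"
    by (subst integral_restrict_space) auto
  then show "(LINT x|lebesgue_on \<Omega>. v x $ i * frechet_derivative \<eta> (at x) (axis j 1))
      = - (LINT x|lebesgue_on \<Omega>. grad v x $ i $ j * \<eta> x)"
    using ess_bounded_integrable[OF finite_measure_domain prod1]
      ess_bounded_integrable[OF finite_measure_domain prod2]
    by (simp add: f_def d\<eta>_def)
qed

lemma (in fe_mesh) P1_H1:
  "v \<in> P1_vector_space \<Omega> \<T> \<Longrightarrow> v \<in> H1_space \<Omega>"
  using ess_bounded_L2[OF P1_ess_bounded] ess_bounded_L2[OF grad_ess_bounded] P1_weak_gradient
  unfolding H1_space_def by blast

section \<open>Comparison of two finite element functions through their nodal values\<close>

context fe_mesh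
begin

text \<open>On each element both sides are compared with the largest nodal value of
  \<open>v\<close>. The volume of the element cancels, so the constant is absolute.\<close>

lemma L2_nodal_comparison:
  assumes u: "u \<in> P1_vector_space \<Omega> \<T>" and v: "v \<in> P1_vector_space \<Omega> \<T>"
    and le: "\<And>p. p \<in> nodes \<T> \<Longrightarrow> norm (u p) \<le> norm (v p)"
  shows "(LINT x|lebesgue_on \<Omega>. (norm (u x))\<^sup>2) \<le> 1024 * (LINT x|lebesgue_on \<Omega>. (norm (v x))\<^sup>2)"
proof -
  have elemwise: "(LINT x|lebesgue_on \<Omega>. indicator K x * (norm (u x))\<^sup>2)
      \<le> 1024 * (LINT x|lebesgue_on \<Omega>. indicator K x * (norm (v x))\<^sup>2)" if K: "K \<in> \<T>" for K
  proof -
    obtain q where q: "q \<in> verts K" "\<And>p. p \<in> verts K \<Longrightarrow> norm (v p) \<le> norm (v q)"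
      using max_vertex[OF K, of "\<lambda>p. norm (v p)"] by blast
    have "norm (u p) \<le> norm (v q)" if "p \<in> verts K" for p
      using le[of p] q(2)[OF that] verts_subset[OF K] that by (meson order.trans subsetD)
    from P1_elem_upper[OF u K this] P1_elem_lower[OF v K q(1)] show ?thesis
      by linarith
  qed
  have int: "ess_bounded (lebesgue_on \<Omega>) w \<Longrightarrow> integrable (lebesgue_on \<Omega>) (\<lambda>x. (norm (w x))\<^sup>2)"
    for w :: "real^3 \<Rightarrow> real^'k"
    by (rule ess_bounded_integrable[OF finite_measure_domain ess_bounded_norm_sq])
  show ?thesis
    unfolding integral_eq_sum_elems[OF int[OF P1_ess_bounded[OF u]]]
      integral_eq_sum_elems[OF int[OF P1_ess_bounded[OF v]]] sum_distrib_left
    by (intro sum_mono elemwise)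
qed

text \<open>The hypothesis \<open>le\<close> is a discrete product rule, \<open>s\<close> being a
  Lipschitz constant of the nodal isometries in the values of \<open>m\<close>. Vertex differences
  contribute \<open>Cm * h\<close> and \<open>elem_grad_upper\<close> contributes 4 d Cm^2 / h, so
  \<open>h\<close> cancels and the square is 16 d^2 Cm^6. A factor 2 comes from splitting the square
  of a sum, and \<open>1024\<close> from \<open>P1_elem_lower\<close>.\<close>

lemma grad_nodal_comparison:
  fixes u :: "real^3 \<Rightarrow> real^'d"
  assumes u: "u \<in> P1_vector_space \<Omega> \<T>" and v: "v \<in> P1_vector_space \<Omega> \<T>"
    and m: "m \<in> P1_vector_space \<Omega> \<T>" and s: "0 \<le> s"
    and le: "\<And>p q. p \<in> nodes \<T> \<Longrightarrow> q \<in> nodes \<T> \<Longrightarrow>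
      norm (u p - u q) \<le> norm (v p - v q) + s * norm (m p - m q) * norm (v q)"
  defines "g \<equiv> Linf_norm (lebesgue_on \<Omega>) (grad m)"
  shows "(LINT x|lebesgue_on \<Omega>. (norm (grad u x))\<^sup>2)
    \<le> 32 * (real CARD('d))\<^sup>2 * Cm ^ 6 * ((LINT x|lebesgue_on \<Omega>. (norm (grad v x))\<^sup>2)
        + 1024 * s\<^sup>2 * g\<^sup>2 * (LINT x|lebesgue_on \<Omega>. (norm (v x))\<^sup>2))"
proof -
  define d where "d = real CARD('d)"
  have g0: "0 \<le> g"
    unfolding g_def by (rule Linf_norm_bound(2)[OF grad_ess_bounded[OF m]])
  have elemwise: "(LINT x|lebesgue_on \<Omega>. indicator K x * (norm (grad u x))\<^sup>2)
      \<le> 32 * d\<^sup>2 * Cm ^ 6 * ((LINT x|lebesgue_on \<Omega>. indicator K x * (norm (grad v x))\<^sup>2)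
        + 1024 * s\<^sup>2 * g\<^sup>2 * (LINT x|lebesgue_on \<Omega>. indicator K x * (norm (v x))\<^sup>2))"
    if K: "K \<in> \<T>" for K
  proof -
    obtain r where r: "r \<in> verts K" "\<And>p. p \<in> verts K \<Longrightarrow> norm (v p) \<le> norm (v r)"
      using max_vertex[OF K, of "\<lambda>p. norm (v p)"] by blast
    let ?A = "norm (elem_grad u K)" and ?B = "norm (elem_grad v K)" and ?N = "norm (v r)"
    have Cmh: "0 \<le> Cm * h"
      using Cm_ge_1 h_pos by simp
    have "norm (u p - u q) \<le> (?B + s * g * ?N) * (Cm * h)" if pq: "p \<in> verts K" "q \<in> verts K" for p q
    proof -
      have "norm (u p - u q) \<le> norm (v p - v q) + s * norm (m p - m q) * norm (v q)"
        using le pq verts_subset[OF K] by blast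
      also have "\<dots> \<le> ?B * (Cm * h) + s * (g * (Cm * h)) * ?N"
      proof (intro add_mono mult_mono mult_left_mono)
        show "norm (v p - v q) \<le> ?B * (Cm * h)"
          by (rule elem_grad_lower[OF v K pq])
        have "norm (m p - m q) \<le> norm (elem_grad m K) * (Cm * h)"
          by (rule elem_grad_lower[OF m K pq])
        also have "\<dots> \<le> g * (Cm * h)"
          unfolding g_def using Cmh by (intro mult_right_mono elem_grad_le_Linf m K)
        finally show "norm (m p - m q) \<le> g * (Cm * h)" .
      qed (use s g0 Cmh r(2)[OF pq(2)] in auto)
      finally show ?thesis
        by (simp add: algebra_simps)
    qed
    from elem_grad_upper[OF u K this]
    have "?A \<le> d * (4 * Cm\<^sup>2) * ((?B + s * g * ?N) * (Cm * h)) / h"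
      by (simp only: d_def)
    also have "\<dots> = 4 * d * Cm ^ 3 * (?B + s * g * ?N)"
      using h_pos by (simp add: power2_eq_square power3_eq_cube)
    finally have "?A \<le> 4 * d * Cm ^ 3 * (?B + s * g * ?N)" .
    then have "?A\<^sup>2 \<le> (4 * d * Cm ^ 3 * (?B + s * g * ?N))\<^sup>2"
      by (intro power_mono) auto
    also have "\<dots> = 16 * d\<^sup>2 * Cm ^ 6 * (?B + s * g * ?N)\<^sup>2"
      by (simp add: power_mult_distrib)
    also have "\<dots> \<le> 16 * d\<^sup>2 * Cm ^ 6 * (2 * ?B\<^sup>2 + 2 * (s * g * ?N)\<^sup>2)"
    proof (rule mult_left_mono)
      show "(?B + s * g * ?N)\<^sup>2 \<le> 2 * ?B\<^sup>2 + 2 * (s * g * ?N)\<^sup>2"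
        using sum_squares_ge_zero[of "?B - s * g * ?N" 0] by (simp add: power2_eq_square algebra_simps)
    qed (use Cm_ge_1 in simp)
    finally have "?A\<^sup>2 * measure lebesgue K
        \<le> 16 * d\<^sup>2 * Cm ^ 6 * (2 * ?B\<^sup>2 + 2 * (s * g * ?N)\<^sup>2) * measure lebesgue K"
      by (rule mult_right_mono) simp
    also have "\<dots> = 32 * d\<^sup>2 * Cm ^ 6 * (?B\<^sup>2 * measure lebesgue K + s\<^sup>2 * g\<^sup>2 * (?N\<^sup>2 * measure lebesgue K))"
      by (simp add: algebra_simps power_mult_distrib)
    also have "\<dots> \<le> 32 * d\<^sup>2 * Cm ^ 6 * (?B\<^sup>2 * measure lebesgue K
        + s\<^sup>2 * g\<^sup>2 * (1024 * (LINT x|lebesgue_on \<Omega>. indicator K x * (norm (v x))\<^sup>2)))"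
      using Cm_ge_1 by (intro mult_left_mono add_left_mono P1_elem_lower[OF v K r(1)]) auto
    finally show ?thesis
      unfolding integral_elem_grad[OF u K] integral_elem_grad[OF v K] by (simp add: mult_ac)
  qed
  have int: "ess_bounded (lebesgue_on \<Omega>) w \<Longrightarrow> integrable (lebesgue_on \<Omega>) (\<lambda>x. (norm (w x))\<^sup>2)"
    for w :: "real^3 \<Rightarrow> 'k::euclidean_space"
    by (rule ess_bounded_integrable[OF finite_measure_domain ess_bounded_norm_sq])
  have "(LINT x|lebesgue_on \<Omega>. (norm (grad u x))\<^sup>2)
      \<le> (\<Sum>K\<in>\<T>. 32 * d\<^sup>2 * Cm ^ 6 * ((LINT x|lebesgue_on \<Omega>. indicator K x * (norm (grad v x))\<^sup>2)
        + 1024 * s\<^sup>2 * g\<^sup>2 * (LINT x|lebesgue_on \<Omega>. indicator K x * (norm (v x))\<^sup>2)))"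
    unfolding integral_eq_sum_elems[OF int[OF grad_ess_bounded[OF u]]] by (intro sum_mono elemwise)
  also have "\<dots> = 32 * d\<^sup>2 * Cm ^ 6 * ((LINT x|lebesgue_on \<Omega>. (norm (grad v x))\<^sup>2)
        + 1024 * s\<^sup>2 * g\<^sup>2 * (LINT x|lebesgue_on \<Omega>. (norm (v x))\<^sup>2))"
    unfolding integral_eq_sum_elems[OF int[OF grad_ess_bounded[OF v]]]
      integral_eq_sum_elems[OF int[OF P1_ess_bounded[OF v]]]
    by (simp only: sum_distrib_left[symmetric] sum.distrib)
  finally show ?thesis
    unfolding d_def .
qed

end

section \<open>Householder matrices\<close>

text \<open>For a unit vector \<open>w\<close> this is the Householder reflection in the plane
  orthogonal to \<open>w\<close>.\<close>

definition reflect :: "real^3 \<Rightarrow> real^3 \<Rightarrow> real^3" where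
  "reflect w x = x - (2 * inner w x) *\<^sub>R w"

text \<open>Keeping the first two columns of a Householder matrix means composing the reflection
  with \<open>embed\<close>; \<open>proj\<close> is the left inverse that recovers the two
  coefficients.\<close>

definition embed :: "real^2 \<Rightarrow> real^3" where
  "embed x = vector [x $ 1, x $ 2, 0]"

definition proj :: "real^3 \<Rightarrow> real^2" where
  "proj y = vector [y $ 1, y $ 2]"

lemma norm_embed: "norm (embed x) = norm x"
  by (simp add: norm_vec_def L2_set_def sum_2 sum_3 embed_def vector_3)

lemma norm_proj_le: "norm (proj y) \<le> norm y"
  by (simp add: norm_vec_def L2_set_def sum_2 sum_3 proj_def vector_2)

lemma proj_embed: "proj (embed x) = x"
  by (simp add: vec_eq_iff forall_2 proj_def embed_def vector_2 vector_3)

lemma linear_proj_diff: "proj (x - y) = proj x - proj y"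
  by (simp add: vec_eq_iff forall_2 proj_def vector_2)

lemma linear_embed_diff: "embed (x - y) = embed x - embed y"
  by (simp add: vec_eq_iff forall_3 embed_def vector_3)

lemma reflect_diff: "reflect w (x - y) = reflect w x - reflect w y"
  by (simp add: reflect_def inner_diff_right algebra_simps)

lemma reflect_involution: "norm w = 1 \<Longrightarrow> reflect w (reflect w x) = x"
  by (simp add: reflect_def inner_diff_right dot_square_norm algebra_simps)

lemma norm_reflect: "norm w = 1 \<Longrightarrow> norm (reflect w x) = norm x"
proof -
  assume w: "norm w = 1"
  have "inner (reflect w x) (reflect w x)
      = inner x x - 4 * (inner w x)\<^sup>2 + 4 * (inner w x)\<^sup>2 * inner w w"
    unfolding reflect_def inner_diff_left inner_diff_right inner_scaleR_left inner_scaleR_right inner_commute[of x w]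
    by (simp add: power2_eq_square algebra_simps)
  then show ?thesis
    using w by (simp add: norm_eq_sqrt_inner)
qed

text \<open>The term 2 (w . x) w is bilinear in \<open>w\<close>; exchanging its two occurrences of
  \<open>w\<close> one after the other costs a factor 2 each.\<close>

lemma norm_reflect_diff_le:
  assumes "norm w = 1" "norm w' = 1"
  shows "norm (reflect w x - reflect w' x) \<le> 4 * norm (w - w') * norm x"
proof -
  have "reflect w' x - reflect w x = (2 * inner (w - w') x) *\<^sub>R w + (2 * inner w' x) *\<^sub>R (w - w')"
    by (simp add: reflect_def inner_diff_left algebra_simps)
  then have "norm (reflect w x - reflect w' x)
      \<le> norm ((2 * inner (w - w') x) *\<^sub>R w) + norm ((2 * inner w' x) *\<^sub>R (w - w'))"
    using norm_triangle_ineq by (metis norm_minus_commute)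
  also have "\<dots> = 2 * \<bar>inner (w - w') x\<bar> + 2 * \<bar>inner w' x\<bar> * norm (w - w')"
    using assms by (simp add: abs_mult)
  also have "\<dots> \<le> 2 * (norm (w - w') * norm x) + 2 * (norm w' * norm x) * norm (w - w')"
    by (intro add_mono mult_left_mono mult_right_mono Cauchy_Schwarz_ineq2) auto
  finally show ?thesis
    using assms by (simp add: mult_ac)
qed

text \<open>For a unit vector \<open>m\<close> other than \<open>- axis 3 1\<close>, the reflection
  with this normal takes \<open>axis 3 1\<close> to \<open>- m\<close>, so the images of the first
  two axes span the plane orthogonal to \<open>m\<close>.\<close>

definition mirror :: "real^3 \<Rightarrow> real^3" where
  "mirror m = (m + axis 3 1) /\<^sub>R norm (m + axis 3 1)"

lemma reflect_matrix:
  "(Finite_Cartesian_Product.mat 1 - 2 *\<^sub>R (\<chi> i j. w $ i * w $ j)) *v y = reflect w y"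
proof -
  have "(\<chi> i j. w $ i * w $ j) *v y = inner w y *\<^sub>R w"
    by (simp add: vec_eq_iff matrix_vector_mult_def inner_vec_def sum_distrib_left sum_distrib_right mult_ac)
  then show ?thesis
    by (simp add: matrix_vector_mult_diff_rdistrib reflect_def flip: scaleR_matrix_vector_assoc)
qed

lemma householder_mult:
  assumes "m \<noteq> - axis 3 1"
  shows "householder m *v x = reflect (mirror m) (embed x)"
proof -
  have embed: "embed x = x $ 1 *\<^sub>R axis 1 1 + x $ 2 *\<^sub>R axis 2 1"
    by (simp add: vec_eq_iff forall_3 embed_def vector_3 axis_def)
  have "householder m *v x
      = x $ 1 *\<^sub>R (householder_tilde m *v axis 1 1) + x $ 2 *\<^sub>R (householder_tilde m *v axis 2 1)"
    by (simp add: vec_eq_iff householder_def matrix_vector_mult_def[of "vec_lambda _" x] sum_2 mult.commute)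
  also have "\<dots> = householder_tilde m *v embed x"
    by (simp add: embed matrix_vector_right_distrib matrix_vector_mult_scaleR)
  also have "householder_tilde m
      = Finite_Cartesian_Product.mat 1 - 2 *\<^sub>R (\<chi> i j. mirror m $ i * mirror m $ j)"
    unfolding householder_tilde_def Let_def mirror_def using assms by (simp only: if_True not_False_eq_True)
  finally show ?thesis
    by (simp only: reflect_matrix)
qed

lemma norm_mirror_arg:
  fixes m :: "real^3"
  assumes "norm m = 1"
  shows "(norm (m + axis 3 1))\<^sup>2 = 2 * (1 + m $ 3)"
proof -
  have "inner m m = 1" "inner (axis 3 1) (axis 3 1 :: real^3) = 1" "inner m (axis 3 1) = m $ 3"
      "inner (axis 3 1) m = m $ 3"
    using assms by (simp_all add: dot_square_norm inner_axis norm_axis_1 inner_commute[of "axis 3 1" m])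
  then show ?thesis
    by (simp only: power2_norm_eq_inner inner_add_left inner_add_right) simp
qed

text \<open>The difference splits into an error of direction and an error of length, each at most
  \<open>norm (a - b) / norm a\<close>.\<close>

lemma norm_normalize_diff_le:
  fixes a b :: "'a::real_inner"
  assumes a: "c \<le> norm a" and b: "b \<noteq> 0" and c: "0 < c"
  shows "norm (a /\<^sub>R norm a - b /\<^sub>R norm b) \<le> 2 * norm (a - b) / c"
proof -
  have a0: "0 < norm a"
    using a c by linarith
  have b0: "0 < norm b"
    using b by simp
  have "a /\<^sub>R norm a - b /\<^sub>R norm b = (1 / norm a) *\<^sub>R (a - b) + (1 / norm a - 1 / norm b) *\<^sub>R b"
    by (simp add: scaleR_diff_left scaleR_diff_right inverse_eq_divide)
  then have "norm (a /\<^sub>R norm a - b /\<^sub>R norm b)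
      \<le> norm ((1 / norm a) *\<^sub>R (a - b)) + norm ((1 / norm a - 1 / norm b) *\<^sub>R b)"
    by (simp only: norm_triangle_ineq)
  also have "\<dots> = norm (a - b) / norm a + \<bar>norm b - norm a\<bar> / norm a"
  proof -
    have "1 / norm a - 1 / norm b = (norm b - norm a) / (norm a * norm b)"
      using a0 b0 by (simp add: field_simps)
    then show ?thesis
      using a0 b0 by (simp add: abs_mult)
  qed
  also have "\<dots> \<le> norm (a - b) / norm a + norm (a - b) / norm a"
    using a0 norm_triangle_ineq3[of b a]
    by (intro add_left_mono divide_right_mono) (auto simp: norm_minus_commute)
  also have "\<dots> = 2 * norm (a - b) / norm a"
    by simp
  also have "\<dots> \<le> 2 * norm (a - b) / c"
    using a c a0 by (intro divide_left_mono) auto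
  finally show ?thesis .
qed

text \<open>The number \<open>\<gamma>\<close> controls the distance to \<open>- axis 3 1\<close>,
  where the normal degenerates: the squared length of \<open>m + axis 3 1\<close> is 2 (1 + m_3),
  hence at least \<open>2 * \<gamma>\<close>.\<close>

lemma
  assumes m: "norm m = 1" "\<gamma> \<le> 1 + m $ 3" and \<gamma>: "0 < \<gamma>"
  shows norm_mirror: "norm (mirror m) = 1" and mirror_ne: "m \<noteq> - axis 3 1"
    and norm_mirror_arg_ge: "sqrt (2 * \<gamma>) \<le> norm (m + axis 3 1)"
proof -
  have "2 * \<gamma> \<le> (norm (m + axis 3 1))\<^sup>2"
    using norm_mirror_arg[OF m(1)] m(2) by simp
  then show *: "sqrt (2 * \<gamma>) \<le> norm (m + axis 3 1)"
    by (simp add: real_le_lsqrt)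
  moreover have "0 < sqrt (2 * \<gamma>)"
    using \<gamma> by simp
  ultimately have "m + axis 3 1 \<noteq> 0"
    by auto
  then show "norm (mirror m) = 1" "m \<noteq> - axis 3 1"
    by (auto simp: mirror_def)
qed

lemma norm_mirror_diff_le:
  assumes m: "norm m = 1" "\<gamma> \<le> 1 + m $ 3" and m': "norm m' = 1" "\<gamma> \<le> 1 + m' $ 3" and \<gamma>: "0 < \<gamma>"
  shows "norm (mirror m - mirror m') \<le> 2 / sqrt (2 * \<gamma>) * norm (m - m')"
proof -
  have "m' + axis 3 1 \<noteq> 0"
    using mirror_ne[OF m' \<gamma>] by (metis eq_neg_iff_add_eq_0)
  from norm_normalize_diff_le[OF norm_mirror_arg_ge[OF m \<gamma>] this] \<gamma> show ?thesis
    by (simp add: mirror_def)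
qed

text \<open>The constant \<open>s\<close> is 4 times \<open>2 / sqrt (2 * \<gamma>)\<close>: the
  reflection is Lipschitz in its normal with factor 4, the normal in the unit vector with the other
  factor, and \<open>T\<close> preserves distances. The last two claims are the hypotheses of
  \<open>grad_nodal_comparison\<close> in its two directions.\<close>

lemma householder_nodal:
  fixes T :: "real^3^3"
  assumes T: "\<And>x. norm (T *v x) = norm x" "\<And>x. T *v (T *v x) = x"
    and a: "norm a = 1" "\<gamma> \<le> 1 + (T *v a) $ 3" and b: "norm b = 1" "\<gamma> \<le> 1 + (T *v b) $ 3"
    and \<gamma>: "0 < \<gamma>"
  defines "s \<equiv> 8 / sqrt (2 * \<gamma>)"
  defines "G \<equiv> \<lambda>m. T ** householder (T *v m)"
  shows "norm (G a *v x) = norm x"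
    and "norm (G a *v x - G b *v y) \<le> norm (x - y) + s * norm (a - b) * norm y"
    and "norm (x - y) \<le> norm (G a *v x - G b *v y) + s * norm (a - b) * norm (G b *v y)"
proof -
  define wa wb where "wa = mirror (T *v a)" and "wb = mirror (T *v b)"
  have Ta: "norm (T *v a) = 1" "norm (T *v b) = 1"
    using T a b by auto
  have w: "norm wa = 1" "norm wb = 1"
    unfolding wa_def wb_def using norm_mirror[OF Ta(1) a(2) \<gamma>] norm_mirror[OF Ta(2) b(2) \<gamma>] by auto
  have G: "G a *v x = T *v reflect wa (embed x)" "G b *v x = T *v reflect wb (embed x)" for x
    unfolding G_def wa_def wb_def using householder_mult[OF mirror_ne[OF Ta(1) a(2) \<gamma>]]
      householder_mult[OF mirror_ne[OF Ta(2) b(2) \<gamma>]]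
    by (simp_all flip: matrix_vector_mul_assoc)
  have T_diff: "T *v x - T *v y = T *v (x - y)" for x y
    by (simp add: matrix_vector_mult_diff_distrib)
  have wdiff: "4 * norm (wa - wb) \<le> s * norm (a - b)"
    using norm_mirror_diff_le[OF Ta(1) a(2) Ta(2) b(2) \<gamma>] T(1)[of "a - b"]
    by (simp add: wa_def wb_def s_def T_diff)
  have rdiff: "norm (reflect wa z - reflect wb z) \<le> s * norm (a - b) * norm z" for z
    using norm_reflect_diff_le[OF w, of z] mult_right_mono[OF wdiff, of "norm z"] by simp
  show 1: "norm (G a *v x) = norm x"
    by (simp add: G T norm_reflect[OF w(1)] norm_embed)
  have "reflect wa (embed x) - reflect wb (embed y)
      = reflect wa (embed (x - y)) + (reflect wa (embed y) - reflect wb (embed y))"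
    by (simp add: reflect_diff linear_embed_diff)
  then have "norm (reflect wa (embed x) - reflect wb (embed y))
      \<le> norm (reflect wa (embed (x - y))) + norm (reflect wa (embed y) - reflect wb (embed y))"
    by (simp only: norm_triangle_ineq)
  then show "norm (G a *v x - G b *v y) \<le> norm (x - y) + s * norm (a - b) * norm y"
    using rdiff[of "embed y"] by (simp add: G T_diff T norm_reflect[OF w(1)] norm_embed)
  \<comment> \<open>\<open>T\<close> and the reflections are involutions and \<open>proj\<close>
    undoes \<open>embed\<close>, so \<open>x\<close> and \<open>y\<close> are recovered from their
    images by maps that do not increase norms. The reverse inequality therefore holds with the same
    \<open>s\<close>.\<close>
  define p q where "p = T *v (G a *v x)" and "q = T *v (G b *v y)"
  have x: "x = proj (reflect wa p)" and y: "y = proj (reflect wb q)"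
    by (simp_all add: p_def q_def G T reflect_involution w proj_embed)
  have "x - y = proj (reflect wa (p - q) + (reflect wa q - reflect wb q))"
    by (simp add: x y reflect_diff flip: linear_proj_diff)
  then have "norm (x - y) \<le> norm (reflect wa (p - q) + (reflect wa q - reflect wb q))"
    using norm_proj_le by simp
  also have "\<dots> \<le> norm (p - q) + norm (reflect wa q - reflect wb q)"
    using norm_triangle_ineq[of "reflect wa (p - q)"] by (simp add: norm_reflect[OF w(1)])
  also have "\<dots> \<le> norm (p - q) + s * norm (a - b) * norm q"
    using rdiff by simp
  also have "norm (p - q) = norm (G a *v x - G b *v y)"
    by (simp add: p_def q_def T_diff T)
  also have "norm q = norm (G b *v y)"
    by (simp add: q_def T)
  finally show "norm (x - y) \<le> norm (G a *v x - G b *v y) + s * norm (a - b) * norm (G b *v y)" .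
qed

section \<open>Matrices as quadratic forms of finite element functions\<close>

lemma scalar_prod_mult_mat_vec:
  assumes "M \<in> carrier_mat n n" "x \<in> carrier_vec n" "y \<in> carrier_vec n"
  shows "scalar_prod x (M *\<^sub>v y) = (\<Sum>i<n. \<Sum>j<n. vec_index x i * (M $$ (i, j) * vec_index y j))"
  using assms by (auto simp: scalar_prod_def sum_distrib_left lessThan_atLeast0 intro!: sum.cong)

lemma scalar_prod_mult_mat_vec_lincomb:
  fixes a b c :: real
  assumes M: "M1 \<in> carrier_mat n n" "M2 \<in> carrier_mat n n" "M3 \<in> carrier_mat n n"
    and x: "x \<in> carrier_vec n" and y: "y \<in> carrier_vec n"
  shows "scalar_prod x ((a \<cdot>\<^sub>m M1 + b \<cdot>\<^sub>m M2) *\<^sub>v y)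
      = a * scalar_prod x (M1 *\<^sub>v y) + b * scalar_prod x (M2 *\<^sub>v y)"
    and "scalar_prod x ((a \<cdot>\<^sub>m M1 + b \<cdot>\<^sub>m M2 - M3) *\<^sub>v y)
      = a * scalar_prod x (M1 *\<^sub>v y) + b * scalar_prod x (M2 *\<^sub>v y) - scalar_prod x (M3 *\<^sub>v y)"
proof -
  have "a \<cdot>\<^sub>m M1 + b \<cdot>\<^sub>m M2 \<in> carrier_mat n n" "a \<cdot>\<^sub>m M1 + b \<cdot>\<^sub>m M2 - M3 \<in> carrier_mat n n"
    using M by auto
  note sp = scalar_prod_mult_mat_vec[OF _ x y]
  show "scalar_prod x ((a \<cdot>\<^sub>m M1 + b \<cdot>\<^sub>m M2) *\<^sub>v y)
      = a * scalar_prod x (M1 *\<^sub>v y) + b * scalar_prod x (M2 *\<^sub>v y)"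
    unfolding sp[OF M(1)] sp[OF M(2)] sp[OF \<open>a \<cdot>\<^sub>m M1 + b \<cdot>\<^sub>m M2 \<in> carrier_mat n n\<close>]
      sum_distrib_left sum.distrib[symmetric]
    using M by (intro sum.cong) (auto simp: algebra_simps)
  show "scalar_prod x ((a \<cdot>\<^sub>m M1 + b \<cdot>\<^sub>m M2 - M3) *\<^sub>v y)
      = a * scalar_prod x (M1 *\<^sub>v y) + b * scalar_prod x (M2 *\<^sub>v y) - scalar_prod x (M3 *\<^sub>v y)"
    unfolding sp[OF M(1)] sp[OF M(2)] sp[OF M(3)] sp[OF \<open>a \<cdot>\<^sub>m M1 + b \<cdot>\<^sub>m M2 - M3 \<in> carrier_mat n n\<close>]
      sum_distrib_left sum.distrib[symmetric] sum_subtractf[symmetric]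
    using M by (intro sum.cong) (auto simp: algebra_simps)
qed

lemma projected_form:
  assumes Q: "Q \<in> carrier_mat r n" and S: "S \<in> carrier_mat r r"
    and x: "x \<in> carrier_vec n" and y: "y \<in> carrier_vec n"
  shows "scalar_prod y ((transpose_mat Q * S * Q) *\<^sub>v x) = scalar_prod (Q *\<^sub>v y) (S *\<^sub>v (Q *\<^sub>v (x :: real Matrix.vec)))"
proof -
  have Qx: "Q *\<^sub>v x \<in> carrier_vec r" and Qy: "Q *\<^sub>v y \<in> carrier_vec r" and QT: "transpose_mat Q \<in> carrier_mat n r"
    using Q x y by auto
  have SQx: "S *\<^sub>v (Q *\<^sub>v x) \<in> carrier_vec r"
    using S Qx by auto
  have "(transpose_mat Q * S * Q) *\<^sub>v x = (transpose_mat Q * S) *\<^sub>v (Q *\<^sub>v x)"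
    by (rule assoc_mult_mat_vec[OF _ Q x]) (use QT S in auto)
  also have "\<dots> = transpose_mat Q *\<^sub>v (S *\<^sub>v (Q *\<^sub>v x))"
    by (rule assoc_mult_mat_vec[OF QT S Qx])
  finally have "scalar_prod y ((transpose_mat Q * S * Q) *\<^sub>v x)
      = scalar_prod (transpose_mat Q *\<^sub>v (S *\<^sub>v (Q *\<^sub>v x))) y"
    using comm_scalar_prod[OF y, of "transpose_mat Q *\<^sub>v (S *\<^sub>v (Q *\<^sub>v x))"] QT SQx by simp
  also have "\<dots> = scalar_prod (S *\<^sub>v (Q *\<^sub>v x)) (Q *\<^sub>v y)"
    by (rule transpose_vec_mult_scalar[OF Q y SQx])
  finally show ?thesis
    using comm_scalar_prod[OF SQx Qy] by simp
qed

text \<open>The indices with quotient \<open>k\<close> form one block \<open>d * k + l\<close>. The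
  lemma evaluates sums in which a hat function or the block structure of \<open>Q_matrix\<close>
  removes every other block.\<close>

lemma sum_lessThan_restrict_div:
  fixes F :: "nat \<Rightarrow> 'a::comm_monoid_add"
  assumes k: "k < N" and d: "0 < d"
  shows "(\<Sum>i<d * N. if i div d = k then F i else 0) = (\<Sum>l<d. F (d * k + l))"
proof -
  have "(\<Sum>i<d * N. if i div d = k then F i else 0) = (\<Sum>i | i < d * N \<and> i div d = k. F i)"
    by (subst sum.inter_filter[symmetric]) auto
  also have "\<dots> = (\<Sum>l<d. F (d * k + l))"
  proof (rule sum.reindex_bij_witness[of _ "\<lambda>l. d * k + l" "\<lambda>i. i mod d"])
    fix l assume l: "l \<in> {..<d}"
    have "d * k + l < d * Suc k"
      using l by simp
    also have "\<dots> \<le> d * N"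
      using k by (intro mult_le_mono) auto
    finally show "d * k + l \<in> {i. i < d * N \<and> i div d = k}"
      using l d by simp
  qed (use d in \<open>auto simp: mult.commute\<close>)
  finally show ?thesis .
qed

definition fe_sum :: "nat \<Rightarrow> (nat \<Rightarrow> 'a \<Rightarrow> 'b::real_vector) \<Rightarrow> real Matrix.vec \<Rightarrow> 'a \<Rightarrow> 'b" where
  "fe_sum n b x p = (\<Sum>i<n. vec_index x i *\<^sub>R b i p)"

lemma L2_inner_self: "L2_inner \<Omega> f f = (LINT x|lebesgue_on \<Omega>. (norm (f x))\<^sup>2)"
  by (simp add: L2_inner_def power2_norm_eq_inner)

context fe_mesh
begin

lemma ess_bounded_fe_sum:
  "(\<And>i. i < n \<Longrightarrow> ess_bounded (lebesgue_on \<Omega>) (b i)) \<Longrightarrow> ess_bounded (lebesgue_on \<Omega>) (fe_sum n b x)"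
  unfolding fe_sum_def[abs_def] by (intro ess_bounded_sum ess_bounded_cmult) auto

text \<open>Two families are allowed so that weighted mass, stiffness and cross product matrices are
  all instances; the row index belongs to the first argument of the inner product.\<close>

lemma gram_matrix_form:
  fixes f g :: "nat \<Rightarrow> real^3 \<Rightarrow> 'b::euclidean_space"
  assumes f: "\<And>i. i < n \<Longrightarrow> ess_bounded (lebesgue_on \<Omega>) (f i)"
    and g: "\<And>i. i < n \<Longrightarrow> ess_bounded (lebesgue_on \<Omega>) (g i)"
    and x: "x \<in> carrier_vec n" and y: "y \<in> carrier_vec n"
  shows "scalar_prod x (Matrix.mat n n (\<lambda>(i, j). L2_inner \<Omega> (f i) (g j)) *\<^sub>v y)
    = L2_inner \<Omega> (fe_sum n f x) (fe_sum n g y)"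
proof -
  have int: "integrable (lebesgue_on \<Omega>) (\<lambda>p. inner (f i p) (g j p))" if "i < n" "j < n" for i j
    by (rule ess_bounded_integrable[OF finite_measure_domain ess_bounded_inner[OF f[OF that(1)] g[OF that(2)]]])
  have "L2_inner \<Omega> (fe_sum n f x) (fe_sum n g y)
      = (LINT p|lebesgue_on \<Omega>. (\<Sum>i<n. (\<Sum>j<n. vec_index x i * (vec_index y j * inner (f i p) (g j p)))))"
  proof -
    have "inner (fe_sum n f x p) (fe_sum n g y p)
        = (\<Sum>i<n. (\<Sum>j<n. vec_index x i * (vec_index y j * inner (f i p) (g j p))))" for p
      unfolding fe_sum_def inner_sum_left
      by (intro sum.cong refl) (simp add: inner_sum_right sum_distrib_left mult.left_commute)
    then show ?thesis
      by (simp add: L2_inner_def)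
  qed
  also have "\<dots> = (\<Sum>i<n. (\<Sum>j<n. (LINT p|lebesgue_on \<Omega>. vec_index x i * (vec_index y j * inner (f i p) (g j p)))))"
  proof (subst Bochner_Integration.integral_sum)
    show "integrable (lebesgue_on \<Omega>) (\<lambda>p. \<Sum>j<n. vec_index x i * (vec_index y j * inner (f i p) (g j p)))"
      if "i \<in> {..<n}" for i
      using int that by (intro Bochner_Integration.integrable_sum) simp
    show "(\<Sum>i<n. LINT p|lebesgue_on \<Omega>. (\<Sum>j<n. vec_index x i * (vec_index y j * inner (f i p) (g j p))))
        = (\<Sum>i<n. \<Sum>j<n. LINT p|lebesgue_on \<Omega>. vec_index x i * (vec_index y j * inner (f i p) (g j p)))"
      using int by (intro sum.cong refl Bochner_Integration.integral_sum) simp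
  qed
  also have "\<dots> = (\<Sum>i<n. \<Sum>j<n. vec_index x i * (L2_inner \<Omega> (f i) (g j) * vec_index y j))"
    by (simp add: L2_inner_def mult.commute)
  finally show ?thesis
    using scalar_prod_mult_mat_vec[OF _ x y, of "Matrix.mat n n (\<lambda>(i, j). L2_inner \<Omega> (f i) (g j))"] by simp
qed

lemma L2_inner_cong_AE:
  assumes "ess_bounded (lebesgue_on \<Omega>) f" "ess_bounded (lebesgue_on \<Omega>) f'"
    and "ess_bounded (lebesgue_on \<Omega>) g" "ess_bounded (lebesgue_on \<Omega>) g'"
    and ae: "AE x in lebesgue_on \<Omega>. f x = f' x" "AE x in lebesgue_on \<Omega>. g x = g' x"
  shows "L2_inner \<Omega> f g = L2_inner \<Omega> f' g'"
  unfolding L2_inner_def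
proof (rule integral_cong_AE)
  show "AE x in lebesgue_on \<Omega>. inner (f x) (g x) = inner (f' x) (g' x)"
    using ae by eventually_elim simp
qed (intro ess_bounded_measurable ess_bounded_inner assms)+

lemma P1_space_add: "f \<in> P1_space \<Omega> \<T> \<Longrightarrow> g \<in> P1_space \<Omega> \<T> \<Longrightarrow> (\<lambda>x. f x + g x) \<in> P1_space \<Omega> \<T>"
proof -
  assume f: "f \<in> P1_space \<Omega> \<T>" and g: "g \<in> P1_space \<Omega> \<T>"
  have "\<exists>a b. \<forall>x\<in>K. f x + g x = inner a x + b" if K: "K \<in> \<T>" for K
  proof -
    obtain a b a' b' where "\<forall>x\<in>K. f x = inner a x + b" "\<forall>x\<in>K. g x = inner a' x + b'"
      using f g K unfolding P1_space_def by blast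
    then show ?thesis
      by (intro exI[of _ "a + a'"] exI[of _ "b + b'"]) (simp add: inner_add_left)
  qed
  then show ?thesis
    using f g by (auto simp: P1_space_def intro: continuous_on_add)
qed

lemma P1_space_cmult: "f \<in> P1_space \<Omega> \<T> \<Longrightarrow> (\<lambda>x. c * f x) \<in> P1_space \<Omega> \<T>"
proof -
  assume f: "f \<in> P1_space \<Omega> \<T>"
  have "\<exists>a b. \<forall>x\<in>K. c * f x = inner a x + b" if K: "K \<in> \<T>" for K
  proof -
    obtain a b where "\<forall>x\<in>K. f x = inner a x + b"
      using f K unfolding P1_space_def by blast
    then show ?thesis
      by (intro exI[of _ "c *\<^sub>R a"] exI[of _ "c * b"]) (simp add: algebra_simps)
  qed
  then show ?thesis
    using f by (auto simp: P1_space_def intro: continuous_on_mult_left)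
qed

lemma P1_space_sum:
  "(\<And>i. i \<in> I \<Longrightarrow> f i \<in> P1_space \<Omega> \<T>) \<Longrightarrow> (\<lambda>x. \<Sum>i\<in>I. f i x) \<in> P1_space \<Omega> \<T>"
proof (induction I rule: infinite_finite_induct)
  case (insert j I)
  then show ?case
    using P1_space_add[of "f j" "\<lambda>x. \<Sum>i\<in>I. f i x"] by simp
qed (auto simp: P1_space_def intro!: exI[of _ "0 :: real^3"])

lemma fe_sum_P1:
  assumes "\<And>i. i < n \<Longrightarrow> b i \<in> P1_vector_space \<Omega> \<T>"
  shows "fe_sum n b x \<in> P1_vector_space \<Omega> \<T>"
  using assms unfolding P1_vector_space_def fe_sum_def[abs_def]
  by (auto simp: sum_component intro!: P1_space_sum P1_space_cmult)

lemma AE_grad_fe_sum: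
  fixes b :: "nat \<Rightarrow> real^3 \<Rightarrow> real^'d"
  assumes b: "\<And>i. i < n \<Longrightarrow> b i \<in> P1_vector_space \<Omega> \<T>"
  shows "AE p in lebesgue_on \<Omega>. fe_sum n (\<lambda>i. grad (b i)) x p = grad (fe_sum n b x) p"
  using AE_unique_elem
proof eventually_elim
  case (elim p)
  then obtain K where K: "K \<in> \<T>" "p \<in> interior K"
    by blast
  have mult: "(\<Sum>i<n. vec_index x i *\<^sub>R (elem_grad (b i) K *v h))
      = (\<Sum>i<n. vec_index x i *\<^sub>R elem_grad (b i) K) *v h" for h
    by (induction n) (simp_all add: matrix_vector_mult_add_rdistrib scaleR_matrix_vector_assoc)
  have "((\<lambda>p. \<Sum>i<n. vec_index x i *\<^sub>R b i p) has_derivative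
      (\<lambda>h. \<Sum>i<n. vec_index x i *\<^sub>R (elem_grad (b i) K *v h))) (at p)"
    using P1_has_derivative(1)[OF b K] by (intro has_derivative_sum has_derivative_scaleR_right) auto
  then have "frechet_derivative (fe_sum n b x) (at p) = (*v) (\<Sum>i<n. vec_index x i *\<^sub>R elem_grad (b i) K)"
    unfolding mult fe_sum_def[abs_def] by (rule frechet_derivative_at[symmetric])
  then have "grad (fe_sum n b x) p = (\<Sum>i<n. vec_index x i *\<^sub>R elem_grad (b i) K)"
    by (simp add: grad_def jacobian_def)
  then show ?case
    using P1_has_derivative(2)[OF b K] by (simp add: fe_sum_def)
qed

text \<open>Young's inequality is applied pointwise with a free weight \<open>s\<close>. Unlike
  products of norms, bounds of this shape with a common \<open>s\<close> add up over the mass,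
  stiffness and skew terms.\<close>

lemma L2_inner_young:
  fixes f :: "real^3 \<Rightarrow> 'b::euclidean_space" and u' :: "real^3 \<Rightarrow> 'c::euclidean_space"
  assumes f: "ess_bounded (lebesgue_on \<Omega>) f" and u: "ess_bounded (lebesgue_on \<Omega>) u"
    and u': "ess_bounded (lebesgue_on \<Omega>) u'"
    and le: "AE x in lebesgue_on \<Omega>. norm (f x) \<le> C * norm (u' x)" and C: "0 \<le> C" and s: "0 < s"
  shows "2 * \<bar>L2_inner \<Omega> f u\<bar>
    \<le> C * (s * (LINT x|lebesgue_on \<Omega>. (norm (u x))\<^sup>2) + (LINT x|lebesgue_on \<Omega>. (norm (u' x))\<^sup>2) / s)"
proof -
  have int: "integrable (lebesgue_on \<Omega>) (\<lambda>x. inner (f x) (u x))"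
      "integrable (lebesgue_on \<Omega>) (\<lambda>x. (norm (u x))\<^sup>2)" "integrable (lebesgue_on \<Omega>) (\<lambda>x. (norm (u' x))\<^sup>2)"
    using ess_bounded_integrable[OF finite_measure_domain] ess_bounded_inner[OF f u]
      ess_bounded_norm_sq[OF u] ess_bounded_norm_sq[OF u'] by blast+
  have "2 * \<bar>L2_inner \<Omega> f u\<bar> \<le> 2 * (LINT x|lebesgue_on \<Omega>. \<bar>inner (f x) (u x)\<bar>)"
    using integral_abs_bound[of "lebesgue_on \<Omega>" "\<lambda>x. inner (f x) (u x)"] by (simp add: L2_inner_def)
  also have "\<dots> = (LINT x|lebesgue_on \<Omega>. 2 * \<bar>inner (f x) (u x)\<bar>)"
    by simp
  also have "\<dots> \<le> (LINT x|lebesgue_on \<Omega>. C * (s * (norm (u x))\<^sup>2 + (norm (u' x))\<^sup>2 / s))"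
  proof (rule integral_mono_AE)
    show "AE x in lebesgue_on \<Omega>. 2 * \<bar>inner (f x) (u x)\<bar> \<le> C * (s * (norm (u x))\<^sup>2 + (norm (u' x))\<^sup>2 / s)"
      using le
    proof eventually_elim
      case (elim x)
      let ?a = "norm (u x)" and ?b = "norm (u' x)"
      have "2 * \<bar>inner (f x) (u x)\<bar> \<le> 2 * (norm (f x) * ?a)"
        by (intro mult_left_mono Cauchy_Schwarz_ineq2) simp
      also have "\<dots> \<le> 2 * (C * ?b * ?a)"
        using elim by (intro mult_left_mono mult_right_mono) auto
      also have "\<dots> = C * (2 * ?a * ?b)"
        by simp
      also have "\<dots> \<le> C * (s * ?a\<^sup>2 + ?b\<^sup>2 / s)"
      proof (rule mult_left_mono[OF _ C])
        have "0 \<le> (s * ?a - ?b)\<^sup>2 / s"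
          using s by simp
        also have "\<dots> = s * ?a\<^sup>2 + ?b\<^sup>2 / s - 2 * ?a * ?b"
          using s by (simp add: power2_eq_square field_simps)
        finally show "2 * ?a * ?b \<le> s * ?a\<^sup>2 + ?b\<^sup>2 / s"
          by simp
      qed
      finally show ?case .
    qed
  qed (use int in auto)
  also have "\<dots> = C * (s * (LINT x|lebesgue_on \<Omega>. (norm (u x))\<^sup>2) + (LINT x|lebesgue_on \<Omega>. (norm (u' x))\<^sup>2) / s)"
    using int by simp
  finally show ?thesis .
qed

end

section \<open>Finite element functions of coefficient vectors\<close>

locale fe_basis = fe_mesh +
  fixes N :: nat and z :: "nat \<Rightarrow> real^3" and \<phi> :: "nat \<Rightarrow> real^3 \<Rightarrow> real"
  assumes nodes_z: "bij_betw z {..<N} (nodes \<T>)" and hat: "hat_functions \<Omega> \<T> N z \<phi>"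
begin

abbreviation U where "U \<equiv> fe_sum (3 * N) (phi \<phi>)"
abbreviation V where "V \<equiv> fe_sum (2 * N) (psi \<phi>)"

lemma phi_P1: "i < 3 * N \<Longrightarrow> phi \<phi> i \<in> P1_vector_space \<Omega> \<T>"
  and psi_P1: "i < 2 * N \<Longrightarrow> psi \<phi> i \<in> P1_vector_space \<Omega> \<T>"
proof -
  have "c < d * N \<Longrightarrow> \<phi> (c div d) \<in> P1_space \<Omega> \<T>" if "0 < d" for c d
    using hat that by (simp add: hat_functions_def div_less_iff_less_mult mult.commute)
  then have *: "c < d * N \<Longrightarrow> 0 < d \<Longrightarrow> (\<lambda>x. \<phi> (c div d) x * a) \<in> P1_space \<Omega> \<T>" for a c d
    using P1_space_cmult[of "\<phi> (c div d)" a] by (simp add: mult.commute)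
  show "i < 3 * N \<Longrightarrow> phi \<phi> i \<in> P1_vector_space \<Omega> \<T>" "i < 2 * N \<Longrightarrow> psi \<phi> i \<in> P1_vector_space \<Omega> \<T>"
    unfolding P1_vector_space_def phi_def[abs_def] psi_def[abs_def] using *[of i 3] *[of i 2] by auto
qed

lemma U_P1: "U x \<in> P1_vector_space \<Omega> \<T>" and V_P1: "V x \<in> P1_vector_space \<Omega> \<T>"
  by (simp_all add: fe_sum_P1 phi_P1 psi_P1)

lemma L2_inner_fe_sum_grad:
  assumes b: "\<And>i. i < n \<Longrightarrow> b i \<in> P1_vector_space \<Omega> \<T>"
  shows "L2_inner \<Omega> (fe_sum n (\<lambda>i. grad (b i)) x) (fe_sum n (\<lambda>i. grad (b i)) y)
    = L2_inner \<Omega> (grad (fe_sum n b x)) (grad (fe_sum n b y))"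
  by (intro L2_inner_cong_AE AE_grad_fe_sum b ess_bounded_fe_sum grad_ess_bounded fe_sum_P1)

lemma precond_form:
  assumes x: "x \<in> carrier_vec (2 * N)" and y: "y \<in> carrier_vec (2 * N)"
  shows "scalar_prod x ((a \<cdot>\<^sub>m mass2 \<Omega> N \<phi> + \<kappa> \<cdot>\<^sub>m stiff2 \<Omega> N \<phi>) *\<^sub>v y)
    = a * L2_inner \<Omega> (V x) (V y) + \<kappa> * L2_inner \<Omega> (grad (V x)) (grad (V y))"
proof -
  have "scalar_prod x (mass2 \<Omega> N \<phi> *\<^sub>v y) = L2_inner \<Omega> (V x) (V y)"
    unfolding mass2_def by (intro gram_matrix_form P1_ess_bounded psi_P1 x y)
  moreover have "scalar_prod x (stiff2 \<Omega> N \<phi> *\<^sub>v y) = L2_inner \<Omega> (grad (V x)) (grad (V y))"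
    unfolding stiff2_def
    by (subst L2_inner_fe_sum_grad[symmetric]) (intro psi_P1 gram_matrix_form grad_ess_bounded x y; assumption)+
  ultimately show ?thesis
    using scalar_prod_mult_mat_vec_lincomb(1)[of "mass2 \<Omega> N \<phi>" "2 * N" "stiff2 \<Omega> N \<phi>" "mass2 \<Omega> N \<phi>", OF _ _ _ x y]
    by (simp add: mass2_def stiff2_def)
qed

lemma system_form:
  assumes \<alpha>: "\<alpha> \<noteq> 0" and \<omega>: "ess_bounded (lebesgue_on \<Omega>) \<omega>" and m: "ess_bounded (lebesgue_on \<Omega>) m"
    and x: "x \<in> carrier_vec (3 * N)" and y: "y \<in> carrier_vec (3 * N)"
  shows "scalar_prod x (system_matrix \<Omega> N \<phi> \<alpha> \<kappa> \<omega> m *\<^sub>v y)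
    = L2_inner \<Omega> (\<lambda>p. \<omega> p *\<^sub>R U x p) (U y) + \<kappa> * L2_inner \<Omega> (grad (U x)) (grad (U y))
      - L2_inner \<Omega> (\<lambda>p. cross3 (m p) (U x p)) (U y)"
proof -
  have \<omega>': "ess_bounded (lebesgue_on \<Omega>) (\<lambda>p. \<omega> p / \<alpha>)"
    using ess_bounded_cmult[OF \<omega>, of "1 / \<alpha>"] by simp
  have bil: "bounded_bilinear cross3"
    using bilinear_cross bilinear_conv_bounded_bilinear by blast
  have "scalar_prod x (mass3 \<Omega> N \<phi> (\<lambda>p. \<omega> p / \<alpha>) *\<^sub>v y)
      = L2_inner \<Omega> (fe_sum (3 * N) (\<lambda>i p. (\<omega> p / \<alpha>) *\<^sub>R phi \<phi> i p) x) (U y)"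
    unfolding mass3_def by (intro gram_matrix_form ess_bounded_scaleR \<omega>' P1_ess_bounded phi_P1 x y)
  also have "fe_sum (3 * N) (\<lambda>i p. (\<omega> p / \<alpha>) *\<^sub>R phi \<phi> i p) x = (\<lambda>p. (1 / \<alpha>) *\<^sub>R (\<omega> p *\<^sub>R U x p))"
    by (auto simp: fe_sum_def scaleR_sum_right mult.commute)
  also have "\<alpha> * L2_inner \<Omega> (\<lambda>p. (1 / \<alpha>) *\<^sub>R (\<omega> p *\<^sub>R U x p)) (U y) = L2_inner \<Omega> (\<lambda>p. \<omega> p *\<^sub>R U x p) (U y)"
    using \<alpha> by (simp add: L2_inner_def)
  finally have mass: "\<alpha> * scalar_prod x (mass3 \<Omega> N \<phi> (\<lambda>p. \<omega> p / \<alpha>) *\<^sub>v y)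
      = L2_inner \<Omega> (\<lambda>p. \<omega> p *\<^sub>R U x p) (U y)" .
  have stiff: "scalar_prod x (stiff3 \<Omega> N \<phi> *\<^sub>v y) = L2_inner \<Omega> (grad (U x)) (grad (U y))"
    unfolding stiff3_def
    by (subst L2_inner_fe_sum_grad[symmetric]) (intro phi_P1 gram_matrix_form grad_ess_bounded x y; assumption)+
  have "scalar_prod x (skew3 \<Omega> N \<phi> m *\<^sub>v y)
      = L2_inner \<Omega> (fe_sum (3 * N) (\<lambda>i p. cross3 (m p) (phi \<phi> i p)) x) (U y)"
    unfolding skew3_def by (intro gram_matrix_form ess_bounded_bilinear[OF bil m] P1_ess_bounded phi_P1 x y)
  also have "fe_sum (3 * N) (\<lambda>i p. cross3 (m p) (phi \<phi> i p)) x = (\<lambda>p. cross3 (m p) (U x p))"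
    unfolding fe_sum_def bounded_bilinear.sum_right[OF bil] bounded_bilinear.scaleR_right[OF bil] ..
  finally have skew: "scalar_prod x (skew3 \<Omega> N \<phi> m *\<^sub>v y) = L2_inner \<Omega> (\<lambda>p. cross3 (m p) (U x p)) (U y)" .
  show ?thesis
    unfolding system_matrix_def mass[symmetric] stiff[symmetric] skew[symmetric]
    by (rule scalar_prod_mult_mat_vec_lincomb(2)[OF _ _ _ x y])
      (simp_all add: mass3_def stiff3_def skew3_def)
qed

lemma nodeE:
  assumes "p \<in> nodes \<T>"
  obtains k where "k < N" "p = z k"
  using assms nodes_z by (auto simp: bij_betw_def)

lemma V_node:
  assumes k: "k < N"
  shows "V x (z k) = vector [vec_index x (2 * k), vec_index x (2 * k + 1)]"
proof -
  have "V x (z k) = (\<Sum>i<2 * N. if i div 2 = k then vec_index x i *\<^sub>R axis (of_nat (i mod 2 + 1)) 1 else 0)"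
    unfolding fe_sum_def psi_def
  proof (rule sum.cong[OF refl])
    fix i assume "i \<in> {..<2 * N}"
    then have "\<phi> (i div 2) (z k) = (if i div 2 = k then 1 else 0)"
      using hat k by (auto simp: hat_functions_def)
    then show "vec_index x i *\<^sub>R \<phi> (i div 2) (z k) *\<^sub>R axis (of_nat (i mod 2 + 1)) 1
        = (if i div 2 = k then vec_index x i *\<^sub>R axis (of_nat (i mod 2 + 1)) 1 else (0::real^2))"
      by simp
  qed
  also have "\<dots> = (\<Sum>l<2. vec_index x (2 * k + l) *\<^sub>R axis (of_nat ((2 * k + l) mod 2 + 1)) 1)"
    by (rule sum_lessThan_restrict_div[OF k]) simp
  also have "{..<2::nat} = {0, 1}"
    by auto
  finally show ?thesis
    by (simp add: vec_eq_iff forall_2 axis_def vector_2)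
qed

end

section \<open>Coercivity and boundedness of the projected system\<close>

lemma symmetric_involution_isometry:
  fixes T :: "real^'n^'n"
  assumes "invertible T" "T = matrix_inv T" "T = Finite_Cartesian_Product.transpose T"
  shows "T *v (T *v x) = x" and "norm (T *v x) = norm x"
proof -
  \<comment> \<open>\<open>matrix_inv\<close> is defined by choice; \<open>invertible\<close>
    guarantees that the chosen matrix is an inverse.\<close>
  have "T ** T = Finite_Cartesian_Product.mat 1"
    using assms(1,2) someI_ex[of "\<lambda>A'. T ** A' = Finite_Cartesian_Product.mat 1 \<and> A' ** T = Finite_Cartesian_Product.mat 1"]
    unfolding invertible_def matrix_inv_def by metis
  then show inv: "T *v (T *v x) = x" for x
    by (simp add: matrix_vector_mul_assoc)
  have "inner (T *v x) (T *v x) = inner (x v* T) (T *v x)"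
    using assms(3) transpose_matrix_vector[of T x] by simp
  also have "\<dots> = inner x x"
    by (simp only: dot_lmul_matrix inv)
  finally show "norm (T *v x) = norm x"
    by (simp add: norm_eq_sqrt_inner)
qed

lemma norm_cross3_le: "norm (cross3 a b) \<le> norm a * norm b"
proof (rule power2_le_imp_le)
  show "(norm (cross3 a b))\<^sup>2 \<le> (norm a * norm b)\<^sup>2"
    using norm_cross_dot[of a b] by (simp add: add_increasing2 flip: norm_cross_dot)
qed simp

text \<open>The hypothesis \<open>\<kappa> * G \<le> \<alpha>P * (F - 1)\<close> lets the mass part
  of the energy pay for the zeroth-order term in the bound on \<open>b'\<close>. The factor
  \<open>2 ^ 20\<close> dominates \<open>1024\<close> and the factor in front of \<open>G\<close>,
  and \<open>1 + c\<close> serves the mass and gradient parts at once.\<close>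

lemma energy_bound_arith:
  fixes a b c :: real
  assumes nn: "0 \<le> a" "0 \<le> b" "0 \<le> c" "0 \<le> \<kappa>" "0 < \<alpha>P" and F: "1 \<le> F" and G: "\<kappa> * G \<le> \<alpha>P * (F - 1)"
    and a': "a' \<le> 1024 * a" and b': "b' \<le> c * (b + 2 ^ 20 * G * a)"
  shows "\<alpha>P * a' + \<kappa> * b' \<le> 2 ^ 20 * (1 + c) * F * (\<alpha>P * a + \<kappa> * b)"
proof -
  define A B where "A = \<alpha>P * a" and "B = \<kappa> * b"
  have AB: "0 \<le> A" "0 \<le> B"
    using nn by (simp_all add: A_def B_def)
  have "\<alpha>P * a' \<le> 1024 * A"
    using mult_left_mono[OF a', of \<alpha>P] nn by (simp add: A_def)
  moreover have "\<kappa> * b' \<le> c * B + 2 ^ 20 * c * ((F - 1) * A)"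
  proof -
    have "\<kappa> * b' \<le> \<kappa> * (c * (b + 2 ^ 20 * G * a))"
      by (rule mult_left_mono[OF b' nn(4)])
    also have "\<dots> = c * B + 2 ^ 20 * c * (\<kappa> * G * a)"
      by (simp add: B_def algebra_simps)
    also have "\<dots> \<le> c * B + 2 ^ 20 * c * (\<alpha>P * (F - 1) * a)"
      using G nn by (intro add_left_mono mult_left_mono mult_right_mono) auto
    finally show ?thesis
      by (simp add: A_def mult_ac)
  qed
  moreover have "1024 * A \<le> 2 ^ 20 * (F * A)"
  proof -
    have "A \<le> F * A"
      using mult_right_mono[OF F AB(1)] by simp
    then have "1024 * A \<le> 1048576 * (F * A)"
      using AB(1) by linarith
    then show ?thesis
      by simp
  qed
  moreover have "c * B \<le> 2 ^ 20 * (c * (F * B))"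
  proof -
    have "c * B \<le> c * (F * B)"
      using mult_right_mono[OF F AB(2)] nn(3) by (intro mult_left_mono) auto
    moreover have "0 \<le> c * (F * B)"
      using nn AB F by simp
    ultimately show ?thesis
      by simp
  qed
  moreover have "2 ^ 20 * c * ((F - 1) * A) \<le> 2 ^ 20 * (c * (F * A))"
    using mult_nonneg_nonneg[OF nn(3) AB(1)] by (simp add: algebra_simps)
  moreover have "0 \<le> 2 ^ 20 * (F * B)"
    using F AB by simp
  ultimately have "\<alpha>P * a' + \<kappa> * b' \<le> 2 ^ 20 * (F * A) + 2 ^ 20 * (F * B) + 2 ^ 20 * (c * (F * B)) + 2 ^ 20 * (c * (F * A))"
    by linarith
  then show ?thesis
    by (simp add: A_def B_def algebra_simps)
qed

text \<open>For \<open>V x\<close> this is the squared preconditioner norm of \<open>x\<close>. It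
  is polymorphic in the range so that the same expression is available for functions with three
  components.\<close>

definition energy :: "(real^3) set \<Rightarrow> real \<Rightarrow> real \<Rightarrow> (real^3 \<Rightarrow> real^'d) \<Rightarrow> real" where
  "energy \<Omega> a \<kappa> u = a * (LINT x|lebesgue_on \<Omega>. (norm (u x))\<^sup>2) + \<kappa> * (LINT x|lebesgue_on \<Omega>. (norm (grad u x))\<^sup>2)"

section \<open>Energies of a coefficient vector and of its image under the projection\<close>

context fe_basis
begin

lemma U_node:
  assumes k: "k < N"
  shows "U y (z k) = vector [vec_index y (3 * k), vec_index y (3 * k + 1), vec_index y (3 * k + 2)]"
proof -
  have "U y (z k) = (\<Sum>i<3 * N. if i div 3 = k then vec_index y i *\<^sub>R axis (of_nat (i mod 3 + 1)) 1 else 0)"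
    unfolding fe_sum_def phi_def
  proof (rule sum.cong[OF refl])
    fix i assume "i \<in> {..<3 * N}"
    then have "\<phi> (i div 3) (z k) = (if i div 3 = k then 1 else 0)"
      using hat k by (auto simp: hat_functions_def)
    then show "vec_index y i *\<^sub>R \<phi> (i div 3) (z k) *\<^sub>R axis (of_nat (i mod 3 + 1)) 1
        = (if i div 3 = k then vec_index y i *\<^sub>R axis (of_nat (i mod 3 + 1)) 1 else (0::real^3))"
      by simp
  qed
  also have "\<dots> = (\<Sum>l<3. vec_index y (3 * k + l) *\<^sub>R axis (of_nat ((3 * k + l) mod 3 + 1)) 1)"
    by (rule sum_lessThan_restrict_div[OF k]) simp
  also have "{..<3::nat} = {0, 1, 2}"
    by auto
  finally show ?thesis
    by (simp add: vec_eq_iff forall_3 axis_def vector_3)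
qed

lemma U_Q_node:
  assumes k: "k < N" and x: "x \<in> carrier_vec (2 * N)"
  shows "U (Q_matrix N z Tn m *\<^sub>v x) (z k) = (Tn ** householder (Tn *v m (z k))) *v V x (z k)"
proof -
  define G where "G = Tn ** householder (Tn *v m (z k))"
  have comp: "vec_index (Q_matrix N z Tn m *\<^sub>v x) (3 * k + l)
      = G $ of_nat (l + 1) $ 1 * vec_index x (2 * k) + G $ of_nat (l + 1) $ 2 * vec_index x (2 * k + 1)"
    if l: "l < 3" for l
  proof -
    have lt: "3 * k + l < 3 * N" and dv: "(3 * k + l) div 3 = k" "(3 * k + l) mod 3 = l"
      using k l by auto
    have "vec_index (Q_matrix N z Tn m *\<^sub>v x) (3 * k + l)
        = (\<Sum>j<2 * N. Q_matrix N z Tn m $$ (3 * k + l, j) * vec_index x j)"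
      using lt x by (auto simp: Q_matrix_def scalar_prod_def lessThan_atLeast0 intro!: sum.cong)
    also have "\<dots> = (\<Sum>j<2 * N. if j div 2 = k
        then G $ of_nat (l + 1) $ of_nat (j mod 2 + 1) * vec_index x j else 0)"
      using lt dv by (intro sum.cong) (auto simp: Q_matrix_def G_def)
    also have "\<dots> = (\<Sum>c<2. G $ of_nat (l + 1) $ of_nat ((2 * k + c) mod 2 + 1) * vec_index x (2 * k + c))"
      by (rule sum_lessThan_restrict_div[OF k]) simp
    also have "{..<2::nat} = {0, 1}"
      by auto
    finally show ?thesis
      by simp
  qed
  from comp[of 0] comp[of 1] comp[of 2] show ?thesis
    unfolding U_node[OF k] V_node[OF k] G_def[symmetric]
    by (simp add: vec_eq_iff forall_3 vector_3 matrix_vector_mult_def sum_2 vector_2)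
qed

text \<open>A nonzero coefficient is a nonzero nodal value, and \<open>P1_elem_lower\<close> on an
  element with that vertex turns it into positive mass. This gives positive definiteness of the
  matrix behind the preconditioner.\<close>

lemma V_pos:
  assumes x: "x \<in> carrier_vec (2 * N)" "x \<noteq> 0\<^sub>v (2 * N)"
  shows "0 < (LINT p|lebesgue_on \<Omega>. (norm (V x p))\<^sup>2)"
proof -
  obtain i where i: "i < 2 * N" "vec_index x i \<noteq> 0"
    using x by (metis carrier_vecD eq_vecI index_zero_vec)
  define k where "k = i div 2"
  have k: "k < N"
    using i(1) by (simp add: k_def less_mult_imp_div_less)
  have "i = 2 * k \<or> i = 2 * k + 1"
    by (auto simp: k_def)
  then have Vk: "V x (z k) \<noteq> 0"
    using i(2) V_node[OF k, of x] by (auto simp: vec_eq_iff forall_2 vector_2)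
  have "z k \<in> nodes \<T>"
    using nodes_z k by (auto simp: bij_betw_def)
  then obtain K where K: "K \<in> \<T>" "z k \<in> verts K"
    by (auto simp: nodes_def)
  have "0 < measure lebesgue K"
    using elem_measure[OF K(1)] h_pos by (smt (verit) zero_less_power)
  then have "0 < (norm (V x (z k)))\<^sup>2 * measure lebesgue K"
    using Vk by simp
  also have "\<dots> \<le> 1024 * (LINT p|lebesgue_on \<Omega>. indicator K p * (norm (V x p))\<^sup>2)"
    by (rule P1_elem_lower[OF V_P1 K])
  also have "\<dots> \<le> 1024 * (LINT p|lebesgue_on \<Omega>. (norm (V x p))\<^sup>2)"
  proof (intro mult_left_mono integral_mono)
    show "integrable (lebesgue_on \<Omega>) (\<lambda>p. indicator K p * (norm (V x p))\<^sup>2)"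
      by (intro integrable_elem_mult K ess_bounded_norm_sq P1_ess_bounded V_P1)
    show "integrable (lebesgue_on \<Omega>) (\<lambda>p. (norm (V x p))\<^sup>2)"
      by (intro ess_bounded_integrable finite_measure_domain ess_bounded_norm_sq P1_ess_bounded V_P1)
  qed (auto simp: indicator_def)
  finally show ?thesis
    by simp
qed

text \<open>A component of a unit vector is at most one. The bound allows low powers of
  \<open>1 / \<gamma>\<close> to be replaced by higher ones at the price of an absolute
  constant.\<close>

lemma gamma_le_2:
  assumes m: "m \<in> unit_P1_space \<Omega> \<T>" and T: "\<And>x. norm (Tn *v x) = norm x"
    and \<gamma>: "\<And>p. p \<in> nodes \<T> \<Longrightarrow> \<gamma> \<le> 1 + (Tn *v m p) $ 3"
  shows "\<gamma> \<le> 2"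
proof -
  obtain K where K: "K \<in> \<T>"
    using mesh_nonempty by blast
  then obtain p where p: "p \<in> nodes \<T>"
    using verts_nonempty[OF K] verts_subset[OF K] by blast
  have "\<bar>(Tn *v m p) $ 3\<bar> \<le> norm (Tn *v m p)"
    by (rule component_le_norm_cart)
  then show ?thesis
    using \<gamma>[OF p] m p by (simp add: T unit_P1_space_def)
qed

lemma energy_comparison:
  fixes m Tn \<gamma> \<alpha>P \<kappa> F
  defines "g \<equiv> Linf_norm (lebesgue_on \<Omega>) (grad m)"
  assumes m: "m \<in> unit_P1_space \<Omega> \<T>"
    and T: "\<And>x. Tn *v (Tn *v x) = x" "\<And>x. norm (Tn *v x) = norm x"
    and \<gamma>: "0 < \<gamma>" "\<And>p. p \<in> nodes \<T> \<Longrightarrow> \<gamma> \<le> 1 + (Tn *v m p) $ 3"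
    and \<alpha>P: "0 < \<alpha>P" and \<kappa>: "0 \<le> \<kappa>" and F: "1 + \<kappa> / (\<alpha>P * \<gamma> ^ 6) * g\<^sup>2 \<le> F"
    and x: "x \<in> carrier_vec (2 * N)"
  defines "u \<equiv> U (Q_matrix N z Tn m *\<^sub>v x)"
  shows "energy \<Omega> \<alpha>P \<kappa> u \<le> 2 ^ 20 * (1 + 288 * Cm ^ 6) * F * energy \<Omega> \<alpha>P \<kappa> (V x)"
    and "energy \<Omega> \<alpha>P \<kappa> (V x) \<le> 2 ^ 20 * (1 + 288 * Cm ^ 6) * F * energy \<Omega> \<alpha>P \<kappa> u"
proof -
  define s where "s = 8 / sqrt (2 * \<gamma>)"
  define G where "G = g\<^sup>2 / \<gamma> ^ 6"
  have s: "0 \<le> s"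
    using \<gamma> by (simp add: s_def)
  have mP: "m \<in> P1_vector_space \<Omega> \<T>" and m1: "\<And>p. p \<in> nodes \<T> \<Longrightarrow> norm (m p) = 1"
    using m by (auto simp: unit_P1_space_def P1_vector_space_def)
  have uP: "u \<in> P1_vector_space \<Omega> \<T>"
    unfolding u_def by (rule U_P1)
  have nodal: "norm (u p) = norm (V x p)"
    "norm (u p - u q) \<le> norm (V x p - V x q) + s * norm (m p - m q) * norm (V x q)"
    "norm (V x p - V x q) \<le> norm (u p - u q) + s * norm (m p - m q) * norm (u q)"
    if p: "p \<in> nodes \<T>" and q: "q \<in> nodes \<T>" for p q
  proof -
    have Q: "u r = (Tn ** householder (Tn *v m r)) *v V x r" if r: "r \<in> nodes \<T>" for r
    proof -
      obtain k where "k < N" "r = z k"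
        using nodeE[OF r] .
      then show ?thesis
        using U_Q_node[OF _ x] by (simp add: u_def)
    qed
    note hh = householder_nodal[OF T(2,1) m1[OF p] \<gamma>(2)[OF p] m1[OF q] \<gamma>(2)[OF q] \<gamma>(1)]
    show "norm (u p) = norm (V x p)"
      "norm (u p - u q) \<le> norm (V x p - V x q) + s * norm (m p - m q) * norm (V x q)"
      "norm (V x p - V x q) \<le> norm (u p - u q) + s * norm (m p - m q) * norm (u q)"
      unfolding Q[OF p] Q[OF q] s_def by (rule hh)+
  qed
  have "1024 * s\<^sup>2 * g\<^sup>2 \<le> 2 ^ 20 * G"
  proof -
    have s2: "s\<^sup>2 = 32 / \<gamma>"
      using \<gamma>(1) by (simp add: s_def power_divide)
    \<comment> \<open>Exactly what is needed for
      \<open>32 / \<gamma> \<le> 1024 / \<gamma> ^ 6\<close>; this leads from the square of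
      \<open>s\<close> to the sixth power in \<open>F\<close>.\<close>
    have "\<gamma> ^ 5 \<le> 2 ^ 5"
      using gamma_le_2[OF m T(2) \<gamma>(2)] \<gamma>(1) by (intro power_mono) auto
    then have "32 / \<gamma> \<le> 1024 / \<gamma> ^ 6"
      using \<gamma>(1) by (simp add: field_simps eval_nat_numeral)
    then have "1024 * s\<^sup>2 * g\<^sup>2 \<le> 1024 * (1024 / \<gamma> ^ 6) * g\<^sup>2"
      unfolding s2 by (intro mult_right_mono mult_left_mono) auto
    then show ?thesis
      by (simp add: G_def)
  qed
  then have sG: "1024 * s\<^sup>2 * g\<^sup>2 * t \<le> 2 ^ 20 * G * t" if "0 \<le> t" for t
    using that by (intro mult_right_mono) auto
  have F1: "1 \<le> F"
  proof -
    have "0 \<le> \<kappa> / (\<alpha>P * \<gamma> ^ 6) * g\<^sup>2"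
      using \<kappa> \<alpha>P \<gamma> by simp
    then show ?thesis
      using F by linarith
  qed
  have FG: "\<kappa> * G \<le> \<alpha>P * (F - 1)"
  proof -
    have "\<alpha>P * (\<kappa> / (\<alpha>P * \<gamma> ^ 6) * g\<^sup>2) \<le> \<alpha>P * (F - 1)"
      using F \<alpha>P by (intro mult_left_mono) auto
    then show ?thesis
      using \<alpha>P by (simp add: G_def)
  qed
  let ?I = "\<lambda>f. LINT p|lebesgue_on \<Omega>. (norm (f p))\<^sup>2"
  have Cm6: "0 \<le> Cm ^ 6"
    using Cm_ge_1 by simp
  \<comment> \<open>\<open>288\<close> is 32 times 3^2 for the three components of \<open>u\<close>;
    the two components of \<open>V x\<close> give \<open>128\<close> below, which is enlarged to the
    same constant.\<close>
  have grad1: "(LINT p|lebesgue_on \<Omega>. (norm (grad u p))\<^sup>2)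
      \<le> 288 * Cm ^ 6 * ((LINT p|lebesgue_on \<Omega>. (norm (grad (V x) p))\<^sup>2) + 2 ^ 20 * G * ?I (V x))"
  proof -
    have "(LINT p|lebesgue_on \<Omega>. (norm (grad u p))\<^sup>2)
        \<le> 288 * Cm ^ 6 * ((LINT p|lebesgue_on \<Omega>. (norm (grad (V x) p))\<^sup>2) + 1024 * s\<^sup>2 * g\<^sup>2 * ?I (V x))"
      using grad_nodal_comparison[OF uP V_P1 mP s nodal(2)] by (simp add: g_def)
    also have "\<dots> \<le> 288 * Cm ^ 6 * ((LINT p|lebesgue_on \<Omega>. (norm (grad (V x) p))\<^sup>2) + 2 ^ 20 * G * ?I (V x))"
      using Cm6 by (intro mult_left_mono add_left_mono sG) auto
    finally show ?thesis .
  qed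
  have grad2: "(LINT p|lebesgue_on \<Omega>. (norm (grad (V x) p))\<^sup>2)
      \<le> 288 * Cm ^ 6 * ((LINT p|lebesgue_on \<Omega>. (norm (grad u p))\<^sup>2) + 2 ^ 20 * G * ?I u)"
  proof -
    have "(LINT p|lebesgue_on \<Omega>. (norm (grad (V x) p))\<^sup>2)
        \<le> 128 * Cm ^ 6 * ((LINT p|lebesgue_on \<Omega>. (norm (grad u p))\<^sup>2) + 1024 * s\<^sup>2 * g\<^sup>2 * ?I u)"
      using grad_nodal_comparison[OF V_P1 uP mP s nodal(3)] by (simp add: g_def)
    also have "\<dots> \<le> 288 * Cm ^ 6 * ((LINT p|lebesgue_on \<Omega>. (norm (grad u p))\<^sup>2) + 2 ^ 20 * G * ?I u)"
      using Cm6 by (intro mult_mono add_left_mono sG) (auto intro!: add_nonneg_nonneg mult_nonneg_nonneg)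
    finally show ?thesis .
  qed
  show "energy \<Omega> \<alpha>P \<kappa> u \<le> 2 ^ 20 * (1 + 288 * Cm ^ 6) * F * energy \<Omega> \<alpha>P \<kappa> (V x)"
    unfolding energy_def
    by (rule energy_bound_arith[OF _ _ _ \<kappa> \<alpha>P F1 FG L2_nodal_comparison[OF uP V_P1] grad1])
      (use nodal(1) Cm6 in auto)
  show "energy \<Omega> \<alpha>P \<kappa> (V x) \<le> 2 ^ 20 * (1 + 288 * Cm ^ 6) * F * energy \<Omega> \<alpha>P \<kappa> u"
    unfolding energy_def
    by (rule energy_bound_arith[OF _ _ _ \<kappa> \<alpha>P F1 FG L2_nodal_comparison[OF V_P1 uP] grad2])
      (use nodal(1) Cm6 in auto)
qed

text \<open>The cross product is orthogonal to \<open>U y\<close> at every point, so the skew part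
  drops out. The mass part uses the lower bound on \<open>\<omega>\<close>; the stiffness part has
  coefficient 1, which exceeds \<open>\<alpha> / (2 * \<alpha>P)\<close> because
  \<open>\<alpha> \<le> \<alpha>P\<close>.\<close>

lemma system_coercive:
  assumes \<omega>: "ess_bounded (lebesgue_on \<Omega>) \<omega>" and lower: "\<And>p. \<alpha> / 2 \<le> \<omega> p"
    and m: "ess_bounded (lebesgue_on \<Omega>) m" and \<alpha>: "0 < \<alpha>" "\<alpha> \<le> \<alpha>P" and \<kappa>: "0 \<le> \<kappa>"
    and y: "y \<in> carrier_vec (3 * N)"
  shows "\<alpha> / (2 * \<alpha>P) * energy \<Omega> \<alpha>P \<kappa> (U y) \<le> scalar_prod y (system_matrix \<Omega> N \<phi> \<alpha> \<kappa> \<omega> m *\<^sub>v y)"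
proof -
  let ?a = "LINT p|lebesgue_on \<Omega>. (norm (U y p))\<^sup>2" and ?b = "LINT p|lebesgue_on \<Omega>. (norm (grad (U y) p))\<^sup>2"
  have Ub: "ess_bounded (lebesgue_on \<Omega>) (U y)"
    by (rule P1_ess_bounded[OF U_P1])
  have "\<alpha> / (2 * \<alpha>P) * energy \<Omega> \<alpha>P \<kappa> (U y) = \<alpha> / 2 * ?a + \<alpha> / (2 * \<alpha>P) * (\<kappa> * ?b)"
    using \<alpha> by (simp add: energy_def field_simps)
  also have "\<dots> \<le> \<alpha> / 2 * ?a + 1 * (\<kappa> * ?b)"
    using \<alpha> \<kappa> by (intro add_left_mono mult_right_mono) auto
  also have "\<alpha> / 2 * ?a \<le> L2_inner \<Omega> (\<lambda>p. \<omega> p *\<^sub>R U y p) (U y)"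
  proof -
    have "\<alpha> / 2 * ?a = (LINT p|lebesgue_on \<Omega>. \<alpha> / 2 * (norm (U y p))\<^sup>2)"
      by simp
    also have "\<dots> \<le> (LINT p|lebesgue_on \<Omega>. inner (\<omega> p *\<^sub>R U y p) (U y p))"
    proof (rule integral_mono)
      show "integrable (lebesgue_on \<Omega>) (\<lambda>p. \<alpha> / 2 * (norm (U y p))\<^sup>2)"
        using ess_bounded_integrable[OF finite_measure_domain ess_bounded_norm_sq[OF Ub]] by simp
      show "integrable (lebesgue_on \<Omega>) (\<lambda>p. inner (\<omega> p *\<^sub>R U y p) (U y p))"
        by (rule ess_bounded_integrable[OF finite_measure_domain ess_bounded_inner[OF ess_bounded_scaleR[OF \<omega> Ub] Ub]])
      show "\<alpha> / 2 * (norm (U y p))\<^sup>2 \<le> inner (\<omega> p *\<^sub>R U y p) (U y p)" for p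
        using mult_right_mono[OF lower[of p], of "(norm (U y p))\<^sup>2"] by (simp add: power2_norm_eq_inner)
    qed
    finally show ?thesis
      by (simp add: L2_inner_def)
  qed
  finally have "\<alpha> / (2 * \<alpha>P) * energy \<Omega> \<alpha>P \<kappa> (U y) \<le> L2_inner \<Omega> (\<lambda>p. \<omega> p *\<^sub>R U y p) (U y) + \<kappa> * ?b"
    by simp
  moreover have "L2_inner \<Omega> (\<lambda>p. cross3 (m p) (U y p)) (U y) = 0"
    by (simp add: L2_inner_def dot_cross_self)
  ultimately show ?thesis
    unfolding system_form[OF less_imp_neq[OF \<alpha>(1), symmetric] \<omega> m y y] L2_inner_self by simp
qed

text \<open>The mass part is bounded through |\<omega>| \<le> \<alpha>P + w and the skew part
  through |m| \<le> 1. Their sum \<open>\<alpha>P + w + 1\<close> is \<open>\<alpha>P\<close> times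
  the first factor of the bound, and that factor is at least the coefficient 1 of the stiffness
  part.\<close>

lemma system_bounded:
  assumes \<omega>: "ess_bounded (lebesgue_on \<Omega>) \<omega>"
    and m: "m \<in> P1_vector_space \<Omega> \<T>" "AE p in lebesgue_on \<Omega>. norm (m p) \<le> 1"
    and \<alpha>: "0 < \<alpha>" "0 < \<alpha>P" and \<kappa>: "0 \<le> \<kappa>" and s: "0 < s"
    and upper: "AE p in lebesgue_on \<Omega>. \<bar>\<omega> p - \<alpha>P\<bar> \<le> w" and w: "0 \<le> w"
    and x: "x \<in> carrier_vec (3 * N)" and y: "y \<in> carrier_vec (3 * N)"
  shows "2 * scalar_prod y (system_matrix \<Omega> N \<phi> \<alpha> \<kappa> \<omega> m *\<^sub>v x)
    \<le> (1 + 1 / \<alpha>P + w / \<alpha>P) * (s * energy \<Omega> \<alpha>P \<kappa> (U x) + energy \<Omega> \<alpha>P \<kappa> (U y) / s)"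
proof -
  define R where "R = 1 + 1 / \<alpha>P + w / \<alpha>P"
  define ax bx ay "by" where "ax = (LINT p|lebesgue_on \<Omega>. (norm (U x p))\<^sup>2)"
    and "bx = (LINT p|lebesgue_on \<Omega>. (norm (grad (U x) p))\<^sup>2)"
    and "ay = (LINT p|lebesgue_on \<Omega>. (norm (U y p))\<^sup>2)"
    and "by = (LINT p|lebesgue_on \<Omega>. (norm (grad (U y) p))\<^sup>2)"
  note Ub = P1_ess_bounded[OF U_P1] and gUb = grad_ess_bounded[OF U_P1]
  have mb: "ess_bounded (lebesgue_on \<Omega>) m"
    by (rule P1_ess_bounded[OF m(1)])
  have bil: "bounded_bilinear cross3"
    using bilinear_cross bilinear_conv_bounded_bilinear by blast
  have "AE p in lebesgue_on \<Omega>. norm (\<omega> p *\<^sub>R U y p) \<le> (\<alpha>P + w) * norm (U y p)"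
    using upper
  proof eventually_elim
    case (elim p)
    then have "\<bar>\<omega> p\<bar> \<le> \<alpha>P + w"
      using \<alpha>(2) by linarith
    then show ?case
      by (simp add: mult_right_mono)
  qed
  from L2_inner_young[OF ess_bounded_scaleR[OF \<omega> Ub] Ub Ub this _ s, of x]
  have 1: "2 * \<bar>L2_inner \<Omega> (\<lambda>p. \<omega> p *\<^sub>R U y p) (U x)\<bar> \<le> (\<alpha>P + w) * (s * ax + ay / s)"
    using \<alpha> w by (simp add: ax_def ay_def)
  have "AE p in lebesgue_on \<Omega>. norm (cross3 (m p) (U y p)) \<le> 1 * norm (U y p)"
    using m(2)
  proof eventually_elim
    case (elim p)
    show ?case
      using norm_cross3_le[of "m p" "U y p"] mult_right_mono[OF elim norm_ge_zero[of "U y p"]] by linarith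
  qed
  from L2_inner_young[OF ess_bounded_bilinear[OF bil mb Ub] Ub Ub this _ s, of x]
  have 2: "2 * \<bar>L2_inner \<Omega> (\<lambda>p. cross3 (m p) (U y p)) (U x)\<bar> \<le> s * ax + ay / s"
    by (simp add: ax_def ay_def)
  have "2 * \<bar>L2_inner \<Omega> (grad (U y)) (grad (U x))\<bar> \<le> s * bx + by / s"
    using L2_inner_young[OF gUb[of y] gUb[of x] gUb[of y], of 1 s] s by (simp add: bx_def by_def)
  then have 3: "\<kappa> * (2 * \<bar>L2_inner \<Omega> (grad (U y)) (grad (U x))\<bar>) \<le> \<kappa> * (s * bx + by / s)"
    by (rule mult_left_mono[OF _ \<kappa>])
  have nn: "0 \<le> s * bx + by / s"
    using s by (simp add: bx_def by_def)
  have R1: "1 \<le> R"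
    using \<alpha> w by (simp add: R_def)
  have "2 * scalar_prod y (system_matrix \<Omega> N \<phi> \<alpha> \<kappa> \<omega> m *\<^sub>v x)
      \<le> 2 * \<bar>L2_inner \<Omega> (\<lambda>p. \<omega> p *\<^sub>R U y p) (U x)\<bar> + \<kappa> * (2 * \<bar>L2_inner \<Omega> (grad (U y)) (grad (U x))\<bar>)
        + 2 * \<bar>L2_inner \<Omega> (\<lambda>p. cross3 (m p) (U y p)) (U x)\<bar>"
  proof -
    have "2 * (p + \<kappa> * q - r) \<le> 2 * \<bar>p\<bar> + \<kappa> * (2 * \<bar>q\<bar>) + 2 * \<bar>r\<bar>" for p q r :: real
      using mult_left_mono[OF abs_ge_self[of q] \<kappa>] by (simp add: algebra_simps)
    then show ?thesis
      unfolding system_form[OF less_imp_neq[OF \<alpha>(1), symmetric] \<omega> mb y x] .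
  qed
  also have "\<dots> \<le> (\<alpha>P + w + 1) * (s * ax + ay / s) + \<kappa> * (s * bx + by / s)"
    using 1 2 3 by (simp add: algebra_simps)
  also have "\<dots> \<le> (\<alpha>P + w + 1) * (s * ax + ay / s) + R * (\<kappa> * (s * bx + by / s))"
    using mult_right_mono[OF R1 mult_nonneg_nonneg[OF \<kappa> nn]] by simp
  also have "\<alpha>P + w + 1 = R * \<alpha>P"
    using \<alpha> by (simp add: R_def field_simps)
  also have "R * \<alpha>P * (s * ax + ay / s) + R * (\<kappa> * (s * bx + by / s))
      = R * (s * (\<alpha>P * ax + \<kappa> * bx) + (\<alpha>P * ay + \<kappa> * by) / s)"
    by (simp add: algebra_simps add_divide_distrib)
  finally show ?thesis
    unfolding energy_def ax_def ay_def bx_def by_def R_def .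
qed

end

section \<open>Assembly of the convergence estimate\<close>

context fe_basis
begin

lemma Q_matrix_carrier [simp]: "Q_matrix N z Tn m \<in> carrier_mat (3 * N) (2 * N)"
  by (simp add: Q_matrix_def)

lemma system_matrix_carrier [simp]: "system_matrix \<Omega> N \<phi> \<alpha> \<kappa> \<omega> m \<in> carrier_mat (3 * N) (3 * N)"
  unfolding system_matrix_def by (rule minus_carrier_mat) (simp add: skew3_def)

proposition pgmres_convergence:
  fixes m Tn \<gamma> \<alpha> \<alpha>P \<kappa> F \<omega> w x0 x b
  defines "Q \<equiv> Q_matrix N z Tn m"
  defines "A \<equiv> transpose_mat Q * system_matrix \<Omega> N \<phi> \<alpha> \<kappa> \<omega> m * Q"
    and "B \<equiv> \<alpha>P \<cdot>\<^sub>m mass2 \<Omega> N \<phi> + \<kappa> \<cdot>\<^sub>m stiff2 \<Omega> N \<phi>"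
  defines "r \<equiv> \<lambda>l. pgmres_residual (mat_inv B) A b (x l)"
  assumes m: "m \<in> unit_P1_space \<Omega> \<T>"
    and T: "\<And>x. Tn *v (Tn *v x) = x" "\<And>x. norm (Tn *v x) = norm x"
    and \<gamma>: "0 < \<gamma>" "\<And>p. p \<in> nodes \<T> \<Longrightarrow> \<gamma> \<le> 1 + (Tn *v m p) $ 3"
    and \<alpha>: "0 < \<alpha>" "\<alpha> \<le> \<alpha>P" and \<kappa>: "0 \<le> \<kappa>"
    and F: "1 + \<kappa> / (\<alpha>P * \<gamma> ^ 6) * (Linf_norm (lebesgue_on \<Omega>) (grad m))\<^sup>2 \<le> F"
    and \<omega>: "ess_bounded (lebesgue_on \<Omega>) \<omega>" "\<And>p. \<alpha> / 2 \<le> \<omega> p"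
    and w: "AE p in lebesgue_on \<Omega>. \<bar>\<omega> p - \<alpha>P\<bar> \<le> w" "0 \<le> w"
    and b: "b \<in> carrier_vec (2 * N)" and x0: "x0 \<in> carrier_vec (2 * N)"
    and it: "pgmres_iterates (mat_inv B) A b x0 x"
  shows "energy_norm B (r l)
    \<le> (1 - inverse (4 * (2 ^ 20 * (1 + 288 * Cm ^ 6)) ^ 4) * (\<alpha> / \<alpha>P)\<^sup>2
        * (1 + 1 / \<alpha>P + w / \<alpha>P) powi (-2) * F powi (-4)) powr (real l / 2)
      * energy_norm B (r 0)"
proof -
  define c3 where "c3 = 2 ^ 20 * (1 + 288 * Cm ^ 6)"
  define R where "R = 1 + 1 / \<alpha>P + w / \<alpha>P"
  \<comment> \<open>Coercivity and boundedness hold for \<open>U\<close>; passing to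
    \<open>V\<close> divides the first constant by the comparison factor \<open>c3 * F\<close> and
    multiplies the second by it.\<close>
  define c1 where "c1 = \<alpha> / (2 * \<alpha>P * (c3 * F))"
  define c2 where "c2 = R * (c3 * F)"
  define q where "q = 1 - inverse (4 * c3 ^ 4) * (\<alpha> / \<alpha>P)\<^sup>2 * R powi (-2) * F powi (-4)"
  have \<alpha>P: "0 < \<alpha>P"
    using \<alpha> by linarith
  have c3: "1 \<le> c3"
    using Cm_ge_1 by (simp add: c3_def)
  have F1: "1 \<le> F"
  proof -
    have "0 \<le> \<kappa> / (\<alpha>P * \<gamma> ^ 6) * (Linf_norm (lebesgue_on \<Omega>) (grad m))\<^sup>2"
      using \<kappa> \<alpha>P \<gamma> by simp
    then show ?thesis
      using F by linarith
  qed
  have R1: "1 \<le> R"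
    using \<alpha>P w by (simp add: R_def)
  have c3F: "0 < c3 * F"
    using c3 F1 by simp
  have c1: "0 < c1" and c2: "0 < c2"
    using \<alpha> \<alpha>P c3F R1 by (simp_all add: c1_def c2_def)
  have mP: "m \<in> P1_vector_space \<Omega> \<T>" and m1: "\<And>p. p \<in> nodes \<T> \<Longrightarrow> norm (m p) = 1"
    using m by (auto simp: unit_P1_space_def P1_vector_space_def)
  have mb: "ess_bounded (lebesgue_on \<Omega>) m"
    by (rule P1_ess_bounded[OF mP])
  \<comment> \<open>Unit length is known at the nodes only; between them convexity gives at most
    one.\<close>
  have m_le: "AE p in lebesgue_on \<Omega>. norm (m p) \<le> 1"
    using AE_unique_elem
  proof eventually_elim
    case (elim p)
    then obtain K where K: "K \<in> \<T>" "p \<in> interior K"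
      by blast
    have "norm (m a) \<le> 1" if "a \<in> verts K" for a
      using m1[of a] verts_subset[OF K(1)] that by fastforce
    from P1_convex_bound[OF mP K(1) this] show ?case
      using K interior_subset by blast
  qed
  have Qx: "Q *\<^sub>v x \<in> carrier_vec (3 * N)" if "x \<in> carrier_vec (2 * N)" for x
    unfolding Q_def by (rule mult_mat_vec_carrier[OF Q_matrix_carrier that])
  have A_form: "scalar_prod y (A *\<^sub>v x) = scalar_prod (Q *\<^sub>v y) (system_matrix \<Omega> N \<phi> \<alpha> \<kappa> \<omega> m *\<^sub>v (Q *\<^sub>v x))"
    if "x \<in> carrier_vec (2 * N)" "y \<in> carrier_vec (2 * N)" for x y
    unfolding A_def Q_def by (rule projected_form[OF Q_matrix_carrier system_matrix_carrier that])
  have B_form: "scalar_prod x (B *\<^sub>v x) = energy \<Omega> \<alpha>P \<kappa> (V x)" if "x \<in> carrier_vec (2 * N)" for x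
    unfolding B_def precond_form[OF that that] L2_inner_self energy_def ..
  have E: "energy \<Omega> \<alpha>P \<kappa> (U (Q *\<^sub>v x)) \<le> c3 * F * energy \<Omega> \<alpha>P \<kappa> (V x)"
    "energy \<Omega> \<alpha>P \<kappa> (V x) \<le> c3 * F * energy \<Omega> \<alpha>P \<kappa> (U (Q *\<^sub>v x))"
    if x: "x \<in> carrier_vec (2 * N)" for x
    unfolding c3_def Q_def by (rule energy_comparison[OF m T \<gamma> \<alpha>P \<kappa> F x]; assumption)+
  have "transpose_mat Q \<in> carrier_mat (2 * N) (3 * N)"
    by (simp add: Q_def)
  then have A: "A \<in> carrier_mat (2 * N) (2 * N)"
    unfolding A_def Q_def
    by (rule mult_carrier_mat[OF mult_carrier_mat[OF _ system_matrix_carrier] Q_matrix_carrier])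
  have B: "B \<in> carrier_mat (2 * N) (2 * N)"
    by (simp add: B_def mass2_def stiff2_def)
  have sym: "scalar_prod x (B *\<^sub>v y) = scalar_prod y (B *\<^sub>v x)"
    if "x \<in> carrier_vec (2 * N)" "y \<in> carrier_vec (2 * N)" for x y
    unfolding B_def precond_form[OF that] precond_form[OF that(2,1)] L2_inner_def
    by (simp only: inner_commute)
  have pos: "0 < scalar_prod x (B *\<^sub>v x)" if "x \<in> carrier_vec (2 * N)" "x \<noteq> 0\<^sub>v (2 * N)" for x
    unfolding B_form[OF that(1)] energy_def
    using V_pos[OF that] \<alpha>P \<kappa> by (intro add_pos_nonneg mult_pos_pos mult_nonneg_nonneg) auto
  have lower: "c1 * scalar_prod x (B *\<^sub>v x) \<le> scalar_prod x (A *\<^sub>v x)" if x: "x \<in> carrier_vec (2 * N)" for x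
  proof -
    have "c1 * energy \<Omega> \<alpha>P \<kappa> (V x) \<le> c1 * (c3 * F * energy \<Omega> \<alpha>P \<kappa> (U (Q *\<^sub>v x)))"
      using E(2)[OF x] c1 by (intro mult_left_mono) auto
    also have "\<dots> = \<alpha> / (2 * \<alpha>P) * energy \<Omega> \<alpha>P \<kappa> (U (Q *\<^sub>v x))"
      using c3 F1 by (auto simp: c1_def)
    also have "\<dots> \<le> scalar_prod x (A *\<^sub>v x)"
      unfolding A_form[OF x x] by (rule system_coercive[OF \<omega> mb \<alpha> \<kappa> Qx[OF x]])
    finally show ?thesis
      by (simp only: B_form[OF x])
  qed
  have upper: "2 * scalar_prod y (A *\<^sub>v x) \<le> c2\<^sup>2 * scalar_prod x (B *\<^sub>v x) + scalar_prod y (B *\<^sub>v y)"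
    if x: "x \<in> carrier_vec (2 * N)" and y: "y \<in> carrier_vec (2 * N)" for x y
  proof -
    \<comment> \<open>The weight in \<open>system_bounded\<close> is \<open>c2\<close>. Since
      \<open>R * (c3 * F)\<close> equals \<open>c2\<close>, the two energies end up with the factors
      c2^2 and 1.\<close>
    have "2 * scalar_prod y (A *\<^sub>v x)
        \<le> R * (c2 * energy \<Omega> \<alpha>P \<kappa> (U (Q *\<^sub>v x)) + energy \<Omega> \<alpha>P \<kappa> (U (Q *\<^sub>v y)) / c2)"
      unfolding A_form[OF x y] R_def
      by (rule system_bounded[OF \<omega>(1) mP m_le \<alpha>(1) \<alpha>P \<kappa> c2 w Qx[OF x] Qx[OF y]])
    also have "\<dots> \<le> R * (c2 * (c3 * F * energy \<Omega> \<alpha>P \<kappa> (V x)) + (c3 * F * energy \<Omega> \<alpha>P \<kappa> (V y)) / c2)"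
      using E(1)[OF x] E(1)[OF y] c2 R1
      by (intro mult_left_mono add_mono divide_right_mono) auto
    also have "\<dots> = c2\<^sup>2 * energy \<Omega> \<alpha>P \<kappa> (V x) + energy \<Omega> \<alpha>P \<kappa> (V y)"
    proof -
      have "R * (c3 * F) / c2 = 1"
        using R1 c3 F1 by (auto simp: c2_def)
      then have "R * ((c3 * F * t) / c2) = t" for t
        by (metis mult.assoc mult_1 times_divide_eq_left times_divide_eq_right)
      moreover have "R * (c2 * (c3 * F * t)) = c2\<^sup>2 * t" for t
        by (simp add: c2_def power2_eq_square)
      ultimately show ?thesis
        by (simp only: distrib_left)
    qed
    finally show ?thesis
      by (simp only: B_form[OF x] B_form[OF y])
  qed
  have step: "(energy_norm B (r (Suc l)))\<^sup>2 \<le> (1 - (c1 / c2)\<^sup>2) * (energy_norm B (r l))\<^sup>2"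
    "0 \<le> energy_norm B (r l)" for l
    unfolding r_def by (rule pgmres_residual_step[OF A B b x0 sym pos c1 c2 lower upper it]; assumption)+
  have ratio: "(c1 / c2)\<^sup>2 = inverse (4 * c3 ^ 4) * (\<alpha> / \<alpha>P)\<^sup>2 * R powi (-2) * F powi (-4)"
    using \<alpha>P c3 R1 F1
    by (simp add: c1_def c2_def power_int_minus power_divide power_mult_distrib field_simps eval_nat_numeral)
  have "1 - (c1 / c2)\<^sup>2 \<le> q"
    by (simp add: ratio q_def)
  \<comment> \<open>From \<open>\<alpha> \<le> \<alpha>P\<close> follows
    \<open>c1 \<le> 1 / 2\<close>, and \<open>c2\<close> is at least 1, so \<open>q\<close> is at
    least 3/4.\<close>
  moreover have "0 < q"
  proof -
    have "c1 \<le> 1 / 2"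
    proof -
      have "1 \<le> c3 * F"
        using mult_mono[OF c3 F1] c3 by simp
      then have "\<alpha>P * 1 \<le> \<alpha>P * (c3 * F)"
        using \<alpha>P by (intro mult_left_mono) auto
      then have "\<alpha> \<le> \<alpha>P * (c3 * F)"
        using \<alpha> by linarith
      then show ?thesis
        using \<alpha>P c3F unfolding c1_def by (subst divide_le_eq) (simp add: mult_pos_pos)
    qed
    moreover have "1 \<le> c2"
      using mult_mono[OF R1 mult_mono[OF c3 F1]] R1 c3 by (simp add: c2_def)
    ultimately have "c1 / c2 \<le> 1 / 2"
      using c1 frac_le[of "1 / 2" c1 1 c2] by simp
    then have "(c1 / c2)\<^sup>2 \<le> (1 / 2)\<^sup>2"
      using c1 c2 by (intro power_mono) auto
    also have "(1 / 2)\<^sup>2 < (1 :: real)"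
      by (simp add: power2_eq_square)
    finally show ?thesis
      by (simp only: q_def ratio diff_gt_0_iff_gt)
  qed
  ultimately have "energy_norm B (r l) \<le> q powr (real l / 2) * energy_norm B (r 0)"
    by (rule powr_half_bound_of_square_recursion[of "\<lambda>l. energy_norm B (r l)", OF step])
  then show ?thesis
    by (simp only: q_def c3_def R_def)
qed

end

theorem corollary6:
  fixes Cmesh :: real
  shows "\<exists>C>1. \<forall>(\<Omega> :: (real^3) set) (\<T> :: (real^3) set set) (h :: real)
      (N :: nat) (z :: nat \<Rightarrow> real^3) (\<phi> :: nat \<Rightarrow> real^3 \<Rightarrow> real)
      (\<alpha> :: real) (l_ex :: real) (T :: real) (M :: nat) (n :: nat)
      (\<pi> :: (real^3 \<Rightarrow> real^3) \<Rightarrow> real^3 \<Rightarrow> real^3) (f :: real \<Rightarrow> real^3 \<Rightarrow> real^3)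
      (\<beta> :: real \<Rightarrow> real) (W :: real \<Rightarrow> real \<Rightarrow> real)
      (Lh :: (real^3 \<Rightarrow> real^3) \<Rightarrow> (real^3 \<Rightarrow> real^3) \<Rightarrow> real^3 \<Rightarrow> real^3)
      (m :: real^3 \<Rightarrow> real^3) (m_old :: real^3 \<Rightarrow> real^3) (Tn :: real^3^3)
      (\<alpha>P :: real) (\<gamma> :: real) (x0 :: real Matrix.vec) (x :: nat \<Rightarrow> real Matrix.vec).
    lipschitz_domain \<Omega> \<and> bounded \<Omega> \<and> 0 < h \<and> quasi_uniform_mesh Cmesh h \<Omega> \<T> \<and>
    bij_betw z {..<N} (nodes \<T>) \<and> hat_functions \<Omega> \<T> N z \<phi> \<and>
    0 < \<alpha> \<and> \<alpha> \<le> 1 \<and> 0 < l_ex \<and> 0 < T \<and> n < M \<and>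
    bounded_operator_H1_L2 \<Omega> \<pi> \<and> C1_into_L2 \<Omega> T f \<and>
    (\<forall>k>0. 0 < \<beta> k) \<and> ((\<lambda>k. \<beta> k * k) \<longlongrightarrow> 0) (at_right 0) \<and>
    (\<forall>k>0. W k \<in> borel_measurable borel \<and> bounded (range (W k)) \<and> (\<forall>s. 0 < W k s)) \<and>
    ((\<lambda>k. Linf_norm lebesgue (\<lambda>s. W k s - \<alpha>)) \<longlongrightarrow> 0) (at_right 0) \<and>
    (INF k\<in>{0<..}. INF s. W k s) \<ge> \<alpha> / 2 \<and>
    m \<in> unit_P1_space \<Omega> \<T> \<and> m_old \<in> unit_P1_space \<Omega> \<T> \<and> Lh m m_old \<in> L2_space \<Omega> \<and>
    invertible Tn \<and> Tn = matrix_inv Tn \<and> Tn = Finite_Cartesian_Product.transpose Tn \<and>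
    \<alpha> \<le> \<alpha>P \<and> 0 < \<gamma> \<and> (\<forall>p\<in>nodes \<T>. \<gamma> \<le> 1 + (Tn *v m p) $ 3) \<and>
    x0 \<in> carrier_vec (2 * N)
    \<longrightarrow>
    (let k = T / real M;
         lam = lambda_fun l_ex (f (k * real n)) \<pi> m;
         Q = Q_matrix N z Tn m;
         A\<^sub>Q = transpose_mat Q * system_matrix \<Omega> N \<phi> \<alpha> (\<beta> k * k) (\<lambda>p. W k (lam p)) m * Q;
         b\<^sub>Q = transpose_mat Q *\<^sub>v system_rhs \<Omega> N \<phi> l_ex (Lh m m_old) m;
         B = \<alpha>P \<cdot>\<^sub>m mass2 \<Omega> N \<phi> + (\<beta> k * k) \<cdot>\<^sub>m stiff2 \<Omega> N \<phi>;
         P = mat_inv B;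
         F = 1 + \<gamma> powi (-2) +
             \<beta> k * k / (\<alpha>P * \<gamma> ^ 6) * (Linf_norm (lebesgue_on \<Omega>) (grad m))\<^sup>2
     in pgmres_iterates P A\<^sub>Q b\<^sub>Q x0 x \<longrightarrow>
        1 \<le> F \<and>
        (\<forall>l. energy_norm B (pgmres_residual P A\<^sub>Q b\<^sub>Q (x l))
           \<le> (1 - inverse C * (\<alpha> / \<alpha>P)\<^sup>2 *
                (1 + 1 / \<alpha>P +
                 Linf_norm (lebesgue_on \<Omega>) (\<lambda>p. W k (lam p) - \<alpha>P) / \<alpha>P) powi (-2) *
                F powi (-4)) powr (real l / 2)
             * energy_norm B (pgmres_residual P A\<^sub>Q b\<^sub>Q (x 0))))"
proof -
  \<comment> \<open>\<open>Cmesh\<close> is an arbitrary real number at this point, with no mesh at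
    hand to force \<open>Cmesh \<ge> 1\<close>; the even exponent makes \<open>C > 1\<close> all the
    same.\<close>
  define C where "C = 4 * (2 ^ 20 * (1 + 288 * Cmesh ^ 6)) ^ 4"
  have "1 \<le> 2 ^ 20 * (1 + 288 * Cmesh ^ 6)"
    by simp
  then have "1 \<le> (2 ^ 20 * (1 + 288 * Cmesh ^ 6)) ^ 4"
    by (rule one_le_power)
  then have C: "1 < C"
    unfolding C_def by linarith
  show ?thesis
  proof (rule exI[of _ C], intro conjI C allI impI, elim conjE, unfold Let_def, intro impI conjI allI)
    fix \<Omega> :: "(real^3) set" and \<T> :: "(real^3) set set" and h :: real
      and N :: nat and z :: "nat \<Rightarrow> real^3" and \<phi> :: "nat \<Rightarrow> real^3 \<Rightarrow> real"
      and \<alpha> l_ex T :: real and M n :: nat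
      and \<pi> :: "(real^3 \<Rightarrow> real^3) \<Rightarrow> real^3 \<Rightarrow> real^3" and f :: "real \<Rightarrow> real^3 \<Rightarrow> real^3"
      and \<beta> :: "real \<Rightarrow> real" and W :: "real \<Rightarrow> real \<Rightarrow> real"
      and Lh :: "(real^3 \<Rightarrow> real^3) \<Rightarrow> (real^3 \<Rightarrow> real^3) \<Rightarrow> real^3 \<Rightarrow> real^3"
      and m m_old :: "real^3 \<Rightarrow> real^3" and Tn :: "real^3^3"
      and \<alpha>P \<gamma> :: real and x0 :: "real Matrix.vec" and x :: "nat \<Rightarrow> real Matrix.vec"
    let ?k = "T / real M"
    let ?lam = "lambda_fun l_ex (f (?k * real n)) \<pi> m"
    let ?\<omega> = "\<lambda>p. W ?k (?lam p)"
    let ?\<kappa> = "\<beta> ?k * ?k"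
    let ?Q = "Q_matrix N z Tn m"
    let ?A = "transpose_mat ?Q * system_matrix \<Omega> N \<phi> \<alpha> ?\<kappa> ?\<omega> m * ?Q"
    let ?b = "transpose_mat ?Q *\<^sub>v system_rhs \<Omega> N \<phi> l_ex (Lh m m_old) m"
    let ?B = "\<alpha>P \<cdot>\<^sub>m mass2 \<Omega> N \<phi> + ?\<kappa> \<cdot>\<^sub>m stiff2 \<Omega> N \<phi>"
    let ?F = "1 + \<gamma> powi (-2) + ?\<kappa> / (\<alpha>P * \<gamma> ^ 6) * (Linf_norm (lebesgue_on \<Omega>) (grad m))\<^sup>2"
    let ?w = "Linf_norm (lebesgue_on \<Omega>) (\<lambda>p. W ?k (?lam p) - \<alpha>P)"
    assume dom: "lipschitz_domain \<Omega>" "bounded \<Omega>" "0 < h" "quasi_uniform_mesh Cmesh h \<Omega> \<T>"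
      and basis: "bij_betw z {..<N} (nodes \<T>)" "hat_functions \<Omega> \<T> N z \<phi>"
      and \<alpha>: "0 < \<alpha>" "\<alpha> \<le> \<alpha>P" and T: "0 < T" "n < M"
      and \<pi>: "bounded_operator_H1_L2 \<Omega> \<pi>" and f: "C1_into_L2 \<Omega> T f"
      and \<beta>: "\<forall>k>0. 0 < \<beta> k"
      and W: "\<forall>k>0. W k \<in> borel_measurable borel \<and> bounded (range (W k)) \<and> (\<forall>s. 0 < W k s)"
        "(INF k\<in>{0<..}. INF s. W k s) \<ge> \<alpha> / 2"
      and m: "m \<in> unit_P1_space \<Omega> \<T>"
      and Tn: "invertible Tn" "Tn = matrix_inv Tn" "Tn = Finite_Cartesian_Product.transpose Tn"
      and \<gamma>: "0 < \<gamma>" "\<forall>p\<in>nodes \<T>. \<gamma> \<le> 1 + (Tn *v m p) $ 3"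
      and x0: "x0 \<in> carrier_vec (2 * N)"
      and it: "pgmres_iterates (mat_inv ?B) ?A ?b x0 x"
    interpret fe_basis Cmesh h \<Omega> \<T> N z \<phi>
      using dom basis by unfold_locales
    \<comment> \<open>\<open>n < M\<close> excludes \<open>M = 0\<close>, for which division by zero
      would make the step size \<open>0\<close>.\<close>
    have k: "0 < ?k" "?k * real n \<in> {0..T}"
      using T by (auto simp: field_simps)
    have \<kappa>: "0 < ?\<kappa>"
      using \<beta> k(1) by (blast intro: mult_pos_pos)
    have \<alpha>P: "0 < \<alpha>P"
      using \<alpha> by linarith
    have mP: "m \<in> P1_vector_space \<Omega> \<T>"
      using m by (auto simp: unit_P1_space_def P1_vector_space_def)
    have W_pos: "0 \<le> W k s" if "0 < k" for k s
      using W(1) that by (simp add: less_imp_le)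
    have W_lower: "\<alpha> / 2 \<le> W ?k s" for s
    proof -
      \<comment> \<open>A real infimum lies below the values only if these are bounded below;
        positivity of \<open>W\<close> supplies the bound \<open>0\<close> for both infima.\<close>
      have "(INF k\<in>{0<..}. INF s. W k s) \<le> (INF s. W ?k s)"
        using k(1) W_pos by (intro cINF_lower bdd_belowI2[of _ 0] cINF_greatest) auto
      also have "\<dots> \<le> W ?k s"
        using k(1) W_pos by (intro cINF_lower bdd_belowI2[of _ 0]) auto
      finally show ?thesis
        using W(2) by linarith
    qed
    have [measurable]: "m \<in> borel_measurable (lebesgue_on \<Omega>)" "grad m \<in> borel_measurable (lebesgue_on \<Omega>)"
      "f (?k * real n) \<in> borel_measurable (lebesgue_on \<Omega>)" "\<pi> m \<in> borel_measurable (lebesgue_on \<Omega>)"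
      "W ?k \<in> borel_measurable borel"
      using ess_bounded_measurable[OF P1_ess_bounded[OF mP]] ess_bounded_measurable[OF grad_ess_bounded[OF mP]]
        f k \<pi> P1_H1[OF mP] W(1)
      by (auto simp: C1_into_L2_def L2_space_def bounded_operator_H1_L2_def)
    have "(\<lambda>p. W ?k (?lam p)) \<in> borel_measurable (lebesgue_on \<Omega>)"
      unfolding lambda_fun_def by measurable
    moreover obtain c where "\<And>s. \<bar>W ?k s\<bar> \<le> c"
      using W(1) k(1) unfolding bounded_iff by (metis rangeI real_norm_def)
    ultimately have \<omega>: "ess_bounded (lebesgue_on \<Omega>) ?\<omega>"
      by (intro ess_boundedI[of _ _ c]) auto
    have \<omega>': "ess_bounded (lebesgue_on \<Omega>) (\<lambda>p. ?\<omega> p - \<alpha>P)"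
      using ess_bounded_add[OF \<omega> ess_bounded_const[of _ "- \<alpha>P"]] by simp
    have F: "1 + ?\<kappa> / (\<alpha>P * \<gamma> ^ 6) * (Linf_norm (lebesgue_on \<Omega>) (grad m))\<^sup>2 \<le> ?F"
      using \<gamma>(1) by simp
    have "0 \<le> \<kappa>' / (\<alpha>P * \<gamma> ^ 6) * t\<^sup>2" if "0 \<le> \<kappa>'" for \<kappa>' t
      using that \<alpha>P \<gamma>(1) by simp
    from this[OF less_imp_le[OF \<kappa>], of "Linf_norm (lebesgue_on \<Omega>) (grad m)"] F show "1 \<le> ?F"
      by linarith
    have b: "?b \<in> carrier_vec (2 * N)"
      by (rule mult_mat_vec_carrier[of _ _ "3 * N"]) (simp_all add: Q_matrix_def system_rhs_def)
    have w: "AE p in lebesgue_on \<Omega>. \<bar>?\<omega> p - \<alpha>P\<bar> \<le> ?w"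
      using Linf_norm_bound(1)[OF \<omega>'] by simp
    show "energy_norm ?B (pgmres_residual (mat_inv ?B) ?A ?b (x l))
        \<le> (1 - inverse C * (\<alpha> / \<alpha>P)\<^sup>2 * (1 + 1 / \<alpha>P + ?w / \<alpha>P) powi (-2) * ?F powi (-4)) powr (real l / 2)
          * energy_norm ?B (pgmres_residual (mat_inv ?B) ?A ?b (x 0))" for l
      unfolding C_def
      by (rule pgmres_convergence[OF m symmetric_involution_isometry[OF Tn] \<gamma>(1) bspec[OF \<gamma>(2)] \<alpha>
          less_imp_le[OF \<kappa>] F \<omega> W_lower w Linf_norm_bound(2)[OF \<omega>'] b x0 it])
  qed
qed

end
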